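(* There is a fully polynomial-time randomised approximation scheme (FPRAS) for counting the bases of a bicircular matroid, with time complexity $O(n^3m^2\varepsilon^{-2})$, where the input is a connected simple graph $G$ with $n$ vertices and $m\ge n$ edges and $\varepsilon\in(0,1)$ is the accuracy parameter.
   Context: The bicircular matroid of a connected graph $G=(V,E)$ with $|E|\ge|V|$ has ground set $E$; its bases are the sets $R\subseteq E$ such that every connected component of $(V,R)$ contains exactly one cycle. An FPRAS for the number $N(G)$ of bases is a randomised algorithm that, given $G$ and $\varepsilon\in(0,1)$, outputs an estimate $\hat N$ with $\Pr[(1-\varepsilon)N(G)\le \hat N\le(1+\varepsilon)N(G)]\ge 3/4$, in time polynomial in the size of $G$ and $\varepsilon^{-1}$. *)

theory Defs
  imports "HOL-Probability.Probability"
begin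

section \<open>Bases of the bicircular matroid of a simple graph\<close>

definition simple_graph :: "'a set \<Rightarrow> 'a set set \<Rightarrow> bool" where
  "simple_graph V E \<longleftrightarrow> finite V \<and> (\<forall>e\<in>E. e \<subseteq> V \<and> card e = 2)"

definition reachability :: "'a set \<Rightarrow> 'a set set \<Rightarrow> ('a \<times> 'a) set" where
  "reachability V E = {(u, v). u \<in> V \<and> v \<in> V \<and> (u, v) \<in> {(x, y). {x, y} \<in> E}\<^sup>*}"

definition components :: "'a set \<Rightarrow> 'a set set \<Rightarrow> 'a set set" where
  "components V E = V // reachability V E"

definition connected_graph :: "'a set \<Rightarrow> 'a set set \<Rightarrow> bool" where
  "connected_graph V E \<longleftrightarrow> V \<noteq> {} \<and> (\<forall>u\<in>V. \<forall>v\<in>V. (u, v) \<in> reachability V E)"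

text \<open>A cycle is identified with its set of edges, so that neither the starting
  point nor the direction of traversal matters.\<close>

definition is_cycle :: "'a set set \<Rightarrow> bool" where
  "is_cycle C \<longleftrightarrow> (\<exists>vs. 3 \<le> length vs \<and> distinct vs \<and>
     C = {{vs ! i, vs ! (Suc i mod length vs)} | i. i < length vs})"

definition bicircular_bases :: "'a set \<Rightarrow> 'a set set \<Rightarrow> 'a set set set" where
  "bicircular_bases V E =
     {R. R \<subseteq> E \<and> (\<forall>K\<in>components V R. \<exists>!C. is_cycle C \<and> C \<subseteq> {e \<in> R. e \<subseteq> K})}"


section \<open>Randomised random access programs\<close>

text \<open>
  The model of computation is the unit-cost random access machine whose arithmetic
  consists of addition and truncated subtraction of natural numbers (no
  multiplication, so that unit-cost time is polynomially related to Turing machine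
  time), presented as a while language. A state consists of finitely many relevant
  named registers and an unbounded, indirectly addressable memory. The only source
  of randomness is an instruction drawing a uniformly distributed number.
\<close>

type_synonym state = "(string \<Rightarrow> nat) \<times> (nat \<Rightarrow> nat)"

datatype aexp = Const nat | Reg string | Mem aexp | Plus aexp aexp | Minus aexp aexp

fun aval :: "aexp \<Rightarrow> state \<Rightarrow> nat" where
  "aval (Const k) s = k"
| "aval (Reg x) s = fst s x"
| "aval (Mem a) s = snd s (aval a s)"
| "aval (Plus a b) s = aval a s + aval b s"
| "aval (Minus a b) s = aval a s - aval b s"

datatype com =
    Skip
  | Assign string aexp
  | Store aexp aexp
  | Draw string aexp
  | Seq com com
  | Cond aexp com com
  | While aexp com

text \<open>
  One step of a program. A guard counts as true if it is nonzero; \<open>Draw x a\<close> draws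
  from \<open>{0, ..., a}\<close>, inclusively. Expressions occurring in a program have a fixed
  size, so every step performs a bounded number of elementary operations.
\<close>

fun step :: "com \<times> state \<Rightarrow> (com \<times> state) pmf" where
  "step (Skip, s) = return_pmf (Skip, s)"
| "step (Assign x a, s) = return_pmf (Skip, ((fst s)(x := aval a s), snd s))"
| "step (Store a b, s) = return_pmf (Skip, (fst s, (snd s)(aval a s := aval b s)))"
| "step (Draw x a, s) =
     map_pmf (\<lambda>k. (Skip, ((fst s)(x := k), snd s))) (pmf_of_set {0..aval a s})"
| "step (Seq c d, s) =
     (if c = Skip then return_pmf (d, s)
      else map_pmf (\<lambda>(c', s'). (Seq c' d, s')) (step (c, s)))"
| "step (Cond a c d, s) = return_pmf (if aval a s \<noteq> 0 then c else d, s)"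
| "step (While a c, s) =
     return_pmf (if aval a s \<noteq> 0 then Seq c (While a c) else Skip, s)"

fun run :: "nat \<Rightarrow> com \<times> state \<Rightarrow> (com \<times> state) pmf" where
  "run 0 cfg = return_pmf cfg"
| "run (Suc t) cfg = bind_pmf (step cfg) (run t)"

text \<open>Registers initially hold zero; the input words occupy the first memory cells.\<close>

definition initial_state :: "nat list \<Rightarrow> state" where
  "initial_state ws = ((\<lambda>_. 0), (\<lambda>i. if i < length ws then ws ! i else 0))"

definition halts_within :: "com \<Rightarrow> nat list \<Rightarrow> nat \<Rightarrow> bool" where
  "halts_within P ws t \<longleftrightarrow> (\<forall>cfg\<in>set_pmf (run t (P, initial_state ws)). fst cfg = Skip)"

text \<open>The number returned is a fraction: numerator and denominator are left in the
  first two memory cells.\<close>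

definition result :: "state \<Rightarrow> real" where
  "result s = real (snd s 0) / real (snd s 1)"

definition output_dist :: "com \<Rightarrow> nat list \<Rightarrow> nat \<Rightarrow> real pmf" where
  "output_dist P ws t = map_pmf (\<lambda>(c, s). result s) (run t (P, initial_state ws))"


section \<open>Randomised approximation schemes\<close>

text \<open>
  The accuracy parameter is the rational number \<open>\<epsilon> = p / q\<close>, given to the program as
  the two words \<open>p\<close> and \<open>q\<close> in front of the encoded instance. The time bound
  \<open>T\<close> holds for every run, not merely in expectation.
\<close>

definition approx_scheme_in_time ::
  "'i set \<Rightarrow> ('i \<Rightarrow> nat list) \<Rightarrow> ('i \<Rightarrow> nat) \<Rightarrow> com \<Rightarrow> ('i \<Rightarrow> real \<Rightarrow> real) \<Rightarrow> bool" where
  "approx_scheme_in_time I enc N P T \<longleftrightarrow>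
     (\<forall>x\<in>I. \<forall>p q \<epsilon>. 0 < p \<and> p < q \<and> \<epsilon> = real p / real q \<longrightarrow>
        (\<exists>t. real t \<le> T x \<epsilon> \<and> halts_within P (p # q # enc x) t \<and>
             measure_pmf.prob (output_dist P (p # q # enc x) t)
               {z. (1 - \<epsilon>) * real (N x) \<le> z \<and> z \<le> (1 + \<epsilon>) * real (N x)} \<ge> 3 / 4))"

definition is_fpras :: "'i set \<Rightarrow> ('i \<Rightarrow> nat list) \<Rightarrow> ('i \<Rightarrow> nat) \<Rightarrow> com \<Rightarrow> bool" where
  "is_fpras I enc N P \<longleftrightarrow>
     (\<exists>c k. approx_scheme_in_time I enc N P
        (\<lambda>x \<epsilon>. c * (real (length (enc x)) + 1 / \<epsilon>) ^ k))"


section \<open>Graphs as inputs\<close>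

text \<open>
  A graph with \<open>n\<close> vertices is presented as \<open>(n, es)\<close>, where the vertices are
  \<open>0, ..., n - 1\<close> and \<open>es\<close> lists every edge exactly once, in an arbitrary order
  and with its two ends in an arbitrary order.
\<close>

type_synonym graph_input = "nat \<times> (nat \<times> nat) list"

definition vertices :: "graph_input \<Rightarrow> nat set" where
  "vertices G = {..<fst G}"

definition edges :: "graph_input \<Rightarrow> nat set set" where
  "edges G = (\<lambda>(u, v). {u, v}) ` set (snd G)"

definition bicircular_inputs :: "graph_input set" where
  "bicircular_inputs = {G. distinct (map (\<lambda>(u, v). {u, v}) (snd G)) \<and>
     simple_graph (vertices G) (edges G) \<and> connected_graph (vertices G) (edges G) \<and>
     card (vertices G) \<le> card (edges G)}"

definition encode_graph :: "graph_input \<Rightarrow> nat list" where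
  "encode_graph G = fst G # length (snd G) # concat (map (\<lambda>(u, v). [u, v]) (snd G))"

definition num_bases :: "graph_input \<Rightarrow> nat" where
  "num_bases G = card (bicircular_bases (vertices G) (edges G))"

end

(* Orient a basis R so that every vertex v points along its own edge {v, f v}: each component of R then
   contains exactly one directed cycle. A rule allowing exactly one of the two directions of each cycle
   and no 2-cycle turns bases into the "good" maps f, those all of whose cycles are allowed.
   Good maps on a vertex set W are sampled by cycle popping: keep a set W of active vertices, pick the
   least inactive v, let it point to a random vertex, and if this closes a forbidden cycle S (or the
   target is no neighbour) deactivate S. Given W, the current map is uniform on the good maps on W,
   since removing a forbidden cycle S leaves an arbitrary good map on W - S. Hence the set W performs a
   Markov chain; its expected hitting time of the full vertex set is a ratio of weighted counts of good
   maps, which is O(n^3) by an augmenting path argument.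
   The samples yield the count without self-reduction: let W_i = {0, ..., i - 1} and let g(W) be the
   number of good maps on W.
   From W_i the vertex i gets accepted with probability g(W_{i+1}) / (n g(W_i)), so the number of draws at
   W_i until the first acceptance is geometric with that parameter, and the product of these means
   over i < n is n^n / g(V). A geometric variable has relative variance at most 1, so averaging
   O(n / \<epsilon>^2) runs suffices. The analysis avoids infinite runs: the conditional mean square error and the
   expected remaining number of draws are explicit potentials of the chain stopped after a fixed budget. *)
theory Submission
  imports Defs "HOL-Combinatorics.Orbits"
begin

text \<open>Uniformity given \<open>W\<close> is never stated as a conditional law. Probabilities
  are summed over all of \<open>good W\<close> (\<open>prob_sum\<close>), and the counting identity
  \<open>sum_draw_step\<close> turns one draw into a recurrence over active sets, along which every
  estimate for the chain is an induction. The cubic bound rests on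
  \<open>card (good (W - {u})) \<le> n * card (good W)\<close>: for popped loops and 2-cycles this
  ratio gives one factor n, the sums over the deactivated vertex and over the drawn target the other
  two. Longer cycles are cheaper, since reversing one gives a good map at once. With
  \<open>s\<close> runs the relative second moments multiply to at most \<open>exp (n / s)\<close>,
  whence \<open>s\<close> of order n / \<epsilon>^2 and a budget \<open>B\<close> of order n^4 /
  \<epsilon>^2 iterations. Each iteration scans an unsorted edge list in time O(n + m), so the total
  is n^4 m / \<epsilon>^2 up to a constant, and n \<le> m gives the claimed form. The machine cannot
  multiply. The final products are computed by repeated addition in time linear in the second
  factor, so the huge partial products always come first and the draw counts must be bounded by
  \<open>B\<close>.\<close>

section \<open>Cycles of self-maps and good maps\<close>

text \<open>On a cycle \<open>S\<close> of \<open>f\<close>, the vertex \<open>p\<close> is the predecessor of the least vertex. Exactly one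
  of the two directions of a cycle of length at least 3 satisfies the condition; fixed points and
  2-cycles never do.\<close>

definition ok_cycle :: "(nat \<Rightarrow> nat) \<Rightarrow> nat set \<Rightarrow> bool" where
  "ok_cycle f S \<longleftrightarrow> (\<exists>p\<in>S. f p = Min S \<and> f (Min S) < p)"

definition glue :: "'a set \<Rightarrow> ('a \<Rightarrow> 'b) \<Rightarrow> ('a \<Rightarrow> 'b) \<Rightarrow> 'a \<Rightarrow> 'b" where
  "glue S f g = (\<lambda>u. if u \<in> S then f u else g u)"

text \<open>Skipping fixed points keeps the active set out of the definition: for a map in
  \<open>maps W\<close> the fixed points are exactly the vertices outside \<open>W\<close>.\<close>

definition edge_set :: "('a \<Rightarrow> 'a) \<Rightarrow> 'a set set" where
  "edge_set f = {{v, f v} | v. f v \<noteq> v}"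

lemma edge_setI: "f v \<noteq> v \<Longrightarrow> {v, f v} \<in> edge_set f"
  unfolding edge_set_def by blast

lemma cyclic_on_image_eq:
  assumes "cyclic_on f S" shows "f ` S = S"
proof
  show "f ` S \<subseteq> S" using cyclic_on_inI[OF assms] by blast
  show "S \<subseteq> f ` S"
  proof
    fix y assume "y \<in> S"
    then have "y \<in> orbit f y" using assms by (simp add: orbit_cyclic_eq3)
    then show "y \<in> f ` S"
    proof cases
      case base then show ?thesis using \<open>y \<in> S\<close> by blast
    next
      case (step z)
      then have "z \<in> S" using assms \<open>y \<in> S\<close> by (simp add: orbit_cyclic_eq3)
      then show ?thesis using step by blast
    qed
  qed
qed

lemma cyclic_on_inj_on:
  assumes "cyclic_on f S" shows "inj_on f S"
  by (rule eq_card_imp_inj_on) (simp_all add: cyclic_on_image_eq[OF assms] finite_cyclic_on[OF assms])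

lemma cyclic_on_bij_betw:
  assumes "cyclic_on f S" shows "bij_betw f S S"
  using cyclic_on_inj_on[OF assms] cyclic_on_image_eq[OF assms] by (simp add: bij_betw_def)

lemma cyclic_on_self_orbit:
  "v \<in> orbit f v \<Longrightarrow> cyclic_on f (orbit f v)" by (auto simp: cyclic_on_def)

lemma ok_cycle_cong:
  assumes "cyclic_on f S" "\<And>u. u \<in> S \<Longrightarrow> f u = g u"
  shows "ok_cycle f S \<longleftrightarrow> ok_cycle g S"
proof -
  have "Min S \<in> S" using assms(1) finite_cyclic_on cyclic_on_alldef by (metis Min_in)
  then show ?thesis using assms(2) by (auto simp: ok_cycle_def)
qed

lemma cyclic_on_inverse:
  assumes "cyclic_on f S" "\<And>u. u \<in> S \<Longrightarrow> g (f u) = u"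
  shows "cyclic_on g S"
proof -
  obtain s where s: "s \<in> S" using assms(1) unfolding cyclic_on_def by blast
  have gS: "g u \<in> S" if u: "u \<in> S" for u
  proof -
    obtain w where "w \<in> S" "u = f w" using cyclic_on_image_eq[OF assms(1)] u by blast
    then show ?thesis using assms(2) by simp
  qed
  have "orbit g s = S"
  proof
    show "orbit g s \<subseteq> S"
    proof
      fix y assume "y \<in> orbit g s" then show "y \<in> S" by induct (auto intro: gS s)
    qed
    show "S \<subseteq> orbit g s"
    proof
      fix t assume t: "t \<in> S"
      then have "s \<in> orbit f t" using assms(1) s by (simp add: orbit_cyclic_eq3)
      then obtain j where j: "0 < j" "s = (f ^^ j) t" by (auto simp: orbit_altdef)
      have "(g ^^ i) ((f ^^ i) t) = t" for i
      proof (induction i)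
        case (Suc i)
        have "(g ^^ Suc i) ((f ^^ Suc i) t) = (g ^^ i) (g (f ((f ^^ i) t)))"
          by (simp add: funpow_swap1)
        also have "\<dots> = (g ^^ i) ((f ^^ i) t)" using assms t by (simp add: cyclic_on_funpow_in)
        finally show ?case using Suc by simp
      qed simp
      then have "(g ^^ j) s = t" using j by simp
      then show "t \<in> orbit g s" using j(1) unfolding orbit_altdef by blast
    qed
  qed
  then show ?thesis using s unfolding cyclic_on_def by blast
qed

text \<open>Inverting the cycle exchanges the predecessor and the successor of the least vertex.
  They differ because there are no 2-cycles, so exactly one of the two strict inequalities
  holds.\<close>

lemma ok_cycle_inverse:
  assumes "cyclic_on f S" "\<And>u. u \<in> S \<Longrightarrow> g (f u) = u" "\<And>u. u \<in> S \<Longrightarrow> f (f u) \<noteq> u"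
  shows "ok_cycle g S \<longleftrightarrow> \<not> ok_cycle f S"
proof -
  let ?m = "Min S"
  have m: "?m \<in> S" using assms(1) finite_cyclic_on cyclic_on_alldef by (metis Min_in)
  obtain p where p: "p \<in> S" "f p = ?m"
    using cyclic_on_bij_betw[OF assms(1)] m by (metis bij_betw_def imageE)
  have gm: "g ?m = p" using assms(2) p by metis
  have 1: "ok_cycle f S \<longleftrightarrow> f ?m < p"
    using p cyclic_on_inj_on[OF assms(1)] unfolding ok_cycle_def by (metis inj_on_def)
  have fm: "f ?m \<in> S" "g (f ?m) = ?m" using assms(2) m cyclic_on_inI[OF assms(1)] by auto
  have "cyclic_on g S" by (rule cyclic_on_inverse[OF assms(1,2)])
  then have 2: "ok_cycle g S \<longleftrightarrow> p < f ?m"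
    using fm gm cyclic_on_inj_on[of g S] unfolding ok_cycle_def by (metis inj_on_def)
  have "f ?m \<noteq> p" using p assms(3) by metis
  then show ?thesis using 1 2 by auto
qed

lemma cyclic_on_glue:
  assumes "cyclic_on f S"
  shows "cyclic_on (glue S f g) S"
  using assms by (subst cyclic_cong[of S _ f]) (auto simp: glue_def)

lemma cyclic_on_glue_disjoint:
  assumes "T \<inter> S = {}"
  shows "cyclic_on (glue S f g) T \<longleftrightarrow> cyclic_on g T"
  using assms by (intro cyclic_cong) (auto simp: glue_def)

lemma cyclic_on_meet:
  assumes "cyclic_on f S" "cyclic_on g T" "u \<in> S" "u \<in> T" "\<And>x. x \<in> S \<Longrightarrow> f x = g x"
  shows "S = T" using assms by (metis cyclic_cong orbit_cyclic_eq3)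

text \<open>\<open>S\<close> is closed under the glued map, so a cycle that meets \<open>S\<close>
  cannot leave it.\<close>

lemma cyclic_on_glue_cases:
  assumes "cyclic_on f S" "cyclic_on (glue S f g) T"
  shows "T = S \<or> T \<inter> S = {} \<and> cyclic_on g T"
proof (cases "T \<inter> S = {}")
  case True then show ?thesis using assms(2) cyclic_on_glue_disjoint by blast
next
  case False
  then obtain u where "u \<in> T" "u \<in> S" by blast
  then have "S = T" using cyclic_on_meet[OF assms] by (auto simp: glue_def)
  then show ?thesis by simp
qed

lemma reaches_cycle:
  assumes "finite S" "\<And>u. u \<in> S \<Longrightarrow> f u \<in> S" "v \<in> S"
  shows "\<exists>k. cyclic_on f (orbit f ((f ^^ k) v)) \<and> (f ^^ k) v \<in> orbit f ((f ^^ k) v)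
     \<and> orbit f ((f ^^ k) v) \<subseteq> S"
proof -
  have in_S: "(f ^^ i) v \<in> S" for i using assms by (induction i) auto
  then have "\<not> inj (\<lambda>i. (f ^^ i) v)"
    using assms(1) by (metis finite_subset image_subset_iff infinite_UNIV_nat finite_imageD)
  then obtain i' j' where "(f ^^ i') v = (f ^^ j') v" "i' \<noteq> j'" by (auto simp: inj_def)
  then obtain i j where ij: "(f ^^ i) v = (f ^^ j) v" "i < j"
    by (cases "i' < j'") (auto intro: that[of i' j'] that[of j' i'])
  then have "(f ^^ (j - i)) ((f ^^ i) v) = (f ^^ (j - i + i)) v"
    by (simp only: funpow_add comp_apply)
  then have "(f ^^ (j - i)) ((f ^^ i) v) = (f ^^ i) v" using ij by simp
  then have "\<exists>k. (f ^^ i) v = (f ^^ k) ((f ^^ i) v) \<and> 0 < k"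
    using ij(2) by (intro exI[of _ "j - i"]) simp
  then have *: "(f ^^ i) v \<in> orbit f ((f ^^ i) v)" unfolding orbit_altdef by blast
  have "orbit f ((f ^^ i) v) \<subseteq> S"
  proof
    fix y assume "y \<in> orbit f ((f ^^ i) v)" then show "y \<in> S"
      by induct (auto intro: assms in_S)
  qed
  then show ?thesis using * cyclic_on_self_orbit[OF *] by blast
qed

section \<open>Maps on a set of active vertices, and augmentation of their edge sets\<close>

locale finite_graph =
  fixes n :: nat and E :: "nat set set"
  assumes edge: "e \<in> E \<Longrightarrow> e \<subseteq> {..<n} \<and> card e = 2"
begin

lemma edgeD:
  assumes "{u, v} \<in> E" shows "u < n" "v < n" "u \<noteq> v" using edge[OF assms] by auto

lemma edge_cases:
  assumes "e \<in> E" obtains u v where "e = {u, v}" "u \<noteq> v"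
  using edge[OF assms] by (auto simp: card_2_iff)

text \<open>Inactive vertices are encoded as fixed points. As \<open>E\<close> has no loops,
  \<open>W\<close> can be recovered from the map, and one array of successors represents both in the
  program.\<close>

definition maps :: "nat set \<Rightarrow> (nat \<Rightarrow> nat) set" where
  "maps W = {f. (\<forall>v. v \<notin> W \<longrightarrow> f v = v) \<and> (\<forall>v\<in>W. {v, f v} \<in> E)}"

text \<open>Excluding 2-cycles makes the edges \<open>{v, f v}\<close> distinct
  (\<open>proper_owner\<close>). Augmentation takes place in this class, where the directions of
  longer cycles do not matter; \<open>orient\<close> then passes to \<open>good\<close> without
  changing the edge set.\<close>

definition proper :: "nat set \<Rightarrow> (nat \<Rightarrow> nat) set" where
  "proper W = {f \<in> maps W. \<forall>v\<in>W. f (f v) \<noteq> v}"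

definition good :: "nat set \<Rightarrow> (nat \<Rightarrow> nat) set" where
  "good W = {f \<in> maps W. \<forall>S\<subseteq>W. cyclic_on f S \<longrightarrow> ok_cycle f S}"

lemma maps_fix: "f \<in> maps W \<Longrightarrow> v \<notin> W \<Longrightarrow> f v = v"
  and maps_edge: "f \<in> maps W \<Longrightarrow> v \<in> W \<Longrightarrow> {v, f v} \<in> E"
  by (auto simp: maps_def)

lemma maps_eq_iff: "f \<in> maps W \<Longrightarrow> f v = v \<longleftrightarrow> v \<notin> W"
  using edgeD(3)[of v "f v"] by (auto simp: maps_def)

lemma edge_set_maps: "f \<in> maps W \<Longrightarrow> edge_set f = (\<lambda>v. {v, f v}) ` W"
  using maps_eq_iff[of f W] by (auto simp: edge_set_def)

lemma maps_edge_set_subset: "f \<in> maps W \<Longrightarrow> edge_set f \<subseteq> E"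
  by (auto simp: edge_set_maps maps_edge)

lemma good_maps: "f \<in> good W \<Longrightarrow> f \<in> maps W" by (simp add: good_def)

lemma finite_maps:
  assumes "W \<subseteq> {..<n}" shows "finite (maps W)"
proof (rule finite_subset)
  show "maps W \<subseteq> {f. \<forall>x. (x \<in> W \<longrightarrow> f x \<in> {..<n}) \<and> (x \<notin> W \<longrightarrow> f x = x)}"
    using edgeD by (auto simp: maps_def)
  have "finite W" using assms finite_subset by blast
  \<comment> \<open>\<open>finite_set_of_finite_funs\<close> works with a constant value off
    \<open>W\<close>; \<open>G\<close> restores the identity there.\<close>
  define G where "G = (\<lambda>f::nat\<Rightarrow>nat. \<lambda>x. if x \<in> W then f x else x)"
  have "{f. \<forall>x. (x \<in> W \<longrightarrow> f x \<in> {..<n}) \<and> (x \<notin> W \<longrightarrow> f x = x)}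
      \<subseteq> G ` {f. \<forall>x. (x \<in> W \<longrightarrow> f x \<in> {..<n}) \<and> (x \<notin> W \<longrightarrow> f x = 0)}"
    (is "?A \<subseteq> G ` ?B")
  proof
    fix f assume f: "f \<in> ?A"
    have "f = G (\<lambda>x. if x \<in> W then f x else 0)" using f by (auto simp: G_def)
    then show "f \<in> G ` ?B" using f by (intro image_eqI) auto
  qed
  moreover have "finite ?B" by (rule finite_set_of_finite_funs) (use \<open>finite W\<close> in auto)
  ultimately show "finite ?A" by (meson finite_imageI finite_subset)
qed

lemma finite_good: "W \<subseteq> {..<n} \<Longrightarrow> finite (good W)"
  by (rule finite_subset[OF _ finite_maps]) (auto simp: good_def)

lemma good_empty: "good {} = {id}" by (auto simp: good_def maps_def cyclic_on_def fun_eq_iff)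

lemma not_ok_two_cycle:
  assumes "f (f v) = v" shows "cyclic_on f {v, f v}" "\<not> ok_cycle f {v, f v}"
proof -
  have "orbit f v = {(f ^^ m) v | m. m < 2}"
    by (rule orbit_altdef_bounded) (use assms in \<open>auto simp: numeral_2_eq_2\<close>)
  also have "\<dots> = {v, f v}"
    by (auto simp: less_2_cases_iff) (metis funpow_0, metis One_nat_def funpow_0 funpow_simps_right(2) comp_apply funpow_swap1)
  finally show "cyclic_on f {v, f v}" by (auto simp: cyclic_on_def)
  show "\<not> ok_cycle f {v, f v}"
    using assms by (auto simp: ok_cycle_def min_def split: if_splits)
qed

lemma good_proper: "good W \<subseteq> proper W"
proof
  fix f assume f: "f \<in> good W"
  have "f (f v) \<noteq> v" if v: "v \<in> W" for v
  proof
    assume ff: "f (f v) = v"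
    have "f v \<in> W" using ff v maps_eq_iff[OF good_maps[OF f]] by metis
    then have "{v, f v} \<subseteq> W" using v by simp
    then show False using f not_ok_two_cycle[of f v, OF ff] by (simp add: good_def)
  qed
  then show "f \<in> proper W" using f by (simp add: proper_def good_def)
qed

text \<open>Where \<open>f\<close> and \<open>g\<close> disagree they use the same edges in opposite
  directions, so \<open>f\<close> maps the finite set \<open>D\<close> to itself and
  \<open>g\<close> inverts it there. A cycle of \<open>f\<close> inside \<open>D\<close> is reversed
  by \<open>g\<close>, but \<open>ok_cycle\<close> admits only one direction.\<close>

lemma good_unique:
  assumes f: "f \<in> good W" and g: "g \<in> good W" and "W \<subseteq> {..<n}" "edge_set f = edge_set g"
  shows "f = g"
proof (rule ccontr)
  assume "f \<noteq> g"
  then obtain v where v: "f v \<noteq> g v" by auto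
  \<comment> \<open>The edge \<open>{u, a u}\<close> also has an owner under \<open>b\<close>. This
    is not \<open>u\<close>, as \<open>b u\<close> differs from \<open>a u\<close>, so it is the
    other end.\<close>
  have swap: "b (a u) = u \<and> a (a u) \<noteq> b (a u)"
    if "a u \<noteq> b u" and a: "a \<in> good W" and b: "b \<in> good W" and e: "edge_set a = edge_set b" for a b u
  proof -
    have u: "u \<in> W"
      using that maps_fix[OF good_maps[OF a]] maps_fix[OF good_maps[OF b]] by metis
    then have "{u, a u} \<in> edge_set b" using e edge_set_maps[OF good_maps[OF a]] by auto
    then obtain w where w: "w \<in> W" "{u, a u} = {w, b w}"
      using edge_set_maps[OF good_maps[OF b]] by auto
    then have "w \<noteq> u" using that by (auto simp: doubleton_eq_iff)
    then have "w = a u" "b w = u" using w by (auto simp: doubleton_eq_iff)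
    moreover have "a (a u) \<noteq> u" using good_proper a u by (auto simp: proper_def)
    ultimately show ?thesis by auto
  qed
  define D where "D = {v. f v \<noteq> g v}"
  have "D \<subseteq> W" using maps_fix[OF good_maps[OF f]] maps_fix[OF good_maps[OF g]]
    unfolding D_def by (metis (mono_tags, lifting) mem_Collect_eq subsetI)
  have fD: "f u \<in> D \<and> g (f u) = u" if "u \<in> D" for u
    using swap[of f u g] that f g assms(4) by (auto simp: D_def)
  have gD: "g u \<in> D \<and> f (g u) = u" if "u \<in> D" for u
    using swap[of g u f] that f g assms(4) by (auto simp: D_def)
  have "finite D" using \<open>D \<subseteq> W\<close> assms(3) by (meson finite_lessThan finite_subset)
  then obtain k where k: "cyclic_on f (orbit f ((f ^^ k) v))" "orbit f ((f ^^ k) v) \<subseteq> D"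
    using reaches_cycle[of D f v] fD v unfolding D_def by blast
  define S where "S = orbit f ((f ^^ k) v)"
  have S: "cyclic_on f S" "S \<subseteq> D" using k by (auto simp: S_def)
  then have "cyclic_on g S" by (intro cyclic_on_inverse[OF S(1)]) (use fD in blast)
  then have "ok_cycle g S" "ok_cycle f S"
    using f g S \<open>D \<subseteq> W\<close> unfolding good_def by blast+
  moreover have "ok_cycle g S \<longleftrightarrow> \<not> ok_cycle f S"
  proof (rule ok_cycle_inverse[OF S(1)])
    fix u assume "u \<in> S"
    then have "u \<in> D" "u \<in> W" "f \<in> proper W" using S good_proper f \<open>D \<subseteq> W\<close> by blast+
    then show "g (f u) = u" "f (f u) \<noteq> u" using fD by (auto simp: proper_def)
  qed
  ultimately show False by simp
qed

lemma edge_set_glue: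
  assumes "g \<in> maps (W - S)" "S \<subseteq> W" "\<And>u. u \<in> S \<Longrightarrow> {u, f u} \<in> E"
  shows "edge_set (glue S f g) = edge_set g \<union> (\<lambda>u. {u, f u}) ` S"
proof -
  have "glue S f g \<in> maps W" using assms by (auto simp: maps_def glue_def)
  then have "edge_set (glue S f g) = (\<lambda>u. {u, glue S f g u}) ` W" by (rule edge_set_maps)
  also have "W = (W - S) \<union> S" using assms by blast
  also have "(\<lambda>u. {u, glue S f g u}) ` \<dots> = (\<lambda>u. {u, g u}) ` (W - S) \<union> (\<lambda>u. {u, f u}) ` S"
    by (auto simp: glue_def image_Un)
  finally show ?thesis using edge_set_maps[OF assms(1)] by simp
qed

lemma glue_good:
  assumes "g \<in> good (W - S)" "S \<subseteq> W" "cyclic_on f S" "ok_cycle f S" "\<And>u. u \<in> S \<Longrightarrow> {u, f u} \<in> E"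
  shows "glue S f g \<in> good W"
proof -
  have "g \<in> maps (W - S)" using assms(1) by (rule good_maps)
  then have "glue S f g \<in> maps W" using assms(2,5) by (auto simp: maps_def glue_def)
  moreover have "ok_cycle (glue S f g) T" if T: "T \<subseteq> W" "cyclic_on (glue S f g) T" for T
  proof -
    consider "T = S" | "T \<inter> S = {}" "cyclic_on g T"
      using cyclic_on_glue_cases[OF assms(3) T(2)] by blast
    then show ?thesis
    proof cases
      case 1
      then show ?thesis using ok_cycle_cong[OF assms(3), of "glue S f g"] assms(4) by (auto simp: glue_def)
    next
      case 2
      have "T \<subseteq> W - S" using 2(1) T(1) by blast
      then have "ok_cycle g T" using assms(1) 2(2) by (simp add: good_def)
      moreover have "g u = glue S f g u" if u: "u \<in> T" for u
      proof -
        have "u \<notin> S" using u 2(1) by blast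
        then show ?thesis by (simp add: glue_def)
      qed
      ultimately show ?thesis using ok_cycle_cong[OF 2(2), of "glue S f g"] by blast
    qed
  qed
  ultimately show ?thesis by (simp add: good_def)
qed

text \<open>Forbidden cycles are reversed one at a time: deleting one leaves a proper map on
  \<open>W - S\<close>, which is oriented by induction, and the reversed cycle, now allowed and with
  the same edges, is glued back.\<close>

lemma orient:
  assumes "f \<in> proper W" "W \<subseteq> {..<n}"
  shows "\<exists>g\<in>good W. edge_set g = edge_set f" using assms
proof (induction "card W" arbitrary: W f rule: less_induct)
  case less
  have fW: "f \<in> maps W" using less.prems by (simp add: proper_def)
  have "finite W" using less.prems(2) by (meson finite_lessThan finite_subset)
  show ?case
  proof (cases "f \<in> good W")
    case False
    then obtain S where S: "S \<subseteq> W" "cyclic_on f S" "\<not> ok_cycle f S"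
      using fW by (auto simp: good_def)
    define g where "g = inv_into S f"
    have gf: "g (f u) = u" if "u \<in> S" for u
      using that cyclic_on_inj_on[OF S(2)] by (simp add: g_def)
    have ffS: "f (f u) \<noteq> u" if "u \<in> S" for u using that S less.prems by (auto simp: proper_def)
    define f' where "f' = glue S id f"
    have edges: "(\<lambda>u. {u, g u}) ` S = (\<lambda>u. {u, f u}) ` S"
    proof -
      have "(\<lambda>u. {u, g u}) ` S = (\<lambda>u. {u, g u}) ` (f ` S)"
        using cyclic_on_bij_betw[OF S(2)] by (simp add: bij_betw_def)
      also have "\<dots> = (\<lambda>u. {u, f u}) ` S"
        unfolding image_image by (intro image_cong) (auto simp: gf)
      finally show ?thesis .
    qed
    have gE: "{u, g u} \<in> E" if "u \<in> S" for u
    proof -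
      have "{u, g u} \<in> (\<lambda>u. {u, f u}) ` S" using that edges by blast
      then show ?thesis using S(1) maps_edge[OF fW] by auto
    qed
    have f'W: "f' \<in> proper (W - S)"
      using less.prems(1) by (auto simp: f'_def glue_def proper_def maps_def)
    have "S \<noteq> {}" using S by (auto simp: cyclic_on_def)
    then have "card (W - S) < card W"
      using S(1) \<open>finite W\<close> by (intro psubset_card_mono) auto
    then obtain h where h: "h \<in> good (W - S)" "edge_set h = edge_set f'"
      using less.hyps[OF _ f'W] less.prems(2) by auto
    have "cyclic_on g S" by (rule cyclic_on_inverse[OF S(2)]) (rule gf)
    moreover have "ok_cycle g S" using ok_cycle_inverse[OF S(2), of g] gf ffS S(3) by auto
    ultimately have "glue S g h \<in> good W" using glue_good[OF h(1) S(1)] gE by auto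
    moreover have "edge_set (glue S g h) = edge_set f"
    proof -
      have "edge_set (glue S g h) = edge_set f' \<union> (\<lambda>u. {u, f u}) ` S"
        using edge_set_glue[OF good_maps[OF h(1)] S(1), of g] gE edges h(2) by simp
      also have "\<dots> = edge_set (glue S f f')"
        using edge_set_glue[of f' W S f] f'W S(1) maps_edge[OF fW] by (auto simp: proper_def)
      also have "glue S f f' = f" by (auto simp: glue_def f'_def)
      finally show ?thesis .
    qed
    ultimately show ?thesis by blast
  qed blast
qed

lemma proper_maps: "f \<in> proper W \<Longrightarrow> f \<in> maps W" by (simp add: proper_def)

lemma proper_owner:
  assumes "f \<in> proper W" "u \<in> W" "v \<in> W" "{u, f u} = {v, f v}" shows "u = v"
proof (rule ccontr)
  assume "u \<noteq> v"
  then have "f u = v" "f v = u" using assms(4) by (auto simp: doubleton_eq_iff)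
  then show False using assms(1,2) by (auto simp: proper_def)
qed

text \<open>Augmenting along the path from \<open>x\<close> to \<open>a\<close>: \<open>x\<close> takes over the new edge, and every vertex of the path
  hands its previous edge on to its successor.\<close>

lemma augment:
  assumes "f \<in> proper W" "a \<notin> W" "(f ^^ k) x = a" "{x, w} \<in> E" "{x, w} \<notin> edge_set f"
  shows "\<exists>g\<in>proper (insert a W). edge_set g = insert {x, w} (edge_set f)" using assms
proof (induction k arbitrary: f x w)
  case 0
  then have x: "x = a" by simp
  have fW: "f \<in> maps W" using 0 by (simp add: proper_def)
  define g where "g = f(a := w)"
  have wa: "w \<noteq> a" using edgeD(3)[OF 0(4)] x by simp
  have g: "g \<in> maps (insert a W)" using fW 0(4) x by (auto simp: maps_def g_def)
  have "edge_set g = insert {x, w} (edge_set f)"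
    unfolding edge_set_maps[OF g] edge_set_maps[OF fW] using 0(2) x by (auto simp: g_def)
  moreover have "g (g v) \<noteq> v" if "v \<in> insert a W" for v
  proof
    assume gg: "g (g v) = v"
    show False
    proof (cases "v = a \<or> g v = a")
      case True
      then have "\<exists>u\<in>W. {u, f u} = {a, w}"
      proof
        assume "v = a"
        then have "f w = a" using gg wa by (simp add: g_def)
        then show ?thesis using maps_fix[OF fW, of w] wa by (intro bexI[of _ w]) auto
      next
        assume *: "g v = a"
        then have "v = w" using gg by (simp add: g_def)
        then have "f w = a" using * wa by (simp add: g_def)
        then show ?thesis using maps_fix[OF fW, of w] wa by (intro bexI[of _ w]) auto
      qed
      then show False using 0(5) x edge_set_maps[OF fW] by auto
    next
      case False
      then have "f (f v) = v" "v \<in> W" using gg that by (auto simp: g_def)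
      then show False using 0(1) by (auto simp: proper_def)
    qed
  qed
  ultimately show ?case using g by (auto simp: proper_def)
next
  case (Suc k)
  have fW: "f \<in> maps W" using Suc.prems by (simp add: proper_def)
  show ?case
  proof (cases "x = a")
    \<comment> \<open>\<open>k\<close> need not be the first hitting time of \<open>a\<close>; as
      \<open>a\<close> is a fixed point, this case reduces to a smaller \<open>k\<close>.\<close>
    case True
    have "(f ^^ i) a = a" for i using maps_fix[OF fW Suc.prems(2)] by (induction i) auto
    then show ?thesis using Suc.IH[of f x w] Suc.prems True by simp
  next
    case False
    define y where "y = f x"
    have ya: "(f ^^ k) y = a" using Suc.prems(3) by (simp add: y_def funpow_swap1)
    have afix: "(f ^^ i) a = a" for i using maps_fix[OF fW Suc.prems(2)] by (induction i) auto
    have xW: "x \<in> W"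
    proof (rule ccontr)
      assume "x \<notin> W"
      then have "f x = x" using maps_fix[OF fW] by simp
      then have "(f ^^ i) x = x" for i by (induction i) auto
      then show False using False Suc.prems(3) by metis
    qed
    \<comment> \<open>If \<open>x\<close> recurred, its trajectory would be periodic, whereas it is
      absorbed at the fixed point \<open>a\<close>, which differs from \<open>x\<close>; comparing
      the iterates of order \<open>Suc k * Suc j\<close> shows this. Hence rerouting
      \<open>x\<close> leaves the path from \<open>y\<close> to \<open>a\<close> intact.\<close>
    have nx: "(f ^^ j) y \<noteq> x" for j
    proof
      assume j: "(f ^^ j) y = x"
      have "(f ^^ Suc j) x = x" using j by (simp add: y_def funpow_swap1)
      then have *: "(f ^^ (i * Suc j)) x = x" for i
      proof (induction i)
        case (Suc i)
        have "(f ^^ (Suc i * Suc j)) x = (f ^^ Suc j) ((f ^^ (i * Suc j)) x)"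
          by (simp only: mult_Suc funpow_add comp_apply)
        then show ?case using Suc \<open>(f ^^ Suc j) x = x\<close> by (simp only:)
      qed simp
      have "(f ^^ (Suc k * Suc j)) x = (f ^^ (Suc k * j + Suc k)) x"
        by (simp only: mult_Suc_right add.commute)
      also have "\<dots> = (f ^^ (Suc k * j)) ((f ^^ Suc k) x)"
        by (simp only: funpow_add comp_apply)
      finally have "(f ^^ (Suc k * Suc j)) x = (f ^^ (Suc k * j)) ((f ^^ Suc k) x)" .
      then have "(f ^^ (Suc k * Suc j)) x = a" using Suc.prems(3) afix by simp
      then show False using * False by metis
    qed
    define g where "g = f(x := w)"
    have xw: "x \<noteq> w" using edgeD(3)[OF Suc.prems(4)] .
    have g: "g \<in> maps W" using fW Suc.prems(4) xW by (auto simp: maps_def g_def)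
    have gy: "(g ^^ j) y = (f ^^ j) y" for j by (induction j) (auto simp: g_def nx)
    have xy: "{x, y} \<in> E" using maps_edge[OF fW xW] by (simp add: y_def)
    have other: "\<not> {v, f v} = {x, w}" if "v \<in> W" for v
      using that Suc.prems(5) edge_set_maps[OF fW] by auto
    have gp: "g \<in> proper W"
    proof -
      have "g (g v) \<noteq> v" if "v \<in> W" for v
      proof
        assume gg: "g (g v) = v"
        show False
        proof (cases "v = x \<or> g v = x")
          case True
          then have "f w = x" using gg xw by (auto simp: g_def split: if_splits)
          then have "w \<in> W" using maps_fix[OF fW, of w] xw by auto
          then show False using other[of w] \<open>f w = x\<close> by auto
        next
          case False
          then have "f (f v) = v" using gg by (auto simp: g_def)
          then show False using Suc.prems(1) that by (auto simp: proper_def)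
        qed
      qed
      then show ?thesis using g by (simp add: proper_def)
    qed
    have eg: "edge_set g = insert {x, w} ((\<lambda>v. {v, f v}) ` (W - {x}))"
      unfolding edge_set_maps[OF g] using xW by (auto simp: g_def)
    have ef: "edge_set f = insert {x, y} ((\<lambda>v. {v, f v}) ` (W - {x}))"
      unfolding edge_set_maps[OF fW] using xW by (auto simp: y_def)
    \<comment> \<open>The edge given up by \<open>x\<close> has no other owner, so it is a
      legitimate new edge for \<open>y\<close> in the induction hypothesis.\<close>
    have "{y, x} \<notin> edge_set g"
    proof
      assume "{y, x} \<in> edge_set g"
      then consider "{x, y} = {x, w}" | v where "v \<in> W" "v \<noteq> x" "{x, f x} = {v, f v}"
        unfolding eg y_def by (auto simp: insert_commute)
      then show False
      proof cases
        case 1 then show False using other[OF xW] by (simp add: y_def)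
      next
        case 2 then show False using proper_owner[OF Suc.prems(1) xW] by blast
      qed
    qed
    then obtain h where "h \<in> proper (insert a W)" "edge_set h = insert {y, x} (edge_set g)"
      using Suc.IH[OF gp Suc.prems(2), of y x] gy ya xy by (auto simp: insert_commute)
    then show ?thesis unfolding eg ef by (intro bexI[of _ h]) (auto simp: insert_commute)
  qed
qed

end

section \<open>Good maps and bases\<close>

lemma mod_Suc_neq:
  assumes "3 \<le> k" "i < k"
  shows "Suc (Suc i mod k) mod k \<noteq> i" "Suc i mod k \<noteq> i"
  using assms by (auto simp: mod_Suc split: if_splits)

lemma mod_Suc_inj:
  assumes "i < k" "j < k" "Suc i mod k = Suc j mod k" shows "i = j"
  using assms by (auto simp: mod_Suc split: if_splits)

text \<open>Every edge is an arc of \<open>f\<close>, crossed forwards or backwards, and either way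
  the two trajectories still meet. This is what prevents a second cycle in a component.\<close>

lemma rtrancl_merge:
  assumes "(u, w) \<in> {(x, y). {x, y} \<in> edge_set f}\<^sup>*"
  shows "\<exists>i j. (f ^^ i) u = (f ^^ j) w" using assms
proof induction
  case base show ?case by blast
next
  case (step y z)
  then obtain i j where ij: "(f ^^ i) u = (f ^^ j) y" by blast
  obtain v where "{y, z} = {v, f v}" using step(2) by (auto simp: edge_set_def)
  then consider "z = f y" | "y = f z" by (auto simp: doubleton_eq_iff)
  then show ?case
  proof cases
    case 1
    then have "(f ^^ Suc i) u = (f ^^ j) z" using ij by (simp add: funpow_swap1)
    then show ?thesis by blast
  next
    case 2
    then have "(f ^^ i) u = (f ^^ Suc j) z" using ij by (simp add: funpow_swap1)
    then show ?thesis by blast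
  qed
qed

lemma component_closed:
  assumes "K \<in> components V R" "x \<in> K" "{x, y} \<in> R" "y \<in> V" shows "y \<in> K"
  using assms by (auto simp: components_def quotient_def reachability_def intro: rtrancl_into_rtrancl)

lemma component_subset: "K \<in> components V R \<Longrightarrow> K \<subseteq> V"
  by (auto simp: components_def quotient_def reachability_def)

lemma component_nonempty: "K \<in> components V R \<Longrightarrow> K \<noteq> {}"
  by (auto simp: components_def quotient_def reachability_def)

lemma component_connected:
  assumes "K \<in> components V R" "x \<in> K" "y \<in> K" shows "(x, y) \<in> {(x, y). {x, y} \<in> R}\<^sup>*"
proof -
  let ?r = "{(x, y). {x, y} \<in> R}"
  have "sym ?r" by (auto simp: sym_def insert_commute)
  then have "sym (?r\<^sup>*)" by (rule sym_rtrancl)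
  obtain v where "(v, x) \<in> ?r\<^sup>*" "(v, y) \<in> ?r\<^sup>*"
    using assms by (auto simp: components_def quotient_def reachability_def)
  then show ?thesis using \<open>sym (?r\<^sup>*)\<close> by (meson rtrancl_trans symD)
qed

lemma component_exists: "x \<in> V \<Longrightarrow> \<exists>K\<in>components V R. x \<in> K"
  by (auto simp: components_def quotient_def reachability_def)

lemma component_subset_closed:
  assumes "K \<in> components V R" "a \<in> K" "a \<in> X" "\<And>x y. x \<in> X \<Longrightarrow> {x, y} \<in> R \<Longrightarrow> y \<in> X"
  shows "K \<subseteq> X"
proof
  fix y assume "y \<in> K"
  then have "(a, y) \<in> {(x, y). {x, y} \<in> R}\<^sup>*" using component_connected assms by metis
  then show "y \<in> X" by induction (auto intro: assms)
qed

context finite_graph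
begin

text \<open>The vertices are listed along the orbit. Its length is at least 3: period 1 would mean
  an inactive vertex, and period 2 is excluded by \<open>proper\<close>.\<close>

lemma cyclic_on_is_cycle:
  assumes "f \<in> proper W" "cyclic_on f S" "S \<subseteq> W"
  shows "is_cycle ((\<lambda>u. {u, f u}) ` S)"
proof -
  obtain s where s: "s \<in> S" "S = orbit f s" "s \<in> orbit f s"
    using assms(2) unfolding cyclic_on_def by metis
  define p where "p = funpow_dist1 f s s"
  have ps: "(f ^^ p) s = s" unfolding p_def by (rule funpow_dist1_prop) (rule s)
  have "p \<noteq> 0" by (simp add: p_def)
  moreover have "p \<noteq> 1"
    using ps maps_eq_iff[OF proper_maps[OF assms(1)], of s] s assms(3) by auto
  moreover have "p \<noteq> 2" using ps s assms(1,3) by (auto simp: proper_def numeral_2_eq_2)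
  ultimately have p3: "3 \<le> p" by linarith
  define vs where "vs = map (\<lambda>i. (f ^^ i) s) [0..<p]"
  have "distinct vs" unfolding vs_def distinct_map p_def set_upt using inj_on_funpow_dist1[OF s(3)]
    by (simp only: distinct_upt simp_thms)
  moreover have "length vs = p" by (simp add: vs_def)
  moreover have ends: "{vs ! i, vs ! (Suc i mod length vs)} = {(f ^^ i) s, f ((f ^^ i) s)}" if "i < p" for i
    using that ps by (cases "Suc i = p") (auto simp: vs_def mod_Suc)
  have "{{vs ! i, vs ! (Suc i mod length vs)} | i. i < length vs}
      = (\<lambda>i. {(f ^^ i) s, f ((f ^^ i) s)}) ` {0..<p}"
  proof -
    have "{{vs ! i, vs ! (Suc i mod length vs)} | i. i < length vs}
        = (\<lambda>i. {vs ! i, vs ! (Suc i mod length vs)}) ` {0..<p}"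
      using \<open>length vs = p\<close> by auto
    also have "\<dots> = (\<lambda>i. {(f ^^ i) s, f ((f ^^ i) s)}) ` {0..<p}"
      by (rule image_cong) (simp_all only: ends atLeastLessThan_iff)
    finally show ?thesis .
  qed
  moreover have "\<dots> = (\<lambda>u. {u, f u}) ` S"
    using orbit_conv_funpow_dist1[OF s(3)] s(2) by (simp add: p_def image_image)
  ultimately show ?thesis unfolding is_cycle_def
    by (intro exI[of _ vs] conjI) (simp_all only: p3 refl)
qed

text \<open>The k edges of \<open>C\<close> have distinct owners among the k vertices of the cycle,
  so every vertex owns an edge of \<open>C\<close>. Hence \<open>f\<close> maps the vertex set to
  itself and has a directed cycle \<open>P\<close> there. Both edges of \<open>C\<close> at a vertex
  of \<open>P\<close> are arcs of \<open>P\<close>, so walking along \<open>C\<close> never leaves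
  \<open>P\<close>.\<close>

lemma is_cycle_cyclic_on:
  assumes f: "f \<in> proper W" and "is_cycle C" "C \<subseteq> edge_set f"
  shows "\<exists>S\<subseteq>W. cyclic_on f S \<and> C = (\<lambda>u. {u, f u}) ` S"
proof -
  obtain vs where vs: "3 \<le> length vs" "distinct vs"
    "C = {{vs ! i, vs ! (Suc i mod length vs)} | i. i < length vs}"
    using assms(2) unfolding is_cycle_def by blast
  define k where "k = length vs"
  define nx where "nx = (\<lambda>i. Suc i mod k)"
  define e where "e = (\<lambda>i. {vs ! i, vs ! nx i})"
  have k3: "3 \<le> k" using vs by (simp add: k_def)
  have C: "C = e ` {..<k}" unfolding vs(3) by (auto simp: e_def nx_def k_def)
  have nxk: "nx i < k" for i using k3 by (simp add: nx_def)
  have vs_eq: "vs ! i = vs ! j \<longleftrightarrow> i = j" if "i < k" "j < k" for i j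
    using that vs(2) by (simp add: k_def nth_eq_iff_index_eq)
  \<comment> \<open>Here the length of at least 3 enters: on two vertices both edges would
    coincide.\<close>
  have "inj_on e {..<k}"
  proof (rule inj_onI)
    fix i j assume ij: "i \<in> {..<k}" "j \<in> {..<k}" "e i = e j"
    show "i = j"
    proof (rule ccontr)
      assume "i \<noteq> j"
      then have "vs ! i = vs ! nx j" "vs ! nx i = vs ! j"
        using ij vs_eq by (auto simp: e_def doubleton_eq_iff)
      then have "i = nx j" "nx i = j" using ij vs_eq nxk by auto
      then show False using mod_Suc_neq(1)[OF k3, of j] ij by (simp add: nx_def)
    qed
  qed
  then have "card C = k" unfolding C by (simp add: card_image)
  define S where "S = set vs"
  have "card S = k" using vs(2) by (simp add: S_def k_def distinct_card)
  have "finite S" by (simp add: S_def)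
  have eS: "e i \<subseteq> S" if "i < k" for i
    using that nxk[of i] by (auto simp: e_def S_def k_def)
  define S' where "S' = {u \<in> S. u \<in> W \<and> {u, f u} \<in> C}"
  have fW: "f \<in> maps W" by (rule proper_maps[OF f])
  have "C \<subseteq> (\<lambda>u. {u, f u}) ` S'"
  proof
    fix c assume c: "c \<in> C"
    then obtain u where u: "u \<in> W" "c = {u, f u}" using assms(3) edge_set_maps[OF fW] by auto
    moreover have "c \<subseteq> S" using c eS unfolding C by auto
    ultimately have "u \<in> S'" using c by (auto simp: S'_def)
    then show "c \<in> (\<lambda>u. {u, f u}) ` S'" using u by blast
  qed
  moreover have "(\<lambda>u. {u, f u}) ` S' \<subseteq> C" by (auto simp: S'_def)
  ultimately have CS': "C = (\<lambda>u. {u, f u}) ` S'" by blast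
  have "S' \<subseteq> S" by (auto simp: S'_def)
  moreover have "k \<le> card S'"
    using \<open>card C = k\<close> CS' card_image_le[of S' "\<lambda>u. {u, f u}"] \<open>finite S\<close> \<open>S' \<subseteq> S\<close> finite_subset by metis
  ultimately have "S' = S" using \<open>card S = k\<close> \<open>finite S\<close> by (metis card_seteq)
  have SW: "S \<subseteq> W" and SC: "\<And>u. u \<in> S \<Longrightarrow> {u, f u} \<in> C"
    using \<open>S' = S\<close> by (auto simp: S'_def)
  have fS: "f u \<in> S" if "u \<in> S" for u using SC[OF that] eS unfolding C by auto
  have "vs ! 0 \<in> S" unfolding S_def by (rule nth_mem) (use vs(1) in linarith)
  from reaches_cycle[of S f "vs ! 0", OF \<open>finite S\<close> fS this]
  obtain i0 where i0: "cyclic_on f (orbit f ((f ^^ i0) (vs ! 0)))"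
    "(f ^^ i0) (vs ! 0) \<in> orbit f ((f ^^ i0) (vs ! 0))"
    "orbit f ((f ^^ i0) (vs ! 0)) \<subseteq> S" by blast
  define s where "s = (f ^^ i0) (vs ! 0)"
  have s: "cyclic_on f (orbit f s)" "s \<in> orbit f s" "orbit f s \<subseteq> S"
    using i0 by (simp_all only: s_def)
  define P where "P = orbit f s"
  have P: "cyclic_on f P" "P \<subseteq> S" using s by (auto simp: P_def)
  have step: "vs ! nx j \<in> P" if j: "j < k" "vs ! j \<in> P" for j
  proof -
    define w where "w = vs ! j"
    have wP: "w \<in> P" using j by (simp add: w_def)
    have "w \<in> f ` P" unfolding cyclic_on_image_eq[OF P(1)] by (rule wP)
    then obtain p where p: "p \<in> P" "f p = w" by blast
    have pw: "p \<noteq> w" using p P SW maps_eq_iff[OF fW, of p] by blast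
    have fwP: "f w \<in> P" using cyclic_on_inI[OF P(1) wP] .
    obtain i1 where i1: "i1 < k" "{w, f w} = e i1" using SC[of w] wP P(2) unfolding C by auto
    obtain i2 where i2: "i2 < k" "{p, w} = e i2" using SC[of p] p P(2) unfolding C by auto
    have ne: "{w, f w} \<noteq> {p, f p}" using proper_owner[OF f, of w p] pw wP p(1) P(2) SW by blast
    have at: "i = j \<or> nx i = j" if "i < k" "w \<in> e i" for i
      using that vs_eq j nxk by (auto simp: e_def w_def)
    \<comment> \<open>An edge of \<open>C\<close> at \<open>vs ! j\<close> has index
      \<open>j\<close> or the index before it. The arcs out of \<open>w\<close> and into
      \<open>w\<close> are two different such edges, so one of them leads to the next vertex of
      \<open>C\<close>.\<close>
    have "i1 = j \<or> i2 = j"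
    proof (rule ccontr)
      assume *: "\<not> ?thesis"
      have "w \<in> e i1" "w \<in> e i2" using i1(2) i2(2) by blast+
      then have "nx i1 = j" "nx i2 = j" using at i1 i2 * by blast+
      then have "i1 = i2" using mod_Suc_inj[of i1 k i2] i1 i2 by (simp add: nx_def)
      then show False using ne i1 i2 p by simp
    qed
    moreover have "vs ! nx j \<in> e j" by (simp add: e_def)
    ultimately have "vs ! nx j \<in> {w, f w} \<union> {p, w}" using i1(2) i2(2) by blast
    then show ?thesis using wP fwP p(1) by (elim UnE insertE) simp_all
  qed
  have "s \<in> S" using s by blast
  then obtain j0 where j0: "j0 < k" "vs ! j0 \<in> P"
    using s(2) by (metis P_def S_def in_set_conv_nth k_def)
  have all: "vs ! ((j0 + t) mod k) \<in> P" for t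
  proof (induction t)
    case 0 then show ?case using j0 by simp
  next
    case (Suc t)
    have "vs ! nx ((j0 + t) mod k) \<in> P" by (rule step) (use Suc k3 in auto)
    then show ?case by (simp add: nx_def mod_Suc_eq)
  qed
  have "S \<subseteq> P"
  proof
    fix v assume "v \<in> S"
    then obtain i where i: "i < k" "v = vs ! i" by (metis S_def in_set_conv_nth k_def)
    have "(j0 + (k - j0 + i)) mod k = i" using j0 i by simp
    then show "v \<in> P" using all[of "k - j0 + i"] i by simp
  qed
  then have "cyclic_on f S" using P by (simp add: subset_antisym)
  then show ?thesis using SW CS' \<open>S' = S\<close> by blast
qed

lemma funpow_component:
  assumes "K \<in> components {..<n} R" "f \<in> maps W" "edge_set f \<subseteq> R" "R \<subseteq> E" "x \<in> K"
  shows "(f ^^ i) x \<in> K"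
proof (induction i)
  case (Suc i)
  let ?y = "(f ^^ i) x"
  show ?case
  proof (cases "f ?y = ?y")
    case False
    then have e: "{?y, f ?y} \<in> R" using assms(3) edge_setI[of f ?y] by blast
    then have "{?y, f ?y} \<in> E" using assms(4) by blast
    then have "f ?y \<in> {..<n}" using edgeD(2) by blast
    then show ?thesis using component_closed[OF assms(1) Suc e] by simp
  qed (use Suc in simp)
qed (use assms in simp)

lemma cycle_in_component:
  assumes K: "K \<in> components {..<n} R" and f: "f \<in> proper {..<n}" and R: "edge_set f \<subseteq> R" "R \<subseteq> E"
    and x: "x \<in> K"
  shows "\<exists>k S. (f ^^ k) x \<in> S \<and> cyclic_on f S \<and> S \<subseteq> {..<n} \<and> is_cycle ((\<lambda>u. {u, f u}) ` S)
     \<and> (\<lambda>u. {u, f u}) ` S \<subseteq> {e \<in> R. e \<subseteq> K}"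
proof -
  have fV: "f \<in> maps {..<n}" by (rule proper_maps[OF f])
  have fK: "f u \<in> K" if "u \<in> K" for u using funpow_component[OF K fV R that, of 1] by simp
  have "K \<subseteq> {..<n}" by (rule component_subset[OF K])
  then have "finite K" by (meson finite_lessThan finite_subset)
  from reaches_cycle[of K f x, OF this fK x] obtain k where
    k: "cyclic_on f (orbit f ((f ^^ k) x))" "(f ^^ k) x \<in> orbit f ((f ^^ k) x)"
      "orbit f ((f ^^ k) x) \<subseteq> K" by blast
  define S where "S = orbit f ((f ^^ k) x)"
  have S: "cyclic_on f S" "(f ^^ k) x \<in> S" "S \<subseteq> K" using k by (simp_all add: S_def)
  have "is_cycle ((\<lambda>u. {u, f u}) ` S)"
    using cyclic_on_is_cycle[OF f S(1)] S(3) \<open>K \<subseteq> {..<n}\<close> by blast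
  moreover have "(\<lambda>u. {u, f u}) ` S \<subseteq> {e \<in> R. e \<subseteq> K}"
  proof
    fix e assume "e \<in> (\<lambda>u. {u, f u}) ` S"
    then obtain u where u: "u \<in> S" "e = {u, f u}" by blast
    then have "u \<in> K" "f u \<in> K" using S fK by blast+
    moreover have "e \<in> edge_set f"
      using u S(3) \<open>K \<subseteq> {..<n}\<close> edge_set_maps[OF fV] by blast
    ultimately show "e \<in> {e \<in> R. e \<subseteq> K}" using R u by blast
  qed
  ultimately show ?thesis using S \<open>K \<subseteq> {..<n}\<close> by blast
qed

text \<open>With all vertices active, every trajectory stays in its component and ends in a cycle.
  Two cycles of one component would both be directed, and since trajectories of connected vertices
  meet, they would share a vertex.\<close>

lemma proper_base:
  assumes f: "f \<in> proper {..<n}"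
  shows "edge_set f \<in> bicircular_bases {..<n} E"
proof -
  have fV: "f \<in> maps {..<n}" by (rule proper_maps[OF f])
  have RE: "edge_set f \<subseteq> E" by (rule maps_edge_set_subset[OF fV])
  have "\<exists>!C. is_cycle C \<and> C \<subseteq> {e \<in> edge_set f. e \<subseteq> K}" if K: "K \<in> components {..<n} (edge_set f)" for K
  proof (rule ex_ex1I)
    obtain x where "x \<in> K" using component_nonempty[OF K] by blast
    then show "\<exists>C. is_cycle C \<and> C \<subseteq> {e \<in> edge_set f. e \<subseteq> K}"
      using cycle_in_component[OF K f _ RE] by blast
  next
    fix C D assume C: "is_cycle C \<and> C \<subseteq> {e \<in> edge_set f. e \<subseteq> K}"
      and D: "is_cycle D \<and> D \<subseteq> {e \<in> edge_set f. e \<subseteq> K}"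
    obtain S where S: "cyclic_on f S" "C = (\<lambda>u. {u, f u}) ` S"
      using is_cycle_cyclic_on[OF f, of C] C by blast
    obtain T where T: "cyclic_on f T" "D = (\<lambda>u. {u, f u}) ` T"
      using is_cycle_cyclic_on[OF f, of D] D by blast
    obtain u where u: "u \<in> S" using S(1) unfolding cyclic_on_def by blast
    obtain w where w: "w \<in> T" using T(1) unfolding cyclic_on_def by blast
    have "u \<in> K" "w \<in> K" using u w C D S(2) T(2) by blast+
    then obtain i j where ij: "(f ^^ i) u = (f ^^ j) w"
      using rtrancl_merge component_connected[OF K] by metis
    have "(f ^^ i) u \<in> S" "(f ^^ i) u \<in> T"
      using cyclic_on_funpow_in[OF S(1) u] cyclic_on_funpow_in[OF T(1) w] ij by metis+
    then have "S = T" using S(1) T(1) orbit_cyclic_eq3 by metis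
    then show "C = D" using S T by simp
  qed
  then show ?thesis using RE by (simp add: bicircular_bases_def)
qed

lemma root_closed:
  assumes f: "f \<in> maps W" "a \<notin> W" and x: "(f ^^ k) x = a" and e: "{x, w} \<in> edge_set f"
  shows "\<exists>k. (f ^^ k) w = a"
proof -
  obtain v where v: "v \<in> W" "{x, w} = {v, f v}" using e edge_set_maps[OF f(1)] by auto
  then consider "w = f x" "x \<in> W" | "x = f w" by (auto simp: doubleton_eq_iff)
  then show ?thesis
  proof cases
    case 1
    then have "k \<noteq> 0" using x f by (metis funpow_0)
    then obtain k' where "k = Suc k'" using not0_implies_Suc by blast
    then have "(f ^^ k') w = a" using x 1 by (simp add: funpow_swap1)
    then show ?thesis by blast
  next
    case 2
    then have "(f ^^ Suc k) w = a" using x by (simp add: funpow_swap1)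
    then show ?thesis by blast
  qed
qed

text \<open>Take a proper map with edges in \<open>R\<close> and as many active vertices as possible. If \<open>a\<close> is inactive, then
  by \<open>augment\<close> no unused edge of \<open>R\<close> meets the tree leading to \<open>a\<close>, so this tree is a component without
  a cycle. If all vertices are active but an edge of \<open>R\<close> is unused, deactivating a vertex on the cycle
  reached from that edge and augmenting yields a second cycle in the component.\<close>

lemma base_proper:
  assumes R: "R \<in> bicircular_bases {..<n} E"
  shows "\<exists>f\<in>proper {..<n}. edge_set f = R"
proof -
  have RE: "R \<subseteq> E" and uniq: "\<And>K. K \<in> components {..<n} R \<Longrightarrow>
      \<exists>!C. is_cycle C \<and> C \<subseteq> {e \<in> R. e \<subseteq> K}"
    using R by (auto simp: bicircular_bases_def)
  define Q where "Q = (\<lambda>m. \<exists>W f. W \<subseteq> {..<n} \<and> f \<in> proper W \<and> edge_set f \<subseteq> R \<and> card W = m)"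
  have "Q 0" unfolding Q_def
    by (intro exI[of _ "{}"] exI[of _ id]) (auto simp: proper_def maps_def edge_set_def)
  moreover have bound: "\<And>m. Q m \<Longrightarrow> m \<le> n"
    unfolding Q_def by (metis card_lessThan card_mono finite_lessThan)
  ultimately obtain m where m: "Q m" "\<And>m'. Q m' \<Longrightarrow> m' \<le> m"
    using ex_has_greatest_nat[of Q 0 id "Suc n"] by (auto simp: less_Suc_eq_le)
  then obtain W f where W: "W \<subseteq> {..<n}" and f: "f \<in> proper W" and fR: "edge_set f \<subseteq> R" and cW: "card W = m"
    unfolding Q_def by blast
  have "finite W" using W by (meson finite_lessThan finite_subset)
  have fW: "f \<in> maps W" by (rule proper_maps[OF f])
  have "W = {..<n}"
  proof (rule ccontr)
    assume "W \<noteq> {..<n}"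
    then obtain a where a: "a < n" "a \<notin> W" using W by blast
    define X where "X = {x. \<exists>k. (f ^^ k) x = a}"
    have "a \<in> X" unfolding X_def by (simp, metis funpow_0)
    have inf: "{x, w} \<in> edge_set f" if x: "x \<in> X" and e: "{x, w} \<in> R" for x w
    proof (rule ccontr)
      assume ne: "{x, w} \<notin> edge_set f"
      obtain k where "(f ^^ k) x = a" using x by (auto simp: X_def)
      then obtain g where g: "g \<in> proper (insert a W)" "edge_set g = insert {x, w} (edge_set f)"
        using augment[OF f a(2) _ _ ne] e RE by blast
      then have "edge_set g \<subseteq> R" "insert a W \<subseteq> {..<n}" "card (insert a W) = Suc m"
        using fR e a W cW \<open>finite W\<close> by auto
      then have "Q (Suc m)" using g(1) unfolding Q_def by blast
      then show False using m(2) by fastforce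
    qed
    obtain K where K: "K \<in> components {..<n} R" "a \<in> K" using component_exists[of a "{..<n}"] a by auto
    have KX: "K \<subseteq> X"
    proof (rule component_subset_closed[OF K \<open>a \<in> X\<close>])
      fix x y assume "x \<in> X" "{x, y} \<in> R"
      then show "y \<in> X" using inf[of x y] root_closed[OF fW a(2)] unfolding X_def by blast
    qed
    obtain C where C: "is_cycle C" "C \<subseteq> {e \<in> R. e \<subseteq> K}" using uniq[OF K(1)] by blast
    have "C \<subseteq> edge_set f"
    proof
      fix e assume "e \<in> C"
      then have e: "e \<in> R" "e \<subseteq> K" using C by auto
      then obtain u v where "e = {u, v}" using RE edge_cases by blast
      then show "e \<in> edge_set f" using inf[of u v] e KX by auto
    qed
    then obtain S where S: "S \<subseteq> W" "cyclic_on f S" "C = (\<lambda>u. {u, f u}) ` S"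
      using is_cycle_cyclic_on[OF f C(1)] by blast
    obtain u where u: "u \<in> S" using S(2) unfolding cyclic_on_def by blast
    then have "u \<in> K" using S(3) C(2) by blast
    then obtain k where "(f ^^ k) u = a" using KX by (auto simp: X_def)
    then have "a \<in> S" using cyclic_on_funpow_in[OF S(2) u] by metis
    then show False using S(1) a by blast
  qed
  note f = f[unfolded this] and fV = fW[unfolded this]
  have "edge_set f = R"
  proof (rule ccontr)
    assume "edge_set f \<noteq> R"
    then obtain e where e: "e \<in> R" "e \<notin> edge_set f" using fR by blast
    then obtain x w where xw: "e = {x, w}" using RE edge_cases by blast
    have xn: "x < n" using edgeD(1)[of x w] e xw RE by auto
    then obtain K where K: "K \<in> components {..<n} R" "x \<in> K" using component_exists[of x "{..<n}"] by auto
    from cycle_in_component[OF K(1) f fR RE K(2)] obtain k0 S where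
      S: "(f ^^ k0) x \<in> S" "cyclic_on f S" "S \<subseteq> {..<n}" "is_cycle ((\<lambda>u. {u, f u}) ` S)"
         "(\<lambda>u. {u, f u}) ` S \<subseteq> {e \<in> R. e \<subseteq> K}" by blast
    define a where "a = (f ^^ k0) x"
    \<comment> \<open>The first arrival at \<open>a\<close> is taken: up to then the path does not
      use the arc out of \<open>a\<close>, so it survives in \<open>g\<close>, where
      \<open>a\<close> is inactive.\<close>
    define k where "k = (LEAST k. (f ^^ k) x = a)"
    have k: "(f ^^ k) x = a" unfolding k_def by (rule LeastI[of _ k0]) (simp add: a_def)
    have nk: "(f ^^ i) x \<noteq> a" if "i < k" for i using that not_less_Least k_def by blast
    have aS: "a \<in> S" "a < n" using S by (auto simp: a_def)
    define g where "g = f(a := a)"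
    have g: "g \<in> proper ({..<n} - {a})" using f by (auto simp: proper_def maps_def g_def)
    have gi: "(g ^^ i) x = (f ^^ i) x" if "i \<le> k" for i
      using that by (induction i) (auto simp: g_def nk)
    have eg: "edge_set f = insert {a, f a} (edge_set g)"
      unfolding edge_set_maps[OF fV] edge_set_maps[OF proper_maps[OF g]] using aS
      by (auto simp: g_def)
    have nag: "{a, f a} \<notin> edge_set g"
    proof
      assume "{a, f a} \<in> edge_set g"
      then obtain u where "u < n" "u \<noteq> a" "{a, f a} = {u, f u}"
        unfolding edge_set_maps[OF proper_maps[OF g]] by (auto simp: g_def)
      then show False using proper_owner[OF f, of a u] aS by auto
    qed
    have "(g ^^ k) x = a" using gi k by simp
    moreover have "e \<notin> edge_set g" using e eg by blast
    ultimately obtain h where h: "h \<in> proper (insert a ({..<n} - {a}))" "edge_set h = insert e (edge_set g)"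
      using augment[OF g, of a k x w] e xw RE by blast
    have "insert a ({..<n} - {a}) = {..<n}" using aS by auto
    then have h1: "h \<in> proper {..<n}" using h by simp
    have "edge_set g \<subseteq> R" using fR unfolding eg by blast
    then have "edge_set h \<subseteq> R" unfolding h(2) using e(1) by blast
    from cycle_in_component[OF K(1) h1 this RE K(2)] obtain T where
      T: "is_cycle ((\<lambda>u. {u, h u}) ` T)" "(\<lambda>u. {u, h u}) ` T \<subseteq> {e \<in> R. e \<subseteq> K}" "T \<subseteq> {..<n}" by blast
    \<comment> \<open>Uniqueness identifies the cycle of \<open>h\<close> with that of
      \<open>f\<close>, which contains \<open>{a, f a}\<close>. But \<open>h\<close> no longer has
      this edge, since the only edge it gained is \<open>e\<close>.\<close>
    have "(\<lambda>u. {u, h u}) ` T = (\<lambda>u. {u, f u}) ` S" using uniq[OF K(1)] T S by blast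
    moreover have "(\<lambda>u. {u, h u}) ` T \<subseteq> edge_set h"
      using edge_set_maps[OF proper_maps[OF h1]] T(3) by blast
    moreover have "{a, f a} \<in> (\<lambda>u. {u, f u}) ` S" using aS by blast
    ultimately have "{a, f a} \<in> edge_set h" by blast
    then have "{a, f a} = e" unfolding h(2) using nag by blast
    then show False using e(2) unfolding eg by blast
  qed
  then show ?thesis using f by blast
qed

lemma card_bases: "card (bicircular_bases {..<n} E) = card (good {..<n})"
proof -
  have "bij_betw edge_set (good {..<n}) (bicircular_bases {..<n} E)"
  proof (rule bij_betw_imageI)
    show "inj_on edge_set (good {..<n})" by (rule inj_onI) (rule good_unique[of _ "{..<n}"], auto)
    have "edge_set ` good {..<n} \<subseteq> bicircular_bases {..<n} E"
      using good_proper proper_base by blast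
    moreover have "R \<in> edge_set ` good {..<n}" if R: "R \<in> bicircular_bases {..<n} E" for R
    proof -
      obtain f where "f \<in> proper {..<n}" "edge_set f = R" using base_proper[OF R] by blast
      then show ?thesis using orient[of f "{..<n}"] by auto
    qed
    ultimately show "edge_set ` good {..<n} = bicircular_bases {..<n} E" by blast
  qed
  then show ?thesis by (simp add: bij_betw_same_card)
qed

end

section \<open>Comparing the numbers of good maps on a connected graph\<close>

locale connected_graph_on = finite_graph +
  assumes connected: "connected_graph {..<n} E"
    and card_edges: "n \<le> card E"
begin

lemma n_pos: "0 < n" using connected by (auto simp: connected_graph_def lessThan_empty_iff)

lemma leaving_edge:
  assumes "K \<subseteq> {..<n}" "a \<in> K" "K \<noteq> {..<n}"
  shows "\<exists>x w. x \<in> K \<and> w \<notin> K \<and> {x, w} \<in> E"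
proof (rule ccontr)
  assume *: "\<not> ?thesis"
  obtain b where b: "b < n" "b \<notin> K" using assms by blast
  have "(a, b) \<in> {(x, y). {x, y} \<in> E}\<^sup>*"
    using connected assms b by (auto simp: connected_graph_def reachability_def)
  then have "b \<in> K" using assms(2) by induction (use * in blast)+
  then show False using b by simp
qed

lemma free_edge:
  assumes f: "f \<in> maps W" and W: "W \<subseteq> {..<n}" and a: "a < n" "a \<notin> W"
  shows "\<exists>k x w. (f ^^ k) x = a \<and> {x, w} \<in> E \<and> {x, w} \<notin> edge_set f"
proof -
  define X where "X = {x. \<exists>k. (f ^^ k) x = a}"
  have aX: "a \<in> X" unfolding X_def by (simp, metis funpow_0)
  have "X \<subseteq> {..<n}"
  proof
    fix x assume "x \<in> X"
    then obtain k where k: "(f ^^ k) x = a" by (auto simp: X_def)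
    show "x \<in> {..<n}"
    proof (rule ccontr)
      assume "x \<notin> {..<n}"
      then have "f x = x" using maps_fix[OF f] W by blast
      then have "(f ^^ i) x = x" for i by (induction i) auto
      then show False using k a \<open>x \<notin> {..<n}\<close> by auto
    qed
  qed
  show ?thesis
  proof (cases "X = {..<n}")
    case False
    then obtain x w where xw: "x \<in> X" "w \<notin> X" "{x, w} \<in> E"
      using leaving_edge[OF \<open>X \<subseteq> {..<n}\<close> aX] by blast
    then have "{x, w} \<notin> edge_set f" using root_closed[OF f a(2)] unfolding X_def by blast
    then show ?thesis using xw unfolding X_def by blast
  next
    case True
    have "finite W" using W by (meson finite_lessThan finite_subset)
    have "W \<subset> {..<n}" using W a by auto
    then have "card W < n" by (metis card_lessThan finite_lessThan psubset_card_mono)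
    then have "card (edge_set f) < card E"
      using card_image_le[OF \<open>finite W\<close>, of "\<lambda>v. {v, f v}"] card_edges edge_set_maps[OF f] by simp
    moreover have "finite (edge_set f)" using \<open>finite W\<close> edge_set_maps[OF f] by simp
    ultimately have "\<not> E \<subseteq> edge_set f" using card_mono[of "edge_set f" E] by linarith
    then obtain e where e: "e \<in> E" "e \<notin> edge_set f" by blast
    then obtain x w where xw: "e = {x, w}" using edge_cases by blast
    then have "x \<in> X" using True edgeD(1) e by auto
    then show ?thesis using e xw unfolding X_def by blast
  qed
qed

text \<open>The edge set of \<open>f\<close> can be extended by one edge to that of a good map with \<open>a\<close> active. The vertex owning
  the new edge tells which edge to delete, so \<open>f\<close> is recovered by \<open>good_unique\<close>.\<close>

lemma card_good_le:
  assumes W: "W \<subseteq> {..<n}" and a: "a < n" "a \<notin> W"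
  shows "card (good W) \<le> n * card (good (insert a W))"
proof -
  have ex: "\<exists>p. fst p < n \<and> snd p \<in> good (insert a W) \<and>
      edge_set f = edge_set (snd p) - {{fst p, snd p (fst p)}}" if f: "f \<in> good W" for f
  proof -
    have fp: "f \<in> proper W" using good_proper f by blast
    obtain k x w where xw: "(f ^^ k) x = a" "{x, w} \<in> E" "{x, w} \<notin> edge_set f"
      using free_edge[OF good_maps[OF f] W a] by blast
    obtain g where g: "g \<in> proper (insert a W)" "edge_set g = insert {x, w} (edge_set f)"
      using augment[OF fp a(2) xw] by blast
    obtain h where h: "h \<in> good (insert a W)" "edge_set h = edge_set g"
      using orient[OF g(1)] W a by auto
    have "{x, w} \<in> edge_set h" using h g by simp
    then obtain y where "y \<in> insert a W" "{x, w} = {y, h y}"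
      using edge_set_maps[OF good_maps[OF h(1)]] by auto
    then show ?thesis using h g xw(3) W a by (intro exI[of _ "(y, h)"]) auto
  qed
  define p where "p = (\<lambda>f. SOME p. fst p < n \<and> snd p \<in> good (insert a W) \<and>
      edge_set f = edge_set (snd p) - {{fst p, snd p (fst p)}})"
  have p: "fst (p f) < n \<and> snd (p f) \<in> good (insert a W) \<and>
      edge_set f = edge_set (snd (p f)) - {{fst (p f), snd (p f) (fst (p f))}}" if "f \<in> good W" for f
    unfolding p_def by (rule someI_ex) (rule ex[OF that])
  have "inj_on p (good W)"
  proof (rule inj_onI)
    fix f g assume f: "f \<in> good W" and g: "g \<in> good W" and "p f = p g"
    then have "edge_set f = edge_set g" using p[OF f] p[OF g] by simp
    then show "f = g" by (rule good_unique[OF f g W])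
  qed
  moreover have "p ` good W \<subseteq> {..<n} \<times> good (insert a W)"
  proof
    fix q assume "q \<in> p ` good W"
    then show "q \<in> {..<n} \<times> good (insert a W)" using p by (auto simp: mem_Times_iff)
  qed
  moreover have "finite (good (insert a W))" by (rule finite_good) (use W a in auto)
  ultimately have "card (good W) \<le> card ({..<n} \<times> good (insert a W))"
    by (intro card_inj_on_le) auto
  then show ?thesis by (simp add: card_cartesian_product)
qed

lemma card_good_pos:
  assumes "W \<subseteq> {..<n}" shows "0 < card (good W)"
proof -
  have "finite W" using assms by (meson finite_lessThan finite_subset)
  then show ?thesis using assms
  proof (induction W)
    case empty then show ?case by (simp add: good_empty)
  next
    case (insert a W)
    then have "card (good W) \<le> n * card (good (insert a W))" by (intro card_good_le) auto
    moreover have "0 < card (good W)" using insert by auto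
    ultimately show ?case by (metis gr0I mult_0_right not_le)
  qed
qed

end

section \<open>Popping cycles\<close>

lemma sum_disjoint_pairs:
  fixes h :: "'a set \<Rightarrow> 'a set \<Rightarrow> real"
  assumes "finite W" "v \<notin> W"
  shows "(\<Sum>S\<in>Pow W. \<Sum>T | v \<in> T \<and> T \<subseteq> insert v (W - S). h S T)
    = (\<Sum>T | v \<in> T \<and> T \<subseteq> insert v W. \<Sum>S\<in>Pow (W - T). h S T)"
proof -
  have fin: "finite {T. v \<in> T \<and> T \<subseteq> insert v U}" if "finite U" for U
    by (rule finite_subset[of _ "Pow (insert v U)"]) (use that in auto)
  have "(\<Sum>S\<in>Pow W. \<Sum>T | v \<in> T \<and> T \<subseteq> insert v (W - S). h S T)
      = (\<Sum>(S, T)\<in>(SIGMA S:Pow W. {T. v \<in> T \<and> T \<subseteq> insert v (W - S)}). h S T)"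
    by (rule sum.Sigma) (use assms(1) fin in auto)
  also have "\<dots> = (\<Sum>(T, S)\<in>(SIGMA T:{T. v \<in> T \<and> T \<subseteq> insert v W}. Pow (W - T)). h S T)"
    by (rule sum.reindex_bij_witness[where i = "\<lambda>(T, S). (S, T)" and j = "\<lambda>(S, T). (T, S)"])
      (use assms in auto)
  also have "\<dots> = (\<Sum>T | v \<in> T \<and> T \<subseteq> insert v W. \<Sum>S\<in>Pow (W - T). h S T)"
    by (rule sum.Sigma[symmetric]) (use assms(1) fin in auto)
  finally show ?thesis .
qed

text \<open>For \<open>G\<close> counting good maps, \<open>popping_total c G W / G W\<close> is the expected number of draws until \<open>W\<close> is the
  active set: one per vertex, and \<open>card S\<close> more each time \<open>S\<close> is popped, which happens
  \<open>c S * G (W - S) / G W\<close> times on average.\<close>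

definition popping_total :: "('a set \<Rightarrow> real) \<Rightarrow> ('a set \<Rightarrow> real) \<Rightarrow> 'a set \<Rightarrow> real" where
  "popping_total c G W = real (card W) * G W + (\<Sum>S\<in>Pow W. real (card S) * c S * G (W - S))"

text \<open>After division by \<open>r * G W\<close>: one draw raises the average of
  \<open>popping_total c G U / G U\<close> by exactly 1. The terms for a cycle \<open>T\<close>
  closed by the draw and a disjoint cycle \<open>S\<close> from \<open>popping_total\<close> occur
  with opposite signs and cancel by \<open>sum_disjoint_pairs\<close>.\<close>

lemma popping_total_step:
  fixes c G :: "'a set \<Rightarrow> real"
  assumes "finite W" "v \<notin> W"
    and rec: "\<And>U. U \<subseteq> W \<Longrightarrow>
      r * G U = G (insert v U) + (\<Sum>S | v \<in> S \<and> S \<subseteq> insert v U. c S * G (U - S))"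
  shows "popping_total c G (insert v W)
      + (\<Sum>S | v \<in> S \<and> S \<subseteq> insert v W. c S * popping_total c G (W - S))
    = r * (popping_total c G W + G W)"
proof -
  let ?Sv = "\<lambda>U. {S. v \<in> S \<and> S \<subseteq> insert v U}"
  have fin: "finite (?Sv U)" if "finite U" for U
    by (rule finite_subset[of _ "Pow (insert v U)"]) (use that in auto)
  have "Pow (insert v W) = Pow W \<union> ?Sv W" using assms(2) by auto
  moreover have "Pow W \<inter> ?Sv W = {}" using assms(2) by auto
  ultimately have split: "(\<Sum>S\<in>Pow (insert v W). h S) = (\<Sum>S\<in>Pow W. h S) + (\<Sum>S\<in>?Sv W. h S)"
    for h :: "'a set \<Rightarrow> real"
    using assms(1) fin[OF assms(1)] by (simp add: sum.union_disjoint)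
  have 1: "(\<Sum>S\<in>Pow W. real (card S) * c S * G (insert v W - S))
     = r * (\<Sum>S\<in>Pow W. real (card S) * c S * G (W - S))
       - (\<Sum>S\<in>Pow W. \<Sum>T\<in>?Sv (W - S). real (card S) * c S * (c T * G (W - S - T)))"
  proof -
    have "real (card S) * c S * G (insert v W - S) = r * (real (card S) * c S * G (W - S))
       - (\<Sum>T\<in>?Sv (W - S). real (card S) * c S * (c T * G (W - S - T)))" if "S \<in> Pow W" for S
    proof -
      have "insert v W - S = insert v (W - S)" using that assms(2) by auto
      then have eq: "G (insert v W - S) = r * G (W - S) - (\<Sum>T\<in>?Sv (W - S). c T * G (W - S - T))"
        using rec[of "W - S"] by auto
      show ?thesis unfolding sum_distrib_left[symmetric] eq by (simp add: algebra_simps)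
    qed
    then show ?thesis by (simp add: sum_subtractf sum_distrib_left)
  qed
  \<comment> \<open>As \<open>S\<close> contains \<open>v\<close>, the two cardinalities always add
    up to \<open>card W + 1\<close>, which can be pulled out of the sum.\<close>
  have 2: "(\<Sum>S\<in>?Sv W. real (card S) * c S * G (insert v W - S))
      + (\<Sum>S\<in>?Sv W. c S * (real (card (W - S)) * G (W - S)))
      = real (card W + 1) * (\<Sum>S\<in>?Sv W. c S * G (W - S))"
  proof -
    have "real (card S) * c S * G (insert v W - S) + c S * (real (card (W - S)) * G (W - S))
        = real (card W + 1) * (c S * G (W - S))" if "S \<in> ?Sv W" for S
    proof -
      have eq: "insert v W - S = W - S" using that by auto
      have "S \<union> (W - S) = insert v W" using that by auto
      moreover have "finite S" using that assms(1) by (metis (mono_tags, lifting) finite_insert finite_subset mem_Collect_eq)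
      ultimately have "card S + card (W - S) = card W + 1"
        using assms by (metis Diff_disjoint Suc_eq_plus1 card_Un_disjoint card_insert_disjoint finite_Diff)
      then have "real (card W + 1) = real (card S) + real (card (W - S))" by linarith
      then show ?thesis unfolding eq by (simp add: algebra_simps)
    qed
    then show ?thesis by (simp add: sum.distrib[symmetric] sum_distrib_left)
  qed
  have 3: "(\<Sum>S\<in>?Sv W. c S * popping_total c G (W - S))
      = (\<Sum>S\<in>?Sv W. c S * (real (card (W - S)) * G (W - S)))
        + (\<Sum>T\<in>?Sv W. \<Sum>S\<in>Pow (W - T). real (card S) * c S * (c T * G (W - S - T)))"
  proof -
    have "W - T - S = W - S - T" for S T :: "'a set" by auto
    then show ?thesis by (simp add: popping_total_def algebra_simps sum.distrib sum_distrib_left)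
  qed
  have 4: "popping_total c G (insert v W) = real (card W + 1) * G (insert v W)
     + (\<Sum>S\<in>Pow W. real (card S) * c S * G (insert v W - S))
     + (\<Sum>S\<in>?Sv W. real (card S) * c S * G (insert v W - S))"
    using assms by (simp add: popping_total_def split)
  have "popping_total c G (insert v W) + (\<Sum>S\<in>?Sv W. c S * popping_total c G (W - S))
      = real (card W + 1) * (G (insert v W) + (\<Sum>S\<in>?Sv W. c S * G (W - S)))
        + r * (\<Sum>S\<in>Pow W. real (card S) * c S * G (W - S))"
    unfolding 4 3 using 1 2 sum_disjoint_pairs[OF assms(1,2),
      of "\<lambda>S T. real (card S) * c S * (c T * G (W - S - T))"] by (simp add: algebra_simps)
  also have "\<dots> = real (card W + 1) * (r * G W) + r * (\<Sum>S\<in>Pow W. real (card S) * c S * G (W - S))"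
    using rec[of W] by simp
  also have "\<dots> = r * (popping_total c G W + G W)"
    by (simp add: popping_total_def algebra_simps)
  finally show ?thesis .
qed

text \<open>\<open>orbit g v\<close> starts at \<open>g v\<close> and contains \<open>v\<close> only
  if \<open>v\<close> is on a cycle, so the first condition says that the new arc closes
  one.\<close>

definition pop_cycle :: "nat \<Rightarrow> (nat \<Rightarrow> nat) \<Rightarrow> nat \<Rightarrow> nat" where
  "pop_cycle v g = (if v \<in> orbit g v \<and> \<not> ok_cycle g (orbit g v) then glue (orbit g v) id g else g)"

lemma pop_cycle_fixed: "f v = v \<Longrightarrow> pop_cycle v f = f"
proof -
  assume "f v = v"
  then have "orbit f v = {v}" by (simp add: orbit_eq_singleton_iff)
  then show ?thesis using \<open>f v = v\<close> by (auto simp: pop_cycle_def glue_def)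
qed

section \<open>The effect of one draw on a uniform good map\<close>

context finite_graph
begin

definition bad_cycles :: "nat set \<Rightarrow> (nat \<Rightarrow> nat) set" where
  "bad_cycles S = {f \<in> maps S. cyclic_on f S \<and> \<not> ok_cycle f S}"

definition deg :: "nat \<Rightarrow> nat" where
  "deg v = card {w. {v, w} \<in> E}"

text \<open>A draw of a non-neighbour has the effect of popping a loop, so there are \<open>n - deg v\<close> forbidden loops
  at \<open>v\<close> besides the forbidden cycles.\<close>

definition bad_weight :: "nat set \<Rightarrow> real" where
  "bad_weight S = real (card (bad_cycles S)) + (if is_singleton S then real (n - deg (the_elem S)) else 0)"

definition draw_step :: "nat \<Rightarrow> nat \<Rightarrow> (nat \<Rightarrow> nat) \<Rightarrow> nat \<Rightarrow> nat" where
  "draw_step v x f = pop_cycle v (f(v := if {v, x} \<in> E then x else v))"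

lemma cyclic_on_maps_subset:
  assumes "f \<in> maps W" "cyclic_on f S" "v \<in> S" "v \<in> W"
  shows "S \<subseteq> W"
proof
  fix u assume u: "u \<in> S"
  show "u \<in> W"
  proof (rule ccontr)
    assume "u \<notin> W"
    then have "orbit f u = {u}" using maps_fix[OF assms(1)] by (simp add: orbit_eq_singleton_iff)
    moreover have "orbit f u = S" by (rule orbit_cyclic_eq3[OF assms(2) u])
    ultimately show False using assms(3,4) \<open>u \<notin> W\<close> by auto
  qed
qed

lemma finite_bad_cycles: "S \<subseteq> {..<n} \<Longrightarrow> finite (bad_cycles S)"
  by (rule finite_subset[OF _ finite_maps]) (auto simp: bad_cycles_def)

text \<open>These are the maps between a draw of a neighbour and the popping: only cycles through
  the new vertex can be forbidden.\<close>

lemma maps_upd_image: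
  assumes "v \<notin> W"
  shows "(\<lambda>(f, x). f(v := x)) ` (good W \<times> {x. {v, x} \<in> E})
    = {g \<in> maps (insert v W). \<forall>S\<subseteq>W. cyclic_on g S \<longrightarrow> ok_cycle g S}" (is "?L = ?R")
proof
  show "?L \<subseteq> ?R"
  proof
    fix g assume "g \<in> ?L"
    then obtain f x where fx: "f \<in> good W" "{v, x} \<in> E" "g = f(v := x)" by auto
    have "g \<in> maps (insert v W)" using good_maps[OF fx(1)] fx(2,3) by (auto simp: maps_def)
    moreover have "ok_cycle g S" if S: "S \<subseteq> W" "cyclic_on g S" for S
    proof -
      have eq: "f u = g u" if "u \<in> S" for u using that S(1) assms fx(3) by auto
      then have "cyclic_on f S" using cyclic_cong[of S f g] S(2) by simp
      then show ?thesis using ok_cycle_cong[of f S g] eq fx(1) S(1) by (auto simp: good_def)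
    qed
    ultimately show "g \<in> ?R" by blast
  qed
  show "?R \<subseteq> ?L"
  proof
    fix g assume g: "g \<in> ?R"
    define f where "f = g(v := v)"
    have "f \<in> maps W" using g assms by (auto simp: f_def maps_def)
    moreover have "ok_cycle f S" if S: "S \<subseteq> W" "cyclic_on f S" for S
    proof -
      have eq: "g u = f u" if "u \<in> S" for u using that S(1) assms by (auto simp: f_def)
      then have "cyclic_on g S" using cyclic_cong[of S g f] S(2) by simp
      then show ?thesis using ok_cycle_cong[of g S f] eq g S(1) by auto
    qed
    ultimately have "f \<in> good W" by (simp add: good_def)
    moreover have "{v, g v} \<in> E" using g by (auto simp: maps_def)
    moreover have "g = f(v := g v)" by (auto simp: f_def)
    ultimately show "g \<in> ?L" by (intro image_eqI[of _ _ "(f, g v)"]) auto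
  qed
qed

lemma orbit_glue:
  assumes "cyclic_on z S" "v \<in> S"
  shows "orbit (glue S z h) v = S"
  by (rule orbit_cyclic_eq3[OF cyclic_on_glue[OF assms(1)] assms(2)])

text \<open>Together with \<open>bad_split\<close> and \<open>glue_bad_eqD\<close> this is the
  bijection that makes popping uniform: a map that gets popped amounts to a forbidden cycle on
  \<open>S\<close> and an arbitrary good map on \<open>W - S\<close>, and popping returns the
  latter.\<close>

lemma glue_bad:
  assumes z: "z \<in> bad_cycles S" and h: "h \<in> good (W - S)" and S: "v \<in> S" "S \<subseteq> insert v W"
    and "v \<notin> W"
  shows "glue S z h \<in> maps (insert v W)" "\<forall>T\<subseteq>W. cyclic_on (glue S z h) T \<longrightarrow> ok_cycle (glue S z h) T"
    "glue S z h \<notin> good (insert v W)" "pop_cycle v (glue S z h) = h"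
proof -
  have z': "z \<in> maps S" "cyclic_on z S" "\<not> ok_cycle z S" using z by (auto simp: bad_cycles_def)
  have "h \<in> maps (W - S)" by (rule good_maps[OF h])
  then show "glue S z h \<in> maps (insert v W)" using z'(1) S by (auto simp: maps_def glue_def)
  have notok: "\<not> ok_cycle (glue S z h) S"
    using ok_cycle_cong[OF z'(2), of "glue S z h"] z'(3) by (auto simp: glue_def)
  have cyc: "cyclic_on (glue S z h) S" by (rule cyclic_on_glue[OF z'(2)])
  then show "glue S z h \<notin> good (insert v W)" using notok S(2) by (auto simp: good_def)
  show "\<forall>T\<subseteq>W. cyclic_on (glue S z h) T \<longrightarrow> ok_cycle (glue S z h) T"
  proof (intro allI impI)
    fix T assume T: "T \<subseteq> W" "cyclic_on (glue S z h) T"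
    have "T \<noteq> S" using T(1) S(1) \<open>v \<notin> W\<close> by blast
    then have T': "T \<inter> S = {}" "cyclic_on h T" using cyclic_on_glue_cases[OF z'(2) T(2)] by auto
    then have "T \<subseteq> W - S" using T(1) by blast
    then have "ok_cycle h T" using h T'(2) by (simp add: good_def)
    moreover have "h u = glue S z h u" if u: "u \<in> T" for u
    proof -
      have "u \<notin> S" using u T'(1) by blast
      then show ?thesis by (simp add: glue_def)
    qed
    ultimately show "ok_cycle (glue S z h) T" using ok_cycle_cong[OF T'(2), of "glue S z h"] by blast
  qed
  have "glue S id (glue S z h) = h"
    using maps_fix[OF \<open>h \<in> maps (W - S)\<close>] by (auto simp: glue_def)
  then show "pop_cycle v (glue S z h) = h"
    unfolding pop_cycle_def orbit_glue[OF z'(2) S(1)] using notok S(1) by simp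
qed

lemma glue_bad_eqD:
  assumes "z \<in> bad_cycles S" "z' \<in> bad_cycles S'" "h \<in> good (W - S)" "h' \<in> good (W - S')"
    "v \<in> S" "v \<in> S'" "glue S z h = glue S' z' h'"
  shows "S = S' \<and> z = z' \<and> h = h'"
proof -
  have c: "cyclic_on z S" "cyclic_on z' S'" "z \<in> maps S" "z' \<in> maps S'"
    using assms by (auto simp: bad_cycles_def)
  have SS: "S = S'" using orbit_glue[OF c(1) assms(5), of h] orbit_glue[OF c(2) assms(6), of h'] assms(7) by simp
  have "z u = z' u" for u
    using fun_cong[OF assms(7), of u] SS maps_fix[OF c(3), of u] maps_fix[OF c(4), of u]
    by (cases "u \<in> S") (auto simp: glue_def)
  moreover have "h u = h' u" for u
    using fun_cong[OF assms(7), of u] SS maps_fix[OF good_maps[OF assms(3)], of u]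
      maps_fix[OF good_maps[OF assms(4)], of u] by (cases "u \<in> S") (auto simp: glue_def)
  ultimately show ?thesis using SS by auto
qed

lemma bad_split:
  assumes v: "v \<notin> W" and g: "g \<in> maps (insert v W)" "\<forall>S\<subseteq>W. cyclic_on g S \<longrightarrow> ok_cycle g S"
    and ng: "g \<notin> good (insert v W)"
  shows "\<exists>S z h. v \<in> S \<and> S \<subseteq> insert v W \<and> z \<in> bad_cycles S \<and> h \<in> good (W - S) \<and> g = glue S z h"
proof -
  obtain S where S: "S \<subseteq> insert v W" "cyclic_on g S" "\<not> ok_cycle g S"
    using g(1) ng by (auto simp: good_def)
  have vS: "v \<in> S"
  proof (rule ccontr)
    assume "v \<notin> S"
    then have "S \<subseteq> W" using S(1) by blast
    then show False using g(2) S(2,3) by blast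
  qed
  define z where "z = glue S g id"
  define h where "h = glue S id g"
  have zg: "g u = z u" if "u \<in> S" for u using that by (simp add: z_def glue_def)
  have "cyclic_on z S" using cyclic_cong[of S g z] zg S(2) by simp
  moreover have "\<not> ok_cycle z S" using ok_cycle_cong[OF S(2), of z] zg S(3) by simp
  moreover have "z \<in> maps S" using g(1) S(1) by (auto simp: z_def glue_def maps_def)
  ultimately have "z \<in> bad_cycles S" by (simp add: bad_cycles_def)
  moreover have "h \<in> maps (W - S)" using g(1) vS by (auto simp: h_def glue_def maps_def)
  moreover have "ok_cycle h T" if T: "T \<subseteq> W - S" "cyclic_on h T" for T
  proof -
    have eq: "g u = h u" if "u \<in> T" for u using that T(1) by (auto simp: h_def glue_def)
    then have "cyclic_on g T" using cyclic_cong[of T g h] T(2) by simp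
    then show ?thesis using ok_cycle_cong[of g T h] eq g(2) T(1) by auto
  qed
  ultimately have "z \<in> bad_cycles S" "h \<in> good (W - S)" by (auto simp: good_def)
  moreover have "g = glue S z h" by (auto simp: z_def h_def glue_def)
  ultimately show ?thesis using vS S(1) by blast
qed

text \<open>Each good map on \<open>insert v W\<close> arises from exactly one pair
  \<open>(f, x)\<close>, each good map on \<open>W - S\<close> from exactly
  \<open>bad_weight S\<close> pairs, whichever map it is. Hence a uniform good map remains uniform
  given the new active set.\<close>

lemma sum_draw_step:
  fixes F :: "(nat \<Rightarrow> nat) \<Rightarrow> real"
  assumes W: "W \<subseteq> {..<n}" and v: "v < n" "v \<notin> W"
  shows "(\<Sum>f\<in>good W. \<Sum>x<n. F (draw_step v x f)) = (\<Sum>g\<in>good (insert v W). F g)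
    + (\<Sum>S | v \<in> S \<and> S \<subseteq> insert v W. bad_weight S * (\<Sum>g\<in>good (W - S). F g))"
proof -
  let ?N = "{x. {v, x} \<in> E}"
  let ?Sv = "{S. v \<in> S \<and> S \<subseteq> insert v W}"
  let ?X = "{g \<in> maps (insert v W). \<forall>S\<subseteq>W. cyclic_on g S \<longrightarrow> ok_cycle g S}"
  let ?T = "SIGMA S:?Sv. bad_cycles S \<times> good (W - S)"
  let ?glue = "\<lambda>(S, z, h). glue S z h"
  have N: "?N \<subseteq> {..<n}" using edgeD(2) by blast
  have Wv: "insert v W \<subseteq> {..<n}" using W v by auto
  have finW: "finite W" using W by (meson finite_lessThan finite_subset)
  have finSv: "finite ?Sv" by (rule finite_subset[of _ "Pow (insert v W)"]) (use finW in auto)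
  have finN: "finite ?N" using N by (meson finite_lessThan finite_subset)
  have finX: "finite ?X" by (rule finite_subset[OF _ finite_maps[OF Wv]]) auto
  have inner: "(\<Sum>x<n. F (draw_step v x f)) = (\<Sum>x\<in>?N. F (pop_cycle v (f(v := x)))) + real (n - deg v) * F f"
    if f: "f \<in> good W" for f
  proof -
    have "f v = v" using maps_fix[OF good_maps[OF f]] v by simp
    then have fv: "f(v := v) = f" by auto
    have "{..<n} = ?N \<union> ({..<n} - ?N)" using N by blast
    then have "(\<Sum>x<n. F (draw_step v x f)) = (\<Sum>x\<in>?N. F (draw_step v x f)) + (\<Sum>x\<in>{..<n} - ?N. F (draw_step v x f))"
      by (metis (no_types, lifting) Diff_disjoint finN finite_Diff finite_lessThan sum.union_disjoint)
    also have "(\<Sum>x\<in>?N. F (draw_step v x f)) = (\<Sum>x\<in>?N. F (pop_cycle v (f(v := x))))"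
      by (rule sum.cong) (auto simp: draw_step_def)
    also have "(\<Sum>x\<in>{..<n} - ?N. F (draw_step v x f)) = (\<Sum>x\<in>{..<n} - ?N. F f)"
      by (rule sum.cong) (auto simp: draw_step_def fv pop_cycle_fixed[of f v, OF \<open>f v = v\<close>])
    also have "\<dots> = real (n - deg v) * F f"
      using N finN by (simp add: deg_def card_Diff_subset)
    finally show ?thesis .
  qed
  have inj: "inj_on (\<lambda>(f, x). f(v := x)) (good W \<times> ?N)"
  proof (rule inj_onI, clarify)
    fix f x f' x' assume f: "f \<in> good W" "f' \<in> good W" and eq: "f(v := x) = f'(v := x')"
    have "f v = v" "f' v = v" using maps_fix[OF good_maps] f v by auto
    then have "f u = f' u" for u using fun_cong[OF eq, of u] by (cases "u = v") auto
    then show "f = f' \<and> x = x'" using fun_cong[OF eq, of v] by auto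
  qed
  have "(\<Sum>f\<in>good W. \<Sum>x\<in>?N. F (pop_cycle v (f(v := x))))
      = (\<Sum>(f, x)\<in>good W \<times> ?N. F (pop_cycle v (f(v := x))))"
    by (rule sum.cartesian_product)
  also have "\<dots> = (\<Sum>p\<in>good W \<times> ?N. F (pop_cycle v ((\<lambda>(f, x). f(v := x)) p)))"
    by (rule sum.cong) auto
  also have "\<dots> = (\<Sum>g\<in>(\<lambda>(f, x). f(v := x)) ` (good W \<times> ?N). F (pop_cycle v g))"
    by (subst sum.reindex[OF inj]) (simp add: o_def)
  also have "\<dots> = (\<Sum>g\<in>?X. F (pop_cycle v g))" unfolding maps_upd_image[OF v(2)] ..
  also have "?X = good (insert v W) \<union> ?glue ` ?T"
  proof
    show "?X \<subseteq> good (insert v W) \<union> ?glue ` ?T"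
    proof
      fix g assume g: "g \<in> ?X"
      show "g \<in> good (insert v W) \<union> ?glue ` ?T"
      proof (cases "g \<in> good (insert v W)")
        case False
        then obtain S z h where "v \<in> S" "S \<subseteq> insert v W" "z \<in> bad_cycles S" "h \<in> good (W - S)" "g = glue S z h"
          using bad_split[OF v(2), of g] g by blast
        then show ?thesis by (intro UnI2 image_eqI[of _ _ "(S, z, h)"]) auto
      qed blast
    qed
    show "good (insert v W) \<union> ?glue ` ?T \<subseteq> ?X"
      using glue_bad(1,2) v(2) by (auto simp: good_def)
  qed
  also have "(\<Sum>g\<in>good (insert v W) \<union> ?glue ` ?T. F (pop_cycle v g))
    = (\<Sum>g\<in>good (insert v W). F (pop_cycle v g)) + (\<Sum>g\<in>?glue ` ?T. F (pop_cycle v g))"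
  proof (rule sum.union_disjoint)
    show "finite (good (insert v W))" by (rule finite_good[OF Wv])
    have "finite ?T"
    proof (rule finite_SigmaI[OF finSv])
      fix S assume "S \<in> ?Sv"
      then have "S \<subseteq> {..<n}" "W - S \<subseteq> {..<n}" using Wv by auto
      then show "finite (bad_cycles S \<times> good (W - S))" using finite_bad_cycles finite_good by blast
    qed
    then show "finite (?glue ` ?T)" by blast
    show "good (insert v W) \<inter> ?glue ` ?T = {}" using glue_bad(3) v(2) by auto
  qed
  also have "(\<Sum>g\<in>good (insert v W). F (pop_cycle v g)) = (\<Sum>g\<in>good (insert v W). F g)"
  proof (rule sum.cong[OF refl])
    fix g assume g: "g \<in> good (insert v W)"
    have "ok_cycle g (orbit g v)" if "v \<in> orbit g v"
    proof -
      have c: "cyclic_on g (orbit g v)" by (rule cyclic_on_self_orbit[OF that])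
      then have "orbit g v \<subseteq> insert v W" using cyclic_on_maps_subset[OF good_maps[OF g] c that] by blast
      then show ?thesis using g c by (simp add: good_def)
    qed
    then show "F (pop_cycle v g) = F g" by (auto simp: pop_cycle_def)
  qed
  also have "(\<Sum>g\<in>?glue ` ?T. F (pop_cycle v g)) = (\<Sum>p\<in>?T. F (pop_cycle v (?glue p)))"
  proof -
    have "inj_on ?glue ?T"
    proof (rule inj_onI)
      fix a b assume a: "a \<in> ?T" and b: "b \<in> ?T" and eq: "?glue a = ?glue b"
      obtain S z h where ae: "a = (S, z, h)" by (metis prod_cases3)
      obtain S' z' h' where be: "b = (S', z', h')" by (metis prod_cases3)
      have "S = S' \<and> z = z' \<and> h = h'"
        by (rule glue_bad_eqD[of z S z' S' h W h' v]) (use a b eq ae be in auto)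
      then show "a = b" by (simp add: ae be)
    qed
    then show ?thesis by (subst sum.reindex) (simp_all add: o_def)
  qed
  also have "\<dots> = (\<Sum>(S, z, h)\<in>?T. F h)"
    by (rule sum.cong[OF refl]) (use glue_bad(4) v(2) in auto)
  also have "\<dots> = (\<Sum>S\<in>?Sv. \<Sum>(z, h)\<in>bad_cycles S \<times> good (W - S). F h)"
  proof (rule sum.Sigma[symmetric, OF finSv, rule_format])
    fix S assume "S \<in> ?Sv"
    then have "S \<subseteq> {..<n}" "W - S \<subseteq> {..<n}" using Wv by auto
    then show "finite (bad_cycles S \<times> good (W - S))" using finite_bad_cycles finite_good by blast
  qed
  also have "\<dots> = (\<Sum>S\<in>?Sv. real (card (bad_cycles S)) * (\<Sum>h\<in>good (W - S). F h))"
    by (rule sum.cong[OF refl]) (simp add: sum.cartesian_product[symmetric])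
  finally have main: "(\<Sum>f\<in>good W. \<Sum>x\<in>?N. F (pop_cycle v (f(v := x))))
     = (\<Sum>g\<in>good (insert v W). F g) + (\<Sum>S\<in>?Sv. real (card (bad_cycles S)) * (\<Sum>h\<in>good (W - S). F h))" .
  have single: "(\<Sum>S\<in>?Sv. (if is_singleton S then real (n - deg (the_elem S)) else 0) * (\<Sum>h\<in>good (W - S). F h))
     = real (n - deg v) * (\<Sum>h\<in>good W. F h)"
  proof -
    have "(\<Sum>S\<in>?Sv. (if is_singleton S then real (n - deg (the_elem S)) else 0) * (\<Sum>h\<in>good (W - S). F h))
      = (\<Sum>S\<in>{{v}}. (if is_singleton S then real (n - deg (the_elem S)) else 0) * (\<Sum>h\<in>good (W - S). F h))"
    proof (rule sum.mono_neutral_right[OF finSv])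
      show "{{v}} \<subseteq> ?Sv" by auto
      show "\<forall>S\<in>?Sv - {{v}}. (if is_singleton S then real (n - deg (the_elem S)) else 0) * (\<Sum>h\<in>good (W - S). F h) = 0"
        by (auto simp: is_singleton_def)
    qed
    also have "\<dots> = real (n - deg v) * (\<Sum>h\<in>good W. F h)" using v by simp
    finally show ?thesis .
  qed
  have "(\<Sum>f\<in>good W. \<Sum>x<n. F (draw_step v x f))
     = (\<Sum>f\<in>good W. (\<Sum>x\<in>?N. F (pop_cycle v (f(v := x)))) + real (n - deg v) * F f)"
    by (rule sum.cong[OF refl inner])
  also have "\<dots> = (\<Sum>f\<in>good W. \<Sum>x\<in>?N. F (pop_cycle v (f(v := x)))) + real (n - deg v) * (\<Sum>f\<in>good W. F f)"
    by (simp add: sum.distrib sum_distrib_left)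
  also have "\<dots> = (\<Sum>g\<in>good (insert v W). F g) + (\<Sum>S\<in>?Sv. bad_weight S * (\<Sum>g\<in>good (W - S). F g))"
    unfolding main single[symmetric] by (simp add: bad_weight_def distrib_right sum.distrib)
  finally show ?thesis .
qed

section \<open>Injections bounding the number of forbidden cycles\<close>

lemma good_attach:
  assumes h: "h \<in> good W" and "v \<notin> W" "w \<notin> W" "{v, w} \<in> E"
  shows "h(v := w) \<in> good (insert v W)"
proof -
  let ?g = "h(v := w)"
  have vw: "v \<noteq> w" by (rule edgeD(3)[OF assms(4)])
  have "?g \<in> maps (insert v W)" using good_maps[OF h] assms(4) by (auto simp: maps_def)
  moreover have "ok_cycle ?g T" if T: "T \<subseteq> insert v W" "cyclic_on ?g T" for T
  proof -
    have "v \<notin> T"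
    proof
      assume "v \<in> T"
      then have "w \<in> T" using cyclic_on_inI[OF T(2)] by fastforce
      then show False using T(1) vw assms(3) by blast
    qed
    then have "T \<subseteq> W" using T(1) by blast
    have eq: "h u = ?g u" if "u \<in> T" for u using that \<open>v \<notin> T\<close> by auto
    then have "cyclic_on h T" using cyclic_cong[of T h ?g] T(2) by simp
    then show ?thesis using ok_cycle_cong[of h T ?g] eq h \<open>T \<subseteq> W\<close> by (auto simp: good_def)
  qed
  ultimately show ?thesis by (simp add: good_def)
qed

lemma two_cycle_eq:
  fixes z :: "nat \<Rightarrow> nat"
  assumes "cyclic_on z S" "u \<in> S" "z (z u) = u" shows "S = {u, z u}"
  using not_ok_two_cycle(1)[of z u, OF assms(3)] assms(1,2) by (metis insertI1 orbit_cyclic_eq3)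

text \<open>Reversing a forbidden cycle of length at least 3 turns the map into a good one.\<close>

lemma card_long_bad_cycles:
  assumes W: "W \<subseteq> {..<n}"
  shows "card {(S, u, z, h) \<in> (SIGMA S:Pow W. S \<times> bad_cycles S \<times> good (W - S)). z (z u) \<noteq> u}
    \<le> n * card (good W)" (is "card ?A \<le> _")
proof -
  let ?p = "\<lambda>(S, u, z, h). (u, glue S (inv_into S z) h)"
  have A: "S \<subseteq> W \<and> u \<in> S \<and> cyclic_on z S \<and> z \<in> maps S \<and> h \<in> good (W - S) \<and>
      (\<forall>x\<in>S. inv_into S z (z x) = x) \<and> cyclic_on (inv_into S z) S \<and> glue S (inv_into S z) h \<in> good W"
    if t: "(S, u, z, h) \<in> ?A" for S u z h
  proof -
    have S: "S \<subseteq> W" "u \<in> S" and z: "z \<in> maps S" "cyclic_on z S" "\<not> ok_cycle z S"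
      and h: "h \<in> good (W - S)" and zu: "z (z u) \<noteq> u"
      using t by (auto simp: bad_cycles_def)
    have inv: "inv_into S z (z x) = x" if "x \<in> S" for x
      using that cyclic_on_inj_on[OF z(2)] by simp
    have cyc: "cyclic_on (inv_into S z) S" by (rule cyclic_on_inverse[OF z(2) inv])
    have "z (z x) \<noteq> x" if x: "x \<in> S" for x
    proof
      assume "z (z x) = x"
      moreover from this have "u = x \<or> u = z x" using two_cycle_eq[OF z(2) x] S(2) by blast
      ultimately show False using zu by auto
    qed
    then have "ok_cycle (inv_into S z) S" using ok_cycle_inverse[OF z(2) inv] z(3) by blast
    moreover have "{x, inv_into S z x} \<in> E" if x: "x \<in> S" for x
    proof -
      have "x \<in> z ` S" unfolding cyclic_on_image_eq[OF z(2)] by (rule x)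
      then obtain y where y: "y \<in> S" "x = z y" by blast
      then have "{x, inv_into S z x} = {y, z y}" using inv by auto
      then show ?thesis using maps_edge[OF z(1) y(1)] by simp
    qed
    ultimately have "glue S (inv_into S z) h \<in> good W" using glue_good[OF h S(1) cyc] by blast
    then show ?thesis using S z h inv cyc by blast
  qed
  \<comment> \<open>The marked vertex \<open>u\<close> locates the reversed cycle: \<open>S\<close>
    is its orbit under the glued map.\<close>
  have "inj_on ?p ?A"
  proof (rule inj_onI)
    fix a b assume a: "a \<in> ?A" and b: "b \<in> ?A" and eq: "?p a = ?p b"
    obtain S u z h where ae: "a = (S, u, z, h)" by (metis prod_cases4)
    obtain S' u' z' h' where be: "b = (S', u', z', h')" by (metis prod_cases4)
    note A1 = A[OF a[unfolded ae]] and A2 = A[OF b[unfolded be]]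
    have uu: "u' = u" and g: "glue S (inv_into S z) h = glue S' (inv_into S' z') h'"
      using eq by (simp_all add: ae be)
    have "orbit (glue S (inv_into S z) h) u = S" by (rule orbit_glue) (use A1 in blast)+
    moreover have "orbit (glue S' (inv_into S' z') h') u' = S'" by (rule orbit_glue) (use A2 in blast)+
    ultimately have SS: "S' = S" using uu g by simp
    have inveq: "inv_into S z x = inv_into S z' x" if "x \<in> S" for x
      using fun_cong[OF g, of x] that SS by (simp add: glue_def)
    have "z x = z' x" for x
    proof (cases "x \<in> S")
      case True
      have zx: "z x \<in> S" using A1 True cyclic_on_inI by metis
      have z'x: "z' x \<in> S" using A2 True SS cyclic_on_inI by metis
      have "inv_into S z (z x) = x" using A1 True by blast
      moreover have "inv_into S z (z' x) = x" using A2 True SS inveq[OF z'x] by auto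
      moreover have "inj_on (inv_into S z) S" using A1 cyclic_on_inj_on by blast
      ultimately show ?thesis using zx z'x by (simp add: inj_on_def)
    next
      case False
      then show ?thesis using A1 A2 SS maps_fix by metis
    qed
    moreover have "h x = h' x" for x
    proof (cases "x \<in> S")
      case True
      then have "x \<notin> W - S" by blast
      then show ?thesis using A1 A2 SS maps_fix good_maps by metis
    next
      case False then show ?thesis using fun_cong[OF g, of x] SS by (simp add: glue_def)
    qed
    ultimately show "a = b" using uu SS by (simp add: ae be fun_eq_iff)
  qed
  moreover have "?p ` ?A \<subseteq> {..<n} \<times> good W"
  proof
    fix q assume "q \<in> ?p ` ?A"
    then obtain S u z h where t: "(S, u, z, h) \<in> ?A" "q = (u, glue S (inv_into S z) h)" by auto
    then show "q \<in> {..<n} \<times> good W" using A[OF t(1)] W by blast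
  qed
  moreover have "finite ({..<n} \<times> good W)" using finite_good[OF W] by blast
  ultimately have "card ?A \<le> card ({..<n} \<times> good W)" by (rule card_inj_on_le)
  then show ?thesis by (simp add: card_cartesian_product)
qed

text \<open>Keeping only the arc from \<open>z u\<close> to \<open>u\<close> of the 2-cycle makes \<open>u\<close> an inactive root.\<close>

lemma card_two_cycles:
  assumes W: "W \<subseteq> {..<n}"
  shows "card {(S, u, z, h) \<in> (SIGMA S:Pow W. S \<times> bad_cycles S \<times> good (W - S)). z (z u) = u}
    \<le> n * (\<Sum>u\<in>W. card (good (W - {u})))" (is "card ?A \<le> _")
proof -
  let ?p = "\<lambda>(S, u, z, h). (u, z u, h(z u := u))"
  let ?B = "SIGMA u:W. {..<n} \<times> good (W - {u})"
  have A: "S \<subseteq> W \<and> u \<in> S \<and> z \<in> maps S \<and> h \<in> good (W - S) \<and> z (z u) = u \<and> S = {u, z u} \<and>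
      z u < n \<and> h(z u := u) \<in> good (W - {u})"
    if t: "(S, u, z, h) \<in> ?A" for S u z h
  proof -
    have S: "S \<subseteq> W" "u \<in> S" and z: "z \<in> maps S" "cyclic_on z S"
      and h: "h \<in> good (W - S)" and zu: "z (z u) = u" using t by (auto simp: bad_cycles_def)
    have Su: "S = {u, z u}" by (rule two_cycle_eq[OF z(2) S(2) zu])
    have e: "{u, z u} \<in> E" by (rule maps_edge[OF z(1) S(2)])
    have "h(z u := u) \<in> good (insert (z u) (W - S))"
      by (rule good_attach[OF h]) (use Su e in \<open>auto simp: insert_commute\<close>)
    moreover have "insert (z u) (W - S) = W - {u}" using Su S(1) edgeD(3)[OF e] by auto
    ultimately show ?thesis using S z h zu Su edgeD(2)[OF e] by simp
  qed
  \<comment> \<open>\<open>u\<close> and \<open>z u\<close> determine the 2-cycle, and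
    \<open>h\<close> fixes both, so nothing is lost in overwriting \<open>h\<close> at
    \<open>z u\<close>.\<close>
  have "inj_on ?p ?A"
  proof (rule inj_onI)
    fix a b assume a: "a \<in> ?A" and b: "b \<in> ?A" and eq: "?p a = ?p b"
    obtain S u z h where ae: "a = (S, u, z, h)" by (metis prod_cases4)
    obtain S' u' z' h' where be: "b = (S', u', z', h')" by (metis prod_cases4)
    note A1 = A[OF a[unfolded ae]] and A2 = A[OF b[unfolded be]]
    have uu: "u' = u" and zz: "z' u = z u" and hh: "h(z u := u) = h'(z u := u)"
      using eq by (auto simp: ae be)
    have SS: "S' = S" using A1 A2 uu zz by metis
    have "z x = z' x" for x
    proof (cases "x \<in> S")
      case True
      then show ?thesis using A1 A2 uu zz by (metis insertE singletonD)
    next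
      case False
      then show ?thesis using A1 A2 SS maps_fix by metis
    qed
    moreover have "h x = h' x" for x
    proof (cases "x \<in> S")
      case True
      then have "x \<notin> W - S" by blast
      then show ?thesis using A1 A2 SS maps_fix good_maps by metis
    next
      case False
      then have "x \<noteq> z u" using A1 by blast
      then show ?thesis using fun_cong[OF hh, of x] by simp
    qed
    ultimately show "a = b" using uu SS by (simp add: ae be fun_eq_iff)
  qed
  moreover have "?p ` ?A \<subseteq> ?B"
  proof
    fix q assume "q \<in> ?p ` ?A"
    then obtain S u z h where t: "(S, u, z, h) \<in> ?A" "q = (u, z u, h(z u := u))" by auto
    then show "q \<in> ?B" using A[OF t(1)] by auto
  qed
  moreover have finB: "finite W" "\<And>u. u \<in> W \<Longrightarrow> finite ({..<n} \<times> good (W - {u}))"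
  proof -
    show "finite W" using W by (meson finite_lessThan finite_subset)
    show "finite ({..<n} \<times> good (W - {u}))" for u using finite_good[of "W - {u}"] W by blast
  qed
  ultimately have "card ?A \<le> card ?B" by (intro card_inj_on_le) auto
  also have "card ?B = (\<Sum>u\<in>W. card ({..<n} \<times> good (W - {u})))"
    by (rule card_SigmaI) (use finB in auto)
  finally show ?thesis by (simp add: card_cartesian_product sum_distrib_left)
qed

end

context connected_graph_on
begin

lemma card_good_remove_le:
  assumes "W \<subseteq> {..<n}" "u \<in> W"
  shows "card (good (W - {u})) \<le> n * card (good W)"
  using card_good_le[of "W - {u}" u] assms by (auto simp: insert_absorb)

text \<open>The factor \<open>card S\<close> is absorbed by marking a vertex of \<open>S\<close>.
  Relative to \<open>card (good W)\<close>, the term \<open>card W\<close> and the long cycles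
  contribute at most \<open>n\<close> each, the 2-cycles and the loops at most \<open>n ^ 3\<close>
  each.\<close>

lemma popping_total_le:
  assumes W: "W \<subseteq> {..<n}"
  shows "popping_total bad_weight (\<lambda>U. real (card (good U))) W \<le> real (4 * n ^ 3) * real (card (good W))"
proof -
  let ?G = "\<lambda>U. real (card (good U))"
  let ?T = "SIGMA S:Pow W. S \<times> bad_cycles S \<times> good (W - S)"
  have finW: "finite W" using W by (meson finite_lessThan finite_subset)
  have cW: "card W \<le> n" using card_mono[OF _ W] by simp
  have sumW: "(\<Sum>u\<in>W. card (good (W - {u}))) \<le> n * (n * card (good W))"
  proof -
    have "(\<Sum>u\<in>W. card (good (W - {u}))) \<le> card W * (n * card (good W))"
      using sum_bounded_above[of W "\<lambda>u. card (good (W - {u}))"] card_good_remove_le[OF W] by simp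
    also have "\<dots> \<le> n * (n * card (good W))" using cW by (rule mult_right_mono) simp
    finally show ?thesis .
  qed
  have T: "card ?T \<le> n * card (good W) + n * (n * (n * card (good W)))"
  proof -
    let ?A = "{(S, u, z, h) \<in> ?T. z (z u) \<noteq> u}" and ?B = "{(S, u, z, h) \<in> ?T. z (z u) = u}"
    have "?T = ?A \<union> ?B" by auto
    then have "card ?T \<le> card ?A + card ?B" by (metis (no_types, lifting) card_Un_le)
    also have "card ?A \<le> n * card (good W)" by (rule card_long_bad_cycles[OF W])
    also have "card ?B \<le> n * (\<Sum>u\<in>W. card (good (W - {u})))" by (rule card_two_cycles[OF W])
    finally show ?thesis using mult_left_mono[OF sumW, of n] by linarith
  qed
  have "card ?T = (\<Sum>S\<in>Pow W. card S * (card (bad_cycles S) * card (good (W - S))))"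
  proof (subst card_SigmaI)
    show "\<forall>S\<in>Pow W. finite (S \<times> bad_cycles S \<times> good (W - S))"
    proof
      fix S assume "S \<in> Pow W"
      then have "S \<subseteq> {..<n}" "W - S \<subseteq> {..<n}" using W by auto
      then show "finite (S \<times> bad_cycles S \<times> good (W - S))"
        using finite_bad_cycles finite_good by (meson finite_SigmaI finite_lessThan finite_subset)
    qed
  qed (use finW in \<open>auto simp: card_cartesian_product\<close>)
  then have 1: "(\<Sum>S\<in>Pow W. real (card S) * (real (card (bad_cycles S)) * ?G (W - S)))
      \<le> real (n * card (good W) + n * (n * (n * card (good W))))"
    using T by (metis (no_types, lifting) of_nat_mono of_nat_mult of_nat_sum sum.cong)
  have 2: "(\<Sum>S\<in>Pow W. real (card S) * ((if is_singleton S then real (n - deg (the_elem S)) else 0) * ?G (W - S)))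
      \<le> real (n * (n * (n * card (good W))))"
  proof -
    have "(\<Sum>S\<in>Pow W. real (card S) * ((if is_singleton S then real (n - deg (the_elem S)) else 0) * ?G (W - S)))
      = (\<Sum>S\<in>(\<lambda>u. {u}) ` W. real (card S) * ((if is_singleton S then real (n - deg (the_elem S)) else 0) * ?G (W - S)))"
      by (rule sum.mono_neutral_right) (use finW in \<open>auto simp: is_singleton_def\<close>)
    also have "\<dots> = (\<Sum>u\<in>W. real (n - deg u) * ?G (W - {u}))"
      by (subst sum.reindex) (auto simp: inj_on_def)
    also have "\<dots> \<le> (\<Sum>u\<in>W. real n * ?G (W - {u}))"
      by (intro sum_mono mult_right_mono) auto
    also have "\<dots> = real (n * (\<Sum>u\<in>W. card (good (W - {u}))))"
      by (simp add: sum_distrib_left)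
    also have "\<dots> \<le> real (n * (n * (n * card (good W))))"
      using mult_left_mono[OF sumW, of n] by (simp only: of_nat_le_iff)
    finally show ?thesis .
  qed
  have "popping_total bad_weight ?G W = real (card W) * ?G W
      + ((\<Sum>S\<in>Pow W. real (card S) * (real (card (bad_cycles S)) * ?G (W - S)))
      + (\<Sum>S\<in>Pow W. real (card S) * ((if is_singleton S then real (n - deg (the_elem S)) else 0) * ?G (W - S))))"
    unfolding popping_total_def bad_weight_def sum.distrib[symmetric] by (simp add: algebra_simps)
  also have "\<dots> \<le> real (n * card (good W)) + (real (n * card (good W) + n * (n * (n * card (good W))))
      + real (n * (n * (n * card (good W)))))"
  proof (intro add_mono 1 2)
    have "real (card W * card (good W)) \<le> real (n * card (good W))"
      unfolding of_nat_le_iff by (rule mult_right_mono[OF cW]) simp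
    then show "real (card W) * ?G W \<le> real (n * card (good W))" by simp
  qed
  also have "\<dots> = real (n * card (good W) + n * card (good W) + 2 * (n * (n * (n * card (good W)))))"
    by simp
  also have "\<dots> \<le> real (4 * n ^ 3 * card (good W))"
  proof -
    have "n * card (good W) \<le> n ^ 3 * card (good W)"
      using n_pos by (intro mult_right_mono) (auto intro: self_le_power)
    then show ?thesis unfolding of_nat_le_iff by (simp add: power3_eq_cube algebra_simps)
  qed
  finally show ?thesis by simp
qed

lemma draws_recurrence:
  assumes W: "W \<subseteq> {..<n}" and v: "v < n" "v \<notin> W"
  shows "real n * real (card (good W)) = real (card (good (insert v W)))
    + (\<Sum>S | v \<in> S \<and> S \<subseteq> insert v W. bad_weight S * real (card (good (W - S))))"
  using sum_draw_step[OF W v, of "\<lambda>_. 1"] by (simp add: mult.commute)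

definition mean_draws :: "nat set \<Rightarrow> real" where
  "mean_draws W = popping_total bad_weight (\<lambda>U. real (card (good U))) W / real (card (good W))"

lemma mean_draws_le: "W \<subseteq> {..<n} \<Longrightarrow> mean_draws W \<le> real (4 * n ^ 3)"
  using popping_total_le[of W] card_good_pos[of W] by (simp add: mean_draws_def divide_le_eq)

lemma mean_draws_empty: "mean_draws {} = 0" by (simp add: mean_draws_def popping_total_def)

lemma mean_draws_step:
  assumes W: "W \<subseteq> {..<n}" and v: "v < n" "v \<notin> W"
  shows "real (card (good (insert v W))) * mean_draws (insert v W)
    + (\<Sum>S | v \<in> S \<and> S \<subseteq> insert v W. bad_weight S * (real (card (good (W - S))) * mean_draws (W - S)))
    = real n * (real (card (good W)) * (mean_draws W + 1))"
proof -
  let ?K = "popping_total bad_weight (\<lambda>U. real (card (good U)))"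
  have K: "real (card (good U)) * mean_draws U = ?K U" if "U \<subseteq> {..<n}" for U
    using card_good_pos[OF that] by (simp add: mean_draws_def)
  have "finite W" using W by (meson finite_lessThan finite_subset)
  have "?K (insert v W) + (\<Sum>S | v \<in> S \<and> S \<subseteq> insert v W. bad_weight S * ?K (W - S))
    = real n * (?K W + real (card (good W)))"
  proof (rule popping_total_step[OF \<open>finite W\<close> v(2)])
    fix U assume "U \<subseteq> W"
    then show "real n * real (card (good U)) = real (card (good (insert v U)))
      + (\<Sum>S | v \<in> S \<and> S \<subseteq> insert v U. bad_weight S * real (card (good (U - S))))"
      using W v by (intro draws_recurrence) auto
  qed
  moreover have "(\<Sum>S | v \<in> S \<and> S \<subseteq> insert v W. bad_weight S * (real (card (good (W - S))) * mean_draws (W - S)))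
    = (\<Sum>S | v \<in> S \<and> S \<subseteq> insert v W. bad_weight S * ?K (W - S))"
  proof (rule sum.cong[OF refl])
    fix S assume "S \<in> {S. v \<in> S \<and> S \<subseteq> insert v W}"
    have "W - S \<subseteq> {..<n}" using W by auto
    then show "bad_weight S * (real (card (good (W - S))) * mean_draws (W - S)) = bad_weight S * ?K (W - S)"
      by (simp only: K)
  qed
  moreover have "insert v W \<subseteq> {..<n}" using W v by auto
  ultimately show ?thesis using K W by (simp only: K distrib_left mult_1_right)
qed

end

section \<open>The Markov chain and its potentials\<close>

type_synonym chain_state = "(nat \<Rightarrow> nat) \<times> nat \<times> nat \<times> (nat \<Rightarrow> nat)"

text \<open>\<open>(p * t + R) / s\<close> is the mean final value of \<open>p / s\<close> times the
  total count, after \<open>t\<close> draws and with \<open>R\<close> geometric variables of mean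
  \<open>1 / p\<close> pending. A draw completes one of them with probability \<open>p\<close>; the
  lemma is the martingale property.\<close>

lemma geometric_first_moment:
  fixes p :: real
  shows "p * ((p * (t + 1) + (R - 1)) / s) + (1 - p) * ((p * (t + 1) + R) / s) = (p * t + R) / s"
  by (simp add: add_divide_distrib[symmetric] algebra_simps)

text \<open>The same for the second moment: \<open>p\<close> times a geometric variable has variance
  \<open>1 - p\<close>, whence the extra term for each pending variable.\<close>

lemma geometric_second_moment:
  fixes p :: real
  shows "p * (((p * (t + 1) + (R - 1)) / s)\<^sup>2 + (R - 1) * (1 - p) / s\<^sup>2)
    + (1 - p) * (((p * (t + 1) + R) / s)\<^sup>2 + R * (1 - p) / s\<^sup>2) = ((p * t + R) / s)\<^sup>2 + R * (1 - p) / s\<^sup>2"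
proof -
  have "p * ((p * (t + 1) + (R - 1))\<^sup>2 + (R - 1) * (1 - p)) + (1 - p) * ((p * (t + 1) + R)\<^sup>2 + R * (1 - p))
    = (p * t + R)\<^sup>2 + R * (1 - p)" by (simp add: power2_eq_square algebra_simps)
  then show ?thesis by (simp only: power_divide add_divide_distrib[symmetric] times_divide_eq_right)
qed

context finite_graph
begin

text \<open>In the state \<open>(f, h, r, tot)\<close>, \<open>r\<close> runs are left (including the current one), the current run has seen
  the active set \<open>{..<h}\<close> but not yet \<open>{..<Suc h}\<close>, and \<open>tot i\<close> counts, over all runs, the draws made for \<open>i\<close> at
  the active set \<open>{..<i}\<close> up to the first acceptance.\<close>

definition trial :: "nat \<Rightarrow> chain_state \<Rightarrow> chain_state" where
  "trial x = (\<lambda>(f, h, r, tot).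
     if r = 0 then (f, h, r, tot)
     else let v = (LEAST v. f v = v) in
       if n \<le> v then (id, 0, r - 1, tot)
       else let g = draw_step v x f in
         (g, if v = h \<and> g v \<noteq> v then Suc h else h, r, if v = h then tot(v := Suc (tot v)) else tot))"

primrec chain :: "nat \<Rightarrow> chain_state \<Rightarrow> chain_state pmf" where
  "chain 0 a = return_pmf a"
| "chain (Suc j) a = bind_pmf (pmf_of_set {..<n}) (\<lambda>x. chain j (trial x a))"

text \<open>This is \<open>card (good W)\<close> times the probability from a uniform start on
  \<open>good W\<close>; without the division the recurrences have no quotients of counts.\<close>

definition prob_sum :: "chain_state set \<Rightarrow> nat \<Rightarrow> nat set \<Rightarrow> nat \<Rightarrow> nat \<Rightarrow> (nat \<Rightarrow> nat) \<Rightarrow> real" where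
  "prob_sum X j W h r tot = (\<Sum>f\<in>good W. measure_pmf.prob (chain j (f, h, r, tot)) X)"

lemma first_idle:
  assumes "f \<in> maps W" shows "(LEAST v. f v = v) = (LEAST v. v \<notin> W)"
  using maps_eq_iff[OF assms] by simp

end

context connected_graph_on
begin

lemma prob_chain_Suc:
  "measure_pmf.prob (chain (Suc j) a) X = (\<Sum>x<n. measure_pmf.prob (chain j (trial x a)) X) / n"
proof -
  have ne: "{..<n} \<noteq> {}" using n_pos by auto
  have "ennreal (measure_pmf.prob (chain (Suc j) a) X)
      = (\<integral>\<^sup>+x. ennreal (measure_pmf.prob (chain j (trial x a)) X) \<partial>pmf_of_set {..<n})"
    by (simp add: measure_pmf.emeasure_eq_measure[symmetric])
  also have "\<dots> = (\<Sum>x<n. ennreal (measure_pmf.prob (chain j (trial x a)) X)) / ennreal n"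
    by (subst nn_integral_pmf_of_set) (use ne in \<open>auto simp: ennreal_of_nat_eq_real_of_nat\<close>)
  also have "\<dots> = ennreal ((\<Sum>x<n. measure_pmf.prob (chain j (trial x a)) X) / n)"
    using n_pos by (simp add: divide_ennreal sum_nonneg)
  finally show ?thesis by (subst (asm) ennreal_inj) (auto intro!: divide_nonneg_nonneg sum_nonneg)
qed

lemma prob_chain_idle: "measure_pmf.prob (chain j (f, h, 0, tot)) X = indicator X (f, h, 0, tot)"
proof (induction j)
  case (Suc j)
  then show ?case unfolding prob_chain_Suc using n_pos by (simp add: trial_def)
qed simp

lemma prob_sum_idle: "W \<subseteq> {..<n} \<Longrightarrow> prob_sum X j W h 0 tot = (\<Sum>f\<in>good W. indicator X (f, h, 0, tot))"
  by (simp add: prob_sum_def prob_chain_idle)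

lemma prob_sum_le: "prob_sum X j W h r tot \<le> card (good W)"
  unfolding prob_sum_def using sum_bounded_above[of "good W" "\<lambda>f. measure_pmf.prob (chain j (f, h, r, tot)) X" 1]
  by simp

lemma prob_sum_full:
  assumes "0 < r"
  shows "prob_sum X (Suc j) {..<n} h r tot = card (good {..<n}) * prob_sum X j {} 0 (r - 1) tot"
proof -
  have "measure_pmf.prob (chain (Suc j) (f, h, r, tot)) X = measure_pmf.prob (chain j (id, 0, r - 1, tot)) X"
    if f: "f \<in> good {..<n}" for f
  proof -
    have "(LEAST v. f v = v) = (LEAST v. v \<notin> {..<n})" by (rule first_idle[OF good_maps[OF f]])
    also have "\<dots> = n" by (rule Least_equality) auto
    finally have "trial x (f, h, r, tot) = (id, 0, r - 1, tot)" for x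
      using assms by (simp add: trial_def)
    then show ?thesis unfolding prob_chain_Suc using n_pos by simp
  qed
  then show ?thesis by (simp add: prob_sum_def good_empty)
qed

text \<open>The values of \<open>h\<close> and \<open>tot\<close> after a draw depend only on
  whether it is accepted, so \<open>sum_draw_step\<close> applies with \<open>F\<close> the
  probability of reaching \<open>X\<close> in the remaining steps.\<close>

lemma prob_sum_Suc:
  fixes h r :: nat and tot :: "nat \<Rightarrow> nat"
  assumes W: "W \<subseteq> {..<n}" "W \<noteq> {..<n}" and r: "0 < r"
  defines "v \<equiv> (LEAST v. v \<notin> W)"
  defines "tot' \<equiv> (if v = h then tot(v := Suc (tot v)) else tot)"
  shows "real n * prob_sum X (Suc j) W h r tot =
      prob_sum X j (insert v W) (if v = h then Suc h else h) r tot'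
      + (\<Sum>S | v \<in> S \<and> S \<subseteq> insert v W. bad_weight S * prob_sum X j (W - S) h r tot')"
    "v < n" "v \<notin> W" "{..<v} \<subseteq> W"
proof -
  obtain u where u: "u < n" "u \<notin> W" using W by blast
  show vW: "v \<notin> W" unfolding v_def by (rule LeastI[of "\<lambda>v. v \<notin> W", OF u(2)])
  show vn: "v < n" using Least_le[of "\<lambda>v. v \<notin> W", OF u(2)] u(1) by (simp add: v_def)
  show "{..<v} \<subseteq> W"
  proof
    fix u assume "u \<in> {..<v}"
    then show "u \<in> W" using not_less_Least[of u "\<lambda>v. v \<notin> W"] by (simp add: v_def)
  qed
  define F where "F = (\<lambda>g. measure_pmf.prob (chain j (g, if v = h \<and> g v \<noteq> v then Suc h else h, r, tot')) X)"
  have "real n * measure_pmf.prob (chain (Suc j) (f, h, r, tot)) X = (\<Sum>x<n. F (draw_step v x f))"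
    if f: "f \<in> good W" for f
  proof -
    have "(LEAST v. f v = v) = v" unfolding v_def by (rule first_idle[OF good_maps[OF f]])
    then have "trial x (f, h, r, tot) = (draw_step v x f,
        if v = h \<and> draw_step v x f v \<noteq> v then Suc h else h, r, tot')" for x
      using r vn by (simp add: trial_def tot'_def Let_def)
    then show ?thesis unfolding prob_chain_Suc F_def using n_pos by simp
  qed
  then have "real n * prob_sum X (Suc j) W h r tot = (\<Sum>f\<in>good W. \<Sum>x<n. F (draw_step v x f))"
    by (simp add: prob_sum_def sum_distrib_left)
  also have "\<dots> = (\<Sum>g\<in>good (insert v W). F g)
    + (\<Sum>S | v \<in> S \<and> S \<subseteq> insert v W. bad_weight S * (\<Sum>g\<in>good (W - S). F g))"
    by (rule sum_draw_step[OF W(1) vn vW])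
  also have "(\<Sum>g\<in>good (insert v W). F g) = prob_sum X j (insert v W) (if v = h then Suc h else h) r tot'"
    unfolding prob_sum_def F_def by (rule sum.cong[OF refl]) (use maps_eq_iff[OF good_maps] in auto)
  also have "(\<Sum>S | v \<in> S \<and> S \<subseteq> insert v W. bad_weight S * (\<Sum>g\<in>good (W - S). F g))
     = (\<Sum>S | v \<in> S \<and> S \<subseteq> insert v W. bad_weight S * prob_sum X j (W - S) h r tot')"
  proof (rule sum.cong[OF refl])
    fix S
    have "g v = v" if g: "g \<in> good (W - S)" for g
      using maps_fix[OF good_maps[OF g], of v] vW by blast
    then have "(\<Sum>g\<in>good (W - S). F g) = prob_sum X j (W - S) h r tot'"
      unfolding prob_sum_def F_def by (intro sum.cong) auto
    then show "bad_weight S * (\<Sum>g\<in>good (W - S). F g) = bad_weight S * prob_sum X j (W - S) h r tot'"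
      by simp
  qed
  finally show "real n * prob_sum X (Suc j) W h r tot =
      prob_sum X j (insert v W) (if v = h then Suc h else h) r tot'
      + (\<Sum>S | v \<in> S \<and> S \<subseteq> insert v W. bad_weight S * prob_sum X j (W - S) h r tot')" .
qed

section \<open>Finishing all runs within the budget\<close>

lemma bad_weight_nonneg: "0 \<le> bad_weight S" by (simp add: bad_weight_def)

text \<open>A bound for the expected number of remaining steps: each run is charged
  \<open>4 * n ^ 3\<close> draws and one step for the restart, less the \<open>mean_draws W\<close>
  credited to the current run. A draw lowers it by 1 on average, a restart by at least 1.\<close>

definition remaining_draws :: "nat set \<Rightarrow> nat \<Rightarrow> real" where
  "remaining_draws W r = (if r = 0 then 0 else real r * real (4 * n ^ 3 + 1) - mean_draws W)"

lemma remaining_draws_full: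
  assumes "0 < r" shows "remaining_draws {} (r - 1) + 1 \<le> remaining_draws {..<n} r"
proof -
  have "remaining_draws {} (r - 1) = (real r - 1) * real (4 * n ^ 3 + 1)"
    using assms by (cases "r = 1") (auto simp: remaining_draws_def mean_draws_empty of_nat_diff)
  moreover have "mean_draws {..<n} \<le> real (4 * n ^ 3)" by (rule mean_draws_le) simp
  ultimately show ?thesis using assms by (simp add: remaining_draws_def algebra_simps)
qed

lemma remaining_draws_ge_1:
  assumes "0 < r" "W \<subseteq> {..<n}" shows "1 \<le> remaining_draws W r"
proof -
  have "real (4 * n ^ 3 + 1) \<le> real r * real (4 * n ^ 3 + 1)"
    using mult_right_mono[of 1 "real r" "real (4 * n ^ 3 + 1)"] assms(1) by simp
  then show ?thesis using mean_draws_le[OF assms(2)] assms(1) by (simp add: remaining_draws_def)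
qed

text \<open>Markov's inequality for the number of steps, in a form that is inductive in
  \<open>j\<close>. While \<open>j\<close> is at most the potential, the bound is trivial because
  probabilities are at most 1.\<close>

lemma unfinished_prob_sum:
  assumes "W \<subseteq> {..<n}"
  shows "real j * prob_sum {a. fst (snd (snd a)) \<noteq> 0} j W h r tot \<le> card (good W) * remaining_draws W r"
  using assms
proof (induction j arbitrary: W h r tot)
  case 0
  then show ?case using remaining_draws_ge_1[of r W]
    by (cases "r = 0") (auto simp: remaining_draws_def)
next
  case (Suc j)
  let ?X = "{a. fst (snd (snd a)) \<noteq> 0} :: chain_state set"
  show ?case
  proof (cases "r = 0")
    case True
    then show ?thesis using prob_sum_idle[OF Suc.prems, of ?X] by (simp add: remaining_draws_def)
  next
    case r: False
    have ge1: "1 \<le> remaining_draws W r" using remaining_draws_ge_1 r Suc.prems by auto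
    show ?thesis
    proof (cases "real (Suc j) \<le> remaining_draws W r")
      case True
      have "real (Suc j) * prob_sum ?X (Suc j) W h r tot \<le> remaining_draws W r * card (good W)"
        using True by (intro mult_mono prob_sum_le) (auto simp: prob_sum_def sum_nonneg)
      then show ?thesis by (simp add: mult.commute)
    next
      case False
      then have lt: "remaining_draws W r < real (Suc j)" by simp
      have main: "real j * prob_sum ?X (Suc j) W h r tot \<le> card (good W) * (remaining_draws W r - 1)"
      proof (cases "W = {..<n}")
        case True
        have "real j * prob_sum ?X (Suc j) {..<n} h r tot = card (good {..<n}) * (real j * prob_sum ?X j {} 0 (r - 1) tot)"
          using prob_sum_full[of r ?X j h tot] r by simp
        also have "\<dots> \<le> card (good {..<n}) * remaining_draws {} (r - 1)"
          using Suc.IH[of "{}" 0 "r - 1" tot] by (intro mult_left_mono) (auto simp: good_empty)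
        also have "\<dots> \<le> card (good {..<n}) * (remaining_draws {..<n} r - 1)"
          using remaining_draws_full[of r] r by (intro mult_left_mono) auto
        finally show ?thesis using True by simp
      next
        case neq: False
        define v where "v = (LEAST v. v \<notin> W)"
        define tot' where "tot' = (if v = h then tot(v := Suc (tot v)) else tot)"
        define h' where "h' = (if v = h then Suc h else h)"
        let ?Sv = "{S. v \<in> S \<and> S \<subseteq> insert v W}"
        have r0: "0 < r" using r by simp
      note step = prob_sum_Suc(1)[OF Suc.prems neq r0, where X = ?X and j = j and h = h and tot = tot,
            folded v_def, folded tot'_def h'_def]
          prob_sum_Suc(2-4)[OF Suc.prems neq r0, folded v_def]
        have v: "v < n" "v \<notin> W" using step(2,3) r by auto
        have Wv: "insert v W \<subseteq> {..<n}" using v Suc.prems by auto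
        have "real n * (real j * prob_sum ?X (Suc j) W h r tot)
          = real j * prob_sum ?X j (insert v W) h' r tot' + (\<Sum>S\<in>?Sv. bad_weight S * (real j * prob_sum ?X j (W - S) h r tot'))"
          using step(1) r by (simp add: algebra_simps sum_distrib_left)
        also have "\<dots> \<le> card (good (insert v W)) * remaining_draws (insert v W) r
           + (\<Sum>S\<in>?Sv. bad_weight S * (card (good (W - S)) * remaining_draws (W - S) r))"
          using Suc.prems
          by (intro add_mono sum_mono mult_left_mono Suc.IH Wv bad_weight_nonneg) auto
        also have "\<dots> = real r * real (4 * n ^ 3 + 1) * (real (card (good (insert v W)))
             + (\<Sum>S\<in>?Sv. bad_weight S * real (card (good (W - S)))))
           - (real (card (good (insert v W))) * mean_draws (insert v W)
             + (\<Sum>S\<in>?Sv. bad_weight S * (real (card (good (W - S))) * mean_draws (W - S))))"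
          using r unfolding remaining_draws_def
          by (simp add: algebra_simps sum_subtractf sum_distrib_left sum_distrib_right sum.distrib)
        also have "\<dots> = real n * (card (good W) * (remaining_draws W r - 1))"
          unfolding draws_recurrence[OF Suc.prems v, symmetric] mean_draws_step[OF Suc.prems v]
          using r by (simp add: remaining_draws_def algebra_simps)
        finally show ?thesis using n_pos by simp
      qed
      have "real (Suc j) * prob_sum ?X (Suc j) W h r tot \<le> card (good W) * remaining_draws W r"
      proof (cases "j = 0")
        case True
        then show ?thesis using lt ge1 by simp
      next
        case False
        have "real j * (real (Suc j) * prob_sum ?X (Suc j) W h r tot)
            = real (Suc j) * (real j * prob_sum ?X (Suc j) W h r tot)" by simp
        also have "\<dots> \<le> real (Suc j) * (card (good W) * (remaining_draws W r - 1))"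
          by (rule mult_left_mono[OF main]) simp
        also have "\<dots> = card (good W) * (real (Suc j) * (remaining_draws W r - 1))" by simp
        \<comment> \<open>This amounts to \<open>remaining_draws W r \<le> Suc j\<close>, the case
          at hand.\<close>
        also have "\<dots> \<le> card (good W) * (real j * remaining_draws W r)"
          using lt by (intro mult_left_mono) (auto simp: algebra_simps)
        finally have "real j * (real (Suc j) * prob_sum ?X (Suc j) W h r tot) \<le> real j * (card (good W) * remaining_draws W r)"
          by (simp add: algebra_simps)
        then show ?thesis using False by simp
      qed
      then show ?thesis .
    qed
  qed
qed

section \<open>The mean square error of the estimate\<close>

definition accept_prob :: "nat \<Rightarrow> real" where
  "accept_prob i = card (good {..<Suc i}) / (n * card (good {..<i}))"

text \<open>The number of geometric variables of index \<open>i\<close> that still have to be completed.\<close>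

definition pending :: "nat \<Rightarrow> nat \<Rightarrow> nat \<Rightarrow> real" where
  "pending h r i = real r - (if i < h then 1 else 0)"

definition first_moment :: "nat \<Rightarrow> nat \<Rightarrow> nat \<Rightarrow> (nat \<Rightarrow> nat) \<Rightarrow> nat \<Rightarrow> real" where
  "first_moment s h r tot i = (accept_prob i * real (tot i) + pending h r i) / real s"

definition second_moment :: "nat \<Rightarrow> nat \<Rightarrow> nat \<Rightarrow> (nat \<Rightarrow> nat) \<Rightarrow> nat \<Rightarrow> real" where
  "second_moment s h r tot i = (first_moment s h r tot i)\<^sup>2 + pending h r i * (1 - accept_prob i) / (real s)\<^sup>2"

text \<open>The conditional expectation, given the state, of the square of \<open>(\<Prod>i<n. accept_prob i * tot i / s) - 1\<close>
  for the final values of \<open>tot\<close>.\<close>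

definition sq_error :: "nat \<Rightarrow> nat \<Rightarrow> nat \<Rightarrow> (nat \<Rightarrow> nat) \<Rightarrow> real" where
  "sq_error s h r tot = (\<Prod>i<n. second_moment s h r tot i) - 2 * (\<Prod>i<n. first_moment s h r tot i) + 1"

lemma card_good_prefix_pos: "i \<le> n \<Longrightarrow> 0 < card (good {..<i})"
  by (rule card_good_pos) auto

lemma accept_prob_bounds:
  assumes "i < n" shows "0 < accept_prob i" "accept_prob i \<le> 1"
proof -
  show "0 < accept_prob i"
    using card_good_prefix_pos[of i] card_good_prefix_pos[of "Suc i"] n_pos assms
    by (simp add: accept_prob_def)
  have "0 \<le> (\<Sum>S | i \<in> S \<and> S \<subseteq> insert i {..<i}. bad_weight S * real (card (good ({..<i} - S))))"
    by (intro sum_nonneg mult_nonneg_nonneg bad_weight_nonneg) auto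
  then have "real (card (good {..<Suc i})) \<le> real n * real (card (good {..<i}))"
    using draws_recurrence[of "{..<i}" i] assms by (simp add: lessThan_Suc)
  then show "accept_prob i \<le> 1"
    using card_good_prefix_pos[of i] n_pos assms by (simp add: accept_prob_def divide_le_eq)
qed

text \<open>Each second moment exceeds the squared first moment by a variance; the hypothesis keeps
  \<open>pending\<close>, and with it this variance, nonnegative.\<close>

lemma sq_error_ge:
  assumes "0 < r \<or> h = 0"
  shows "((\<Prod>i<n. first_moment s h r tot i) - 1)\<^sup>2 \<le> sq_error s h r tot"
proof -
  have "(\<Prod>i<n. (first_moment s h r tot i)\<^sup>2) \<le> (\<Prod>i<n. second_moment s h r tot i)"
  proof (intro prod_mono conjI)
    fix i assume "i \<in> {..<n}"
    then have "0 \<le> pending h r i * (1 - accept_prob i) / (real s)\<^sup>2"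
      using accept_prob_bounds[of i] assms by (intro divide_nonneg_nonneg mult_nonneg_nonneg) (auto simp: pending_def)
    then show "(first_moment s h r tot i)\<^sup>2 \<le> second_moment s h r tot i" by (simp add: second_moment_def)
  qed simp
  then show ?thesis by (simp add: sq_error_def power2_diff prod_power_distrib[symmetric])
qed

text \<open>The draw changes only the factor \<open>h\<close> of each product, and the error is
  affine in these two factors, so the two geometric lemmas give the martingale property.\<close>

lemma sq_error_draw:
  assumes "h < n"
  shows "accept_prob h * sq_error s (Suc h) r (tot(h := Suc (tot h)))
     + (1 - accept_prob h) * sq_error s h r (tot(h := Suc (tot h)))
     = sq_error s h r tot"
proof -
  let ?p = "accept_prob h" and ?I = "{..<n} - {h}" and ?t = "tot(h := Suc (tot h))"
  have split: "(\<Prod>i<n. q i) = q h * (\<Prod>i\<in>?I. q i)" for q :: "nat \<Rightarrow> real"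
    using assms by (simp add: prod.remove[of "{..<n}" h])
  have pend: "pending (Suc h) r i = pending h r i" if "i \<noteq> h" for i
    using that by (auto simp: pending_def)
  have pend_h: "pending (Suc h) r h = pending h r h - 1" by (simp add: pending_def)
  have F: "first_moment s (Suc h) r ?t i = first_moment s h r tot i"
    "first_moment s h r ?t i = first_moment s h r tot i" if "i \<noteq> h" for i
    using that by (simp_all add: first_moment_def pend)
  have S: "second_moment s (Suc h) r ?t i = second_moment s h r tot i"
    "second_moment s h r ?t i = second_moment s h r tot i" if "i \<noteq> h" for i
    using that by (simp_all add: second_moment_def pend F)
  have 1: "?p * first_moment s (Suc h) r ?t h + (1 - ?p) * first_moment s h r ?t h = first_moment s h r tot h"
    using geometric_first_moment[of ?p "real (tot h)" "pending h r h" "real s"]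
    by (simp add: first_moment_def pend_h add.commute)
  have 2: "?p * second_moment s (Suc h) r ?t h + (1 - ?p) * second_moment s h r ?t h = second_moment s h r tot h"
    using geometric_second_moment[of ?p "real (tot h)" "pending h r h" "real s"]
    by (simp add: second_moment_def first_moment_def pend_h add.commute)
  have I: "(\<Prod>i\<in>?I. first_moment s (Suc h) r ?t i) = (\<Prod>i\<in>?I. first_moment s h r tot i)"
    "(\<Prod>i\<in>?I. first_moment s h r ?t i) = (\<Prod>i\<in>?I. first_moment s h r tot i)"
    "(\<Prod>i\<in>?I. second_moment s (Suc h) r ?t i) = (\<Prod>i\<in>?I. second_moment s h r tot i)"
    "(\<Prod>i\<in>?I. second_moment s h r ?t i) = (\<Prod>i\<in>?I. second_moment s h r tot i)"
    by (auto intro!: prod.cong simp: F S)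
  have lin: "p * (a1 * A - 2 * (b1 * B) + 1) + (1 - p) * (a2 * A - 2 * (b2 * B) + 1)
    = (p * a1 + (1 - p) * a2) * A - 2 * ((p * b1 + (1 - p) * b2) * B) + 1" for p a1 a2 b1 b2 A B :: real
    by (simp add: algebra_simps)
  show ?thesis unfolding sq_error_def split I lin 1 2 ..
qed

text \<open>Chebyshev's inequality by induction along the chain. By the invariant
  \<open>W \<subseteq> {..<h}\<close>, the vertex \<open>h\<close> is drawn for only when
  \<open>W = {..<h}\<close>, and until its first acceptance; there the acceptance probability is
  \<open>accept_prob h\<close>. All other draws leave the potential unchanged.\<close>

lemma inaccurate_prob_sum:
  assumes "0 < d" "W \<subseteq> {..<h}" "h \<le> n" "r = 0 \<Longrightarrow> h = 0"
  shows "prob_sum {(f, h, r, tot). r = 0 \<and> d < \<bar>(\<Prod>i<n. accept_prob i * tot i / s) - 1\<bar>} j W h r tot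
    \<le> card (good W) * (sq_error s h r tot / d\<^sup>2)" using assms(2-4)
proof (induction j arbitrary: W h r tot)
  case 0
  let ?X = "{(f, h, r, tot). r = 0 \<and> d < \<bar>(\<Prod>i<n. accept_prob i * tot i / s) - 1\<bar>} :: chain_state set"
  have ge: "((\<Prod>i<n. first_moment s h r tot i) - 1)\<^sup>2 \<le> sq_error s h r tot"
    by (rule sq_error_ge) (use 0 in auto)
  have "indicator ?X (f, h, r, tot) \<le> sq_error s h r tot / d\<^sup>2" for f
  proof (cases "(f, h, r, tot) \<in> ?X")
    case True
    then have "r = 0" "h = 0" using 0 by auto
    then have "first_moment s h r tot i = accept_prob i * tot i / s" for i
      by (simp add: first_moment_def pending_def)
    then have "d < \<bar>(\<Prod>i<n. first_moment s h r tot i) - 1\<bar>" using True by simp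
    then have "d\<^sup>2 \<le> ((\<Prod>i<n. first_moment s h r tot i) - 1)\<^sup>2"
      using assms(1) by (metis abs_le_square_iff abs_of_pos less_imp_le)
    then show ?thesis using ge assms(1) True by (simp add: le_divide_eq)
  next
    case False
    have "0 \<le> sq_error s h r tot" using ge by (meson order_trans zero_le_power2)
    then show ?thesis using False by simp
  qed
  then have "(\<Sum>f\<in>good W. indicator ?X (f, h, r, tot)) \<le> (\<Sum>f\<in>good W. sq_error s h r tot / d\<^sup>2)"
    by (rule sum_mono)
  then show ?case by (simp add: prob_sum_def)
next
  case (Suc j)
  let ?X = "{(f, h, r, tot). r = 0 \<and> d < \<bar>(\<Prod>i<n. accept_prob i * tot i / s) - 1\<bar>} :: chain_state set"
  have W: "W \<subseteq> {..<n}" using Suc.prems by auto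
  show ?case
  proof (cases "r = 0")
    case True
    have "prob_sum ?X (Suc j) W h r tot = prob_sum ?X j W h r tot"
      unfolding True prob_sum_idle[OF W] ..
    then show ?thesis using Suc by simp
  next
    case r: False
    show ?thesis
    proof (cases "W = {..<n}")
      case True
      then have hn: "h = n" using Suc.prems by auto
      \<comment> \<open>A run with all \<open>n\<close> levels completed leaves as many variables
        pending as \<open>r - 1\<close> fresh runs.\<close>
      have "sq_error s h r tot = sq_error s 0 (r - 1) tot"
      proof -
        have "pending h r i = pending 0 (r - 1) i" if "i < n" for i
          using that r hn by (simp add: pending_def of_nat_diff)
        then show ?thesis by (simp add: sq_error_def second_moment_def first_moment_def)
      qed
      moreover have "prob_sum ?X j {} 0 (r - 1) tot \<le> card (good {}) * (sq_error s 0 (r - 1) tot / d\<^sup>2)"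
        by (rule Suc.IH) auto
      ultimately have "prob_sum ?X j {} 0 (r - 1) tot \<le> sq_error s h r tot / d\<^sup>2"
        by (simp add: good_empty)
      then have "card (good {..<n}) * prob_sum ?X j {} 0 (r - 1) tot
          \<le> card (good {..<n}) * (sq_error s h r tot / d\<^sup>2)" by (rule mult_left_mono) simp
      then show ?thesis using prob_sum_full[of r ?X j h tot] r True by simp
    next
      case neq: False
      define v where "v = (LEAST v. v \<notin> W)"
      define tot' where "tot' = (if v = h then tot(v := Suc (tot v)) else tot)"
      define h' where "h' = (if v = h then Suc h else h)"
      let ?Sv = "{S. v \<in> S \<and> S \<subseteq> insert v W}"
      let ?G = "\<lambda>U. real (card (good U))"
      have r0: "0 < r" using r by simp
      note step = prob_sum_Suc(1)[OF W neq r0, where X = ?X and j = j and h = h and tot = tot,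
            folded v_def, folded tot'_def h'_def]
          prob_sum_Suc(2-4)[OF W neq r0, folded v_def]
      have v: "v < n" "v \<notin> W" "{..<v} \<subseteq> W" using step(2-4) r by auto
      have vh: "v \<le> h" using v(3) Suc.prems(1) by (metis lessThan_subset_iff order_trans)
      have "real n * prob_sum ?X (Suc j) W h r tot = prob_sum ?X j (insert v W) h' r tot'
          + (\<Sum>S\<in>?Sv. bad_weight S * prob_sum ?X j (W - S) h r tot')"
        using step(1) r by simp
      also have "\<dots> \<le> ?G (insert v W) * (sq_error s h' r tot' / d\<^sup>2)
          + (\<Sum>S\<in>?Sv. bad_weight S * (?G (W - S) * (sq_error s h r tot' / d\<^sup>2)))"
      proof (intro add_mono sum_mono mult_left_mono Suc.IH bad_weight_nonneg)
        show "insert v W \<subseteq> {..<h'}" using vh Suc.prems(1) by (auto simp: h'_def)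
        show "h' \<le> n" using v(1) Suc.prems(2) by (auto simp: h'_def)
      qed (use Suc.prems r in auto)
      also have "\<dots> = (?G (insert v W) * sq_error s h' r tot'
          + (\<Sum>S\<in>?Sv. bad_weight S * ?G (W - S)) * sq_error s h r tot') / d\<^sup>2"
        by (simp add: add_divide_distrib sum_distrib_right sum_divide_distrib mult.assoc)
      also have "(\<Sum>S\<in>?Sv. bad_weight S * ?G (W - S)) = real n * ?G W - ?G (insert v W)"
        using draws_recurrence[OF W v(1,2)] by simp
      also have "?G (insert v W) * sq_error s h' r tot'
          + (real n * ?G W - ?G (insert v W)) * sq_error s h r tot'
          = real n * ?G W * sq_error s h r tot"
      proof (cases "v = h")
        case False
        then show ?thesis by (simp add: tot'_def h'_def algebra_simps)
      next
        case True
        then have "W = {..<h}" using v(3) Suc.prems(1) by auto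
        then have "?G (insert v W) = real n * ?G W * accept_prob h"
          using card_good_pos[OF W] n_pos True by (simp add: accept_prob_def lessThan_Suc)
        then have "?G (insert v W) * sq_error s h' r tot'
            + (real n * ?G W - ?G (insert v W)) * sq_error s h r tot'
          = real n * ?G W * (accept_prob h * sq_error s h' r tot'
              + (1 - accept_prob h) * sq_error s h r tot')" by (simp add: algebra_simps)
        then show ?thesis using sq_error_draw[of h s r tot] v(1) True by (simp add: tot'_def h'_def)
      qed
      finally have "real n * prob_sum ?X (Suc j) W h r tot
          \<le> real n * (?G W * (sq_error s h r tot / d\<^sup>2))" by simp
      then show ?thesis by (rule mult_left_le_imp_le) (use n_pos in simp)
    qed
  qed
qed

text \<open>The product telescopes down to \<open>card (good {}) = 1\<close>.\<close>

lemma prod_accept_prob: "m \<le> n \<Longrightarrow> (\<Prod>i<m. real n * accept_prob i) = card (good {..<m})"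
proof (induction m)
  case 0 then show ?case by (simp add: good_empty)
next
  case (Suc m)
  then show ?case using card_good_prefix_pos[of m] n_pos by (simp add: accept_prob_def)
qed

text \<open>At the start all first moments equal 1, and each of the \<open>n\<close> second moments
  is at most \<open>1 + 1 / s \<le> exp (1 / s)\<close>.\<close>

lemma initial_error:
  assumes "0 < s" shows "sq_error s 0 s (\<lambda>_. 0) \<le> exp (n / s) - 1"
proof -
  have "first_moment s 0 s (\<lambda>_. 0) i = 1" for i
    using assms by (simp add: first_moment_def pending_def)
  moreover have "(\<Prod>i<n. second_moment s 0 s (\<lambda>_. 0) i) \<le> (\<Prod>i<n. exp (1 / s))"
  proof (intro prod_mono conjI)
    fix i assume i: "i \<in> {..<n}"
    have *: "second_moment s 0 s (\<lambda>_. 0) i = 1 + (1 - accept_prob i) / s"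
      using assms by (simp add: second_moment_def first_moment_def pending_def power2_eq_square)
    then show "0 \<le> second_moment s 0 s (\<lambda>_. 0) i"
      using accept_prob_bounds[of i] i assms by simp
    have "1 + (1 - accept_prob i) / s \<le> 1 + 1 / s"
      using accept_prob_bounds[of i] i assms by (simp add: divide_right_mono)
    also have "\<dots> \<le> exp (1 / s)" by (rule exp_ge_add_one_self)
    finally show "second_moment s 0 s (\<lambda>_. 0) i \<le> exp (1 / s)" using * by simp
  qed
  moreover have "(\<Prod>i<n. exp (1 / real s)) = exp (n / s)"
    by (simp add: exp_of_nat_mult[symmetric])
  ultimately show ?thesis by (simp add: sq_error_def)
qed

text \<open>Not finishing and being inaccurate are allowed probability 1/8 each. The budget per run
  is eight times \<open>8 * n ^ 3\<close>, which bounds \<open>4 * n ^ 3 + 1\<close>; the choice of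
  \<open>s\<close> makes the mean square error at most \<open>e ^ 2 / 32\<close>, against the
  squared tolerance \<open>e ^ 2 / 4\<close>.\<close>

lemma chain_accuracy:
  fixes e :: real
  assumes k: "0 < k" "1 / real k \<le> e" and e: "e < 1"
  defines "s \<equiv> 64 * n * k ^ 2"
  shows "3 / 4 \<le> measure_pmf.prob (chain (64 * n ^ 3 * s) (id, 0, s, \<lambda>_. 0))
    {(f, h, r, tot). (1 - e) * card (good {..<n}) \<le> (\<Prod>i<n. real (n * s) / tot i) \<and>
       (\<Prod>i<n. real (n * s) / tot i) \<le> (1 + e) * card (good {..<n})}" (is "_ \<le> measure_pmf.prob ?M ?Good")
proof -
  define B where "B = 64 * n ^ 3 * s"
  \<comment> \<open>The estimate is the count divided by \<open>Z\<close>; for \<open>e < 1\<close>,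
    a \<open>Z\<close> within \<open>e / 2\<close> of 1 has \<open>1 / Z\<close> within
    \<open>e\<close> of 1.\<close>
  define d where "d = e / 2"
  have e0: "0 < e" using k by (smt (verit) divide_pos_pos of_nat_0_less_iff)
  have d0: "0 < d" using e0 by (simp add: d_def)
  have s0: "0 < s" using n_pos k by (simp add: s_def)
  have B0: "0 < B" using n_pos s0 by (simp add: B_def)
  let ?X1 = "{a. fst (snd (snd a)) \<noteq> 0} :: chain_state set"
  let ?X2 = "{(f, h, r, tot). r = 0 \<and> d < \<bar>(\<Prod>i<n. accept_prob i * tot i / s) - 1\<bar>} :: chain_state set"
  have "real B * prob_sum ?X1 B {} 0 s (\<lambda>_. 0) \<le> card (good {}) * remaining_draws {} s"
    by (rule unfinished_prob_sum) simp
  then have "real B * measure_pmf.prob ?M ?X1 \<le> real s * real (4 * n ^ 3 + 1)"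
    using s0 by (simp add: good_empty prob_sum_def remaining_draws_def mean_draws_empty B_def)
  also have "\<dots> \<le> real B * (1 / 8)"
  proof -
    have "1 \<le> n ^ 3" using n_pos by simp
    then have "s * (4 * n ^ 3 + 1) \<le> s * (8 * n ^ 3)" by simp
    then have "real (s * (4 * n ^ 3 + 1)) \<le> real (s * (8 * n ^ 3))" by (simp only: of_nat_le_iff)
    then show ?thesis by (simp add: B_def algebra_simps)
  qed
  finally have 1: "measure_pmf.prob ?M ?X1 \<le> 1 / 8" using B0 by simp
  have "prob_sum ?X2 B {} 0 s (\<lambda>_. 0) \<le> card (good {}) * (sq_error s 0 s (\<lambda>_. 0) / d\<^sup>2)"
    by (rule inaccurate_prob_sum[OF d0]) (use s0 in auto)
  then have "measure_pmf.prob ?M ?X2 \<le> sq_error s 0 s (\<lambda>_. 0) / d\<^sup>2"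
    by (simp add: good_empty prob_sum_def B_def)
  also have "\<dots> \<le> 1 / 8"
  proof -
    have ns: "real n / real s = 1 / (64 * (real k)\<^sup>2)" using n_pos by (simp add: s_def)
    have "1 \<le> (real k)\<^sup>2" using k by simp
    then have "1 \<le> 64 * (real k)\<^sup>2" by linarith
    then have small: "1 / (64 * (real k)\<^sup>2) \<le> 1" using k by (subst divide_le_eq_1_pos) auto
    have "exp (1 / (64 * (real k)\<^sup>2)) \<le> 1 + 1 / (64 * (real k)\<^sup>2) + (1 / (64 * (real k)\<^sup>2))\<^sup>2"
      by (rule exp_bound) (use small in auto)
    also have "(1 / (64 * (real k)\<^sup>2))\<^sup>2 \<le> 1 / (64 * (real k)\<^sup>2)"
      unfolding power2_eq_square[of "1 / (64 * (real k)\<^sup>2)"]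
      by (rule mult_left_le) (use small in auto)
    finally have "exp (n / s) - 1 \<le> (1 / real k)\<^sup>2 / 32" unfolding ns by (simp add: power_divide)
    also have "\<dots> \<le> e\<^sup>2 / 32" using k by (intro divide_right_mono power_mono) auto
    finally have "sq_error s 0 s (\<lambda>_. 0) \<le> e\<^sup>2 / 32" using initial_error[OF s0] by linarith
    then show ?thesis using e0 by (simp add: d_def divide_le_eq power_divide)
  qed
  finally have 2: "measure_pmf.prob ?M ?X2 \<le> 1 / 8" .
  have "- ?Good \<subseteq> ?X1 \<union> ?X2"
  proof
    fix a assume a: "a \<in> - ?Good"
    obtain f h r tot where ae: "a = (f, h, r, tot)" by (metis prod_cases4)
    show "a \<in> ?X1 \<union> ?X2"
    proof (rule ccontr)
      assume "a \<notin> ?X1 \<union> ?X2"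
      then have le: "\<bar>(\<Prod>i<n. accept_prob i * tot i / s) - 1\<bar> \<le> d" by (auto simp: ae)
      define Z where "Z = (\<Prod>i<n. accept_prob i * tot i / s)"
      have Z: "1 - d \<le> Z" "Z \<le> 1 + d" using le by (auto simp: Z_def abs_le_iff)
      have Z0: "0 < Z" using Z e by (simp add: d_def)
      have "(\<Prod>i<n. real (n * s) / tot i) * Z = (\<Prod>i<n. real (n * s) / tot i * (accept_prob i * tot i / s))"
        unfolding Z_def by (rule prod.distrib[symmetric])
      also have "\<dots> = (\<Prod>i<n. real n * accept_prob i)"
      proof (rule prod.cong[OF refl])
        fix i assume i: "i \<in> {..<n}"
        \<comment> \<open>Division by 0 yields 0, so cancelling \<open>tot i\<close> requires that
          the counter does not vanish.\<close>
        have "tot i \<noteq> 0"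
        proof
          assume "tot i = 0"
          then have "Z = 0" unfolding Z_def using i by (intro prod_zero) auto
          then show False using Z0 by simp
        qed
        then show "real (n * s) / tot i * (accept_prob i * tot i / s) = real n * accept_prob i"
          using s0 by simp
      qed
      also have "\<dots> = card (good {..<n})" by (rule prod_accept_prob) simp
      finally have N: "(\<Prod>i<n. real (n * s) / tot i) = card (good {..<n}) / Z"
        using Z0 by (simp add: eq_divide_eq)
      have "(1 - e) * Z \<le> 1"
      proof -
        have "(1 - e) * Z \<le> (1 - e) * (1 + d)" using Z e by (intro mult_left_mono) auto
        also have "\<dots> \<le> 1" using e0 by (simp add: d_def algebra_simps)
        finally show ?thesis .
      qed
      moreover have "1 \<le> (1 + e) * Z"
      proof -
        have "e * e \<le> e" using e e0 by (simp add: mult_left_le)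
        then have "1 \<le> (1 + e) * (1 - d)" by (simp add: d_def algebra_simps)
        also have "\<dots> \<le> (1 + e) * Z" using Z e0 by (intro mult_left_mono) auto
        finally show ?thesis .
      qed
      ultimately have "(1 - e) * card (good {..<n}) \<le> card (good {..<n}) / Z"
        "card (good {..<n}) / Z \<le> (1 + e) * card (good {..<n})"
        using Z0 mult_right_mono[of "(1 - e) * Z" 1 "real (card (good {..<n}))"]
          mult_right_mono[of 1 "(1 + e) * Z" "real (card (good {..<n}))"]
        by (simp_all add: le_divide_eq divide_le_eq algebra_simps)
      then have "a \<in> ?Good" unfolding ae using N by simp
      then show False using a by simp
    qed
  qed
  then have "measure_pmf.prob ?M (- ?Good) \<le> measure_pmf.prob ?M (?X1 \<union> ?X2)"
    by (intro measure_pmf.finite_measure_mono) auto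
  also have "\<dots> \<le> measure_pmf.prob ?M ?X1 + measure_pmf.prob ?M ?X2"
    by (rule measure_Un_le) auto
  also have "\<dots> \<le> 1 / 4" using 1 2 by simp
  finally have "measure_pmf.prob ?M (- ?Good) \<le> 1 / 4" .
  moreover have "measure_pmf.prob ?M (- ?Good) = 1 - measure_pmf.prob ?M ?Good"
    using measure_pmf.prob_compl[of ?Good ?M] by (simp add: Compl_eq_Diff_UNIV)
  ultimately show ?thesis by simp
qed

end

section \<open>Running programs\<close>

text \<open>As \<open>Skip\<close> is never left, \<open>t\<close> is an upper bound for the running time, valid on every run, and \<open>M\<close> is the
  distribution of the final state.\<close>

definition exec :: "com \<Rightarrow> state \<Rightarrow> nat \<Rightarrow> state pmf \<Rightarrow> bool" where
  "exec c s t M \<longleftrightarrow> run t (c, s) = map_pmf (Pair Skip) M"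

lemma run_Skip: "run t (Skip, s) = return_pmf (Skip, s)"
  by (induction t) (simp_all add: bind_return_pmf)

lemma run_add: "run (t + u) cfg = bind_pmf (run t cfg) (run u)"
proof (induction t arbitrary: cfg)
  case (Suc t)
  then have "run (t + u) = (\<lambda>cfg. bind_pmf (run t cfg) (run u))" by (rule ext)
  then show ?case by (simp add: bind_assoc_pmf)
qed (simp add: bind_return_pmf)

lemma exec_mono:
  assumes "exec c s t M" "t \<le> u" shows "exec c s u M"
proof -
  have "run u (c, s) = bind_pmf (run t (c, s)) (run (u - t))"
    using assms(2) by (simp add: run_add[symmetric])
  then show ?thesis
    using assms(1) by (simp add: exec_def bind_map_pmf run_Skip map_pmf_def[of "Pair Skip"] bind_assoc_pmf bind_return_pmf)
qed

lemma exec_Skip: "exec Skip s t (return_pmf s)" by (simp add: exec_def run_Skip)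

lemma exec_step:
  assumes "step (c, s) = return_pmf (c', s')" "exec c' s' t M"
  shows "exec c s (Suc t) M" using assms by (simp add: exec_def bind_return_pmf)

text \<open>Induction on \<open>t\<close>, following the first step of \<open>c\<close>: the law
  after \<open>c\<close> is a mixture over the configurations reached by that step. The extra unit
  is for discarding the finished \<open>Skip\<close>.\<close>

lemma exec_Seq:
  assumes "exec c s t M" "\<And>s'. s' \<in> set_pmf M \<Longrightarrow> exec d s' u (N s')"
  shows "exec (Seq c d) s (t + u + 1) (bind_pmf M N)" using assms
proof (induction t arbitrary: c s M)
  case 0
  then have eq: "map_pmf (Pair Skip) M = return_pmf (c, s)" by (simp add: exec_def)
  then have "Pair Skip ` set_pmf M = {(c, s)}" by (metis set_map_pmf set_return_pmf)
  then have c: "c = Skip" by auto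
  have "map_pmf (Pair Skip) M = map_pmf (Pair Skip) (return_pmf s)" using eq c by simp
  then have M: "M = return_pmf s" by (rule injD[OF pmf.inj_map, rotated]) (simp add: inj_def)
  have "exec d s u (N s)" using 0(2) M by simp
  then show ?case using c M by (simp add: exec_def bind_return_pmf)
next
  case (Suc t)
  show ?case
  proof (cases "c = Skip")
    case True
    have "map_pmf (Pair Skip) M = map_pmf (Pair Skip) (return_pmf s)"
      using Suc.prems(1) True by (simp add: exec_def bind_return_pmf run_Skip)
    then have M: "M = return_pmf s" by (rule injD[OF pmf.inj_map, rotated]) (simp add: inj_def)
    have "exec d s (t + u + 1) (N s)" by (rule exec_mono[of _ _ u]) (use Suc.prems(2) M in auto)
    then show ?thesis using True M by (simp add: exec_def bind_return_pmf)
  next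
    case False
    define K where "K = (\<lambda>cfg. map_pmf snd (run t cfg))"
    have run: "bind_pmf (step (c, s)) (run t) = map_pmf (Pair Skip) M"
      using Suc.prems(1) by (simp add: exec_def)
    \<comment> \<open>The mixture over all first steps is supported on \<open>Skip\<close>, hence so
      is each of its components.\<close>
    have halted: "run t cfg = map_pmf (Pair Skip) (K cfg)" if "cfg \<in> set_pmf (step (c, s))" for cfg
    proof -
      have "set_pmf (run t cfg) \<subseteq> set_pmf (bind_pmf (step (c, s)) (run t))" using that by auto
      then have "set_pmf (run t cfg) \<subseteq> Pair Skip ` set_pmf M" unfolding run by simp
      then have "map_pmf (Pair Skip \<circ> snd) (run t cfg) = map_pmf id (run t cfg)"
        by (intro map_pmf_cong) auto
      then show ?thesis by (simp add: K_def pmf.map_comp)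
    qed
    have M: "M = bind_pmf (step (c, s)) K"
      using arg_cong[OF run, of "map_pmf snd"] by (simp add: map_bind_pmf K_def pmf.map_comp o_def)
    have "run (Suc t + u + 1) (Seq c d, s) = bind_pmf (step (c, s)) (\<lambda>(c', s'). run (t + u + 1) (Seq c' d, s'))"
      using False by (simp add: bind_map_pmf case_prod_beta')
    also have "\<dots> = bind_pmf (step (c, s)) (\<lambda>cfg. map_pmf (Pair Skip) (bind_pmf (K cfg) N))"
    proof (rule bind_pmf_cong[OF refl])
      fix cfg assume cfg: "cfg \<in> set_pmf (step (c, s))"
      obtain c' s' where cs: "cfg = (c', s')" by (cases cfg)
      have "exec (Seq c' d) s' (t + u + 1) (bind_pmf (K cfg) N)"
      proof (rule Suc.IH)
        show "exec c' s' t (K cfg)" using halted[OF cfg] cs by (simp add: exec_def)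
        fix s'' assume "s'' \<in> set_pmf (K cfg)"
        then have "s'' \<in> set_pmf M" using cfg unfolding M by auto
        then show "exec d s'' u (N s'')" by (rule Suc.prems(2))
      qed
      then show "(case cfg of (c', s') \<Rightarrow> run (t + u + 1) (Seq c' d, s')) = map_pmf (Pair Skip) (bind_pmf (K cfg) N)"
        using cs by (simp add: exec_def)
    qed
    also have "\<dots> = map_pmf (Pair Skip) (bind_pmf M N)"
      unfolding M by (simp add: map_bind_pmf bind_assoc_pmf)
    finally show ?thesis by (simp only: exec_def)
  qed
qed

lemma exec_Draw:
  "exec (Draw x a) s 1 (map_pmf (\<lambda>k. ((fst s)(x := k), snd s)) (pmf_of_set {0..aval a s}))"
  by (simp add: exec_def bind_map_pmf map_pmf_comp map_pmf_def[symmetric] bind_return_pmf' o_def)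

text \<open>Total correctness with a step bound, for executions whose outcome is deterministic.
  Taking \<open>reaches d u Q\<close> as a postcondition chains the parts of a sequence.\<close>

definition reaches :: "com \<Rightarrow> nat \<Rightarrow> (state \<Rightarrow> bool) \<Rightarrow> state \<Rightarrow> bool" where
  "reaches c t Q s \<longleftrightarrow> (\<exists>s'. exec c s t (return_pmf s') \<and> Q s')"

lemma reaches_mono:
  assumes "reaches c t Q s" "t \<le> u" "\<And>s'. Q s' \<Longrightarrow> Q' s'" shows "reaches c u Q' s"
  using assms exec_mono unfolding reaches_def by blast

lemma reaches_Seq:
  assumes "reaches c t (\<lambda>s'. reaches d u Q s') s" "t + u + 1 \<le> T"
  shows "reaches (Seq c d) T Q s"
proof -
  obtain s' where s': "exec c s t (return_pmf s')" "reaches d u Q s'" using assms(1) unfolding reaches_def by blast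
  then obtain s'' where s'': "exec d s' u (return_pmf s'')" "Q s''" unfolding reaches_def by blast
  have "exec (Seq c d) s (t + u + 1) (bind_pmf (return_pmf s') (\<lambda>_. return_pmf s''))"
    by (rule exec_Seq[OF s'(1)]) (use s''(1) in simp)
  then have "exec (Seq c d) s T (return_pmf s'')"
    using exec_mono[OF _ assms(2)] by (simp add: bind_return_pmf)
  then show ?thesis using s''(2) unfolding reaches_def by blast
qed

lemma reaches_step:
  assumes "step (c, s) = return_pmf (c', s')" "reaches c' t Q s'" "Suc t \<le> T"
  shows "reaches c T Q s" using assms exec_step exec_mono unfolding reaches_def by blast

text \<open>The invariant carries the round number, which replaces a termination measure. A round
  costs two steps beyond its body, for unfolding the loop and for discarding the final
  \<open>Skip\<close>; the last test of the guard costs one.\<close>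

lemma reaches_While:
  assumes init: "I 0 s"
    and body: "\<And>i s. i < N \<Longrightarrow> I i s \<Longrightarrow> aval a s \<noteq> 0 \<and> reaches c t (I (Suc i)) s"
    and exit: "\<And>s. I N s \<Longrightarrow> aval a s = 0 \<and> Q s"
    and "N * (t + 2) + 1 \<le> T"
  shows "reaches (While a c) T Q s"
proof -
  have "reaches (While a c) ((N - i) * (t + 2) + 1) Q s" if "i \<le> N" "I i s" for i s using that
  proof (induction "N - i" arbitrary: i s)
    case 0
    then have "I N s" by simp
    then have "aval a s = 0" "reaches Skip 0 Q s"
      using exit[of s] exec_Skip[of s 0] unfolding reaches_def by blast+
    then show ?case by (intro reaches_step[of "While a c" s Skip s 0]) auto
  next
    case (Suc m)
    then have i: "i < N" by simp
    have b: "aval a s \<noteq> 0" "reaches c t (I (Suc i)) s" using body[OF i Suc.prems(2)] by auto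
    have "reaches (Seq c (While a c)) (t + ((N - Suc i) * (t + 2) + 1) + 1) Q s"
    proof (rule reaches_Seq[OF _ order_refl])
      show "reaches c t (\<lambda>s'. reaches (While a c) ((N - Suc i) * (t + 2) + 1) Q s') s"
        by (rule reaches_mono[OF b(2) order_refl], rule Suc.hyps(1)) (use Suc.hyps(2) i in auto)
    qed
    moreover have "N - i = Suc (N - Suc i)" using i by simp
    ultimately show ?case using b(1)
      by (intro reaches_step[of "While a c" s "Seq c (While a c)" s]) auto
  qed
  from this[of 0 s] init have "reaches (While a c) (N * (t + 2) + 1) Q s" by simp
  then show ?thesis by (rule reaches_mono) (use assms(4) in auto)
qed

text \<open>For commands without loops and draws, the final state and a step bound are obtained by
  rewriting.\<close>

fun straight :: "com \<Rightarrow> bool" where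
  "straight (Draw _ _) = False"
| "straight (While _ _) = False"
| "straight (Seq c d) = (straight c \<and> straight d)"
| "straight (Cond _ c d) = (straight c \<and> straight d)"
| "straight _ = True"

fun effect :: "com \<Rightarrow> state \<Rightarrow> state" where
  "effect (Assign x a) s = ((fst s)(x := aval a s), snd s)"
| "effect (Store a b) s = (fst s, (snd s)(aval a s := aval b s))"
| "effect (Seq c d) s = effect d (effect c s)"
| "effect (Cond a c d) s = (if aval a s \<noteq> 0 then effect c s else effect d s)"
| "effect _ s = s"

fun cost :: "com \<Rightarrow> nat" where
  "cost Skip = 0"
| "cost (Assign _ _) = 1"
| "cost (Store _ _) = 1"
| "cost (Draw _ _) = 1"
| "cost (Seq c d) = cost c + cost d + 1"
| "cost (Cond _ c d) = max (cost c) (cost d) + 1"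
| "cost (While _ _) = 1"

lemma exec_straight: "straight c \<Longrightarrow> exec c s (cost c) (return_pmf (effect c s))"
proof (induction c arbitrary: s)
  case (Seq c d)
  then have "exec (Seq c d) s (cost c + cost d + 1) (bind_pmf (return_pmf (effect c s)) (\<lambda>s. return_pmf (effect d s)))"
    by (intro exec_Seq) auto
  then show ?case by (simp add: bind_return_pmf)
next
  case (Cond a c d)
  let ?c = "if aval a s \<noteq> 0 then c else d"
  have "exec ?c s (cost ?c) (return_pmf (effect ?c s))" using Cond by auto
  then have "exec ?c s (max (cost c) (cost d)) (return_pmf (effect ?c s))" by (rule exec_mono) auto
  then have "exec (Cond a c d) s (Suc (max (cost c) (cost d))) (return_pmf (effect ?c s))"
    by (intro exec_step[of _ _ ?c s]) auto
  then show ?case by (cases "aval a s = 0") simp_all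
qed (auto simp: exec_def bind_return_pmf run_Skip)

lemma reaches_straight:
  assumes "straight c" "cost c \<le> t" "Q (effect c s)" shows "reaches c t Q s"
  using assms exec_straight[of c s] exec_mono unfolding reaches_def by blast

lemma reaches_Cond:
  assumes "aval a s \<noteq> 0 \<Longrightarrow> reaches c t Q s" "aval a s = 0 \<Longrightarrow> reaches d t Q s" "Suc t \<le> T"
  shows "reaches (Cond a c d) T Q s"
  by (rule reaches_step[of _ _ "if aval a s \<noteq> 0 then c else d" s t]) (use assms in auto)

definition agree :: "string set \<Rightarrow> (string \<Rightarrow> nat) \<Rightarrow> (string \<Rightarrow> nat) \<Rightarrow> bool" where
  "agree Z R R' \<longleftrightarrow> (\<forall>z. z \<notin> Z \<longrightarrow> R' z = R z)"

definition neq :: "aexp \<Rightarrow> aexp \<Rightarrow> aexp" where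
  "neq a b = Plus (Minus a b) (Minus b a)"

lemma aval_neq: "aval (neq a b) s = 0 \<longleftrightarrow> aval a s = aval b s"
  by (auto simp: neq_def)

text \<open>The time is linear in \<open>y\<close> and independent of \<open>x\<close>, so callers
  put the larger number into \<open>x\<close>.\<close>

definition mul :: "string \<Rightarrow> string \<Rightarrow> com" where
  "mul x y = Seq (Seq (Assign ''t'' (Const 0)) (Assign ''i'' (Reg y)))
     (Seq (While (Reg ''i'') (Seq (Assign ''t'' (Plus (Reg ''t'') (Reg x))) (Assign ''i'' (Minus (Reg ''i'') (Const 1)))))
          (Assign x (Reg ''t'')))"

lemma reaches_mul:
  assumes "x \<notin> {''t'', ''i''}" "y \<notin> {''t'', ''i''}" "5 * R y + 7 \<le> T"
    and Q: "\<And>R'. agree {x, ''t'', ''i''} R R' \<Longrightarrow> R' x = R x * R y \<Longrightarrow> Q (R', M)"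
  shows "reaches (mul x y) T Q (R, M)"
proof -
  let ?b = "Seq (Assign ''t'' (Plus (Reg ''t'') (Reg x))) (Assign ''i'' (Minus (Reg ''i'') (Const 1)))"
  let ?i = "Seq (Assign ''t'' (Const 0)) (Assign ''i'' (Reg y))"
  show ?thesis unfolding mul_def
  proof (rule reaches_Seq[where t = 3 and u = "5 * R y + 3"])
    let ?I = "\<lambda>k s. snd s = M \<and> agree {''t'', ''i''} R (fst s) \<and> fst s ''t'' = k * R x \<and> fst s ''i'' = R y - k"
    show "reaches ?i 3
      (\<lambda>s'. reaches (Seq (While (Reg ''i'') ?b)
            (Assign x (Reg ''t''))) (5 * R y + 3) Q s') (R, M)"
    proof (rule reaches_straight)
      show "reaches (Seq (While (Reg ''i'') ?b)
            (Assign x (Reg ''t''))) (5 * R y + 3) Q (effect ?i (R, M))"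
      proof (rule reaches_Seq[where t = "5 * R y + 1" and u = 1], rule reaches_While[where I = ?I and N = "R y" and t = 3])
        show "?I 0 (effect ?i (R, M))" using assms(1,2) by (auto simp: agree_def)
      next
        fix k s assume k: "k < R y" and I: "?I k s"
        obtain R' M' where s: "s = (R', M')" by (cases s)
        show "aval (Reg ''i'') s \<noteq> 0 \<and>
          reaches ?b 3 (?I (Suc k)) s"
          by (rule conjI, use k I in simp, rule reaches_straight) (use k I assms(1) in \<open>auto simp: s agree_def\<close>)
      next
        fix s assume I: "?I (R y) s"
        obtain R' M' where s: "s = (R', M')" by (cases s)
        show "aval (Reg ''i'') s = 0 \<and> reaches (Assign x (Reg ''t'')) 1 Q s"
        proof
          show "aval (Reg ''i'') s = 0" using I by simp
          have "Q (R'(x := R' ''t''), M')"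
          proof -
            have "agree {x, ''t'', ''i''} R (R'(x := R' ''t''))" "(R'(x := R' ''t'')) x = R x * R y"
              using I by (simp_all add: s agree_def)
            then have "Q (R'(x := R' ''t''), M)" by (rule Q)
            then show ?thesis using I by (simp add: s)
          qed
          then show "reaches (Assign x (Reg ''t'')) 1 Q s" by (intro reaches_straight) (simp_all add: s)
        qed
      qed (use assms(3) in auto)
    qed auto
  qed (use assms(3) in auto)
qed

section \<open>Subprograms\<close>

definition scan :: com where
  "scan = Seq (Assign ''v'' (Const 0))
     (While (neq (Mem (Plus (Reg ''a'') (Reg ''v''))) (Reg ''v'')) (Assign ''v'' (Plus (Reg ''v'') (Const 1))))"

text \<open>A non-neighbour \<open>x\<close> leaves \<open>y = v\<close>, so a rejected draw is
  recorded as a loop. Both orders of the ends are tested because the input lists them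
  arbitrarily.\<close>

definition look_up :: com where
  "look_up = Seq (Seq (Assign ''y'' (Reg ''v'')) (Seq (Assign ''j'' (Const 4)) (Assign ''i'' (Reg ''e''))))
     (While (Reg ''i'')
       (Seq (Cond (Plus (neq (Mem (Reg ''j'')) (Reg ''v'')) (neq (Mem (Plus (Reg ''j'') (Const 1))) (Reg ''x'')))
              Skip (Assign ''y'' (Reg ''x'')))
       (Seq (Cond (Plus (neq (Mem (Reg ''j'')) (Reg ''x'')) (neq (Mem (Plus (Reg ''j'') (Const 1))) (Reg ''v'')))
              Skip (Assign ''y'' (Reg ''x'')))
       (Seq (Assign ''j'' (Plus (Reg ''j'') (Const 2))) (Assign ''i'' (Minus (Reg ''i'') (Const 1)))))))"

text \<open>Follows \<open>n\<close> arcs from \<open>v\<close>, hence all of the cycle through \<open>v\<close> if there is one; \<open>m\<close>, \<open>p\<close>, \<open>q\<close> are the least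
  vertex met, its predecessor and its successor.\<close>

definition walk :: com where
  "walk = Seq (Seq (Assign ''c'' (Const 0)) (Seq (Assign ''m'' (Reg ''n''))
       (Seq (Assign ''u'' (Reg ''v'')) (Assign ''i'' (Reg ''n'')))))
     (While (Reg ''i'')
       (Seq (Assign ''w'' (Mem (Plus (Reg ''a'') (Reg ''u''))))
       (Seq (Cond (Minus (Reg ''m'') (Reg ''w''))
              (Seq (Assign ''m'' (Reg ''w'')) (Seq (Assign ''p'' (Reg ''u''))
                (Assign ''q'' (Mem (Plus (Reg ''a'') (Reg ''w''))))))
              Skip)
       (Seq (Cond (neq (Reg ''w'') (Reg ''v'')) Skip (Assign ''c'' (Const 1)))
       (Seq (Assign ''u'' (Reg ''w'')) (Assign ''i'' (Minus (Reg ''i'') (Const 1))))))))"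

text \<open>The target of an arc is saved in \<open>w\<close> before the arc is erased. The loop
  stops on returning to \<open>v\<close>, by then a fixed point.\<close>

definition unlink :: com where
  "unlink = Seq (Assign ''u'' (Reg ''v''))
     (While (neq (Mem (Plus (Reg ''a'') (Reg ''u''))) (Reg ''u''))
       (Seq (Assign ''w'' (Mem (Plus (Reg ''a'') (Reg ''u''))))
       (Seq (Store (Plus (Reg ''a'') (Reg ''u'')) (Reg ''u'')) (Assign ''u'' (Reg ''w'')))))"

definition reset :: com where
  "reset = Seq (Assign ''u'' (Const 0))
     (While (Minus (Plus (Reg ''n'') (Const 1)) (Reg ''u''))
       (Seq (Store (Plus (Reg ''a'') (Reg ''u'')) (Reg ''u'')) (Assign ''u'' (Plus (Reg ''u'') (Const 1)))))"

section \<open>Memory layout and correctness of the subprograms\<close>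

locale encoded_graph = connected_graph_on +
  fixes es :: "(nat \<times> nat) list"
  assumes edges_es: "E = (\<lambda>(u, v). {u, v}) ` set es"
begin

text \<open>Cells 0 to 3 hold \<open>p\<close>, \<open>q\<close>, \<open>n\<close> and the number of
  edges. The edges follow, two cells each, then \<open>n + 1\<close> links from \<open>base\<close>
  and \<open>n\<close> counters from \<open>tots\<close>.\<close>

definition base :: nat where "base = 4 + 2 * length es"

definition tots :: nat where "tots = base + n + 1"

definition gsize :: nat where "gsize = n + length es + 1"

definition fixed_regs :: "(string \<Rightarrow> nat) \<Rightarrow> bool" where
  "fixed_regs R \<longleftrightarrow> R ''n'' = n \<and> R ''e'' = length es \<and> R ''a'' = base \<and> R ''b'' = tots"

definition stored_edges :: "(nat \<Rightarrow> nat) \<Rightarrow> bool" where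
  "stored_edges M \<longleftrightarrow> (\<forall>i<length es. M (4 + 2 * i) = fst (es ! i) \<and> M (5 + 2 * i) = snd (es ! i))"

text \<open>The entry for \<open>n\<close>, which always is \<open>n\<close>, is the sentinel that stops \<open>scan\<close>.\<close>

definition links :: "(nat \<Rightarrow> nat) \<Rightarrow> (nat \<Rightarrow> nat) \<Rightarrow> bool" where
  "links f M \<longleftrightarrow> (\<forall>u\<le>n. M (base + u) = f u)"

lemma reaches_scan:
  assumes "fixed_regs R" "links f M" "f n = n" "10 * gsize \<le> T"
    and Q: "\<And>R'. agree {''v''} R R' \<Longrightarrow> R' ''v'' = (LEAST v. f v = v) \<Longrightarrow> Q (R', M)"
  shows "reaches scan T Q (R, M)"
proof -
  let ?g = "neq (Mem (Plus (Reg ''a'') (Reg ''v''))) (Reg ''v'')"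
  let ?b = "Assign ''v'' (Plus (Reg ''v'') (Const 1))"
  define v where "v = (LEAST v. f v = v)"
  have vn: "v \<le> n" unfolding v_def by (rule Least_le) (rule assms(3))
  have fv: "f v = v" unfolding v_def by (rule LeastI) (rule assms(3))
  have fu: "f u \<noteq> u" if "u < v" for u using not_less_Least[of u "\<lambda>v. f v = v"] that by (simp add: v_def)
  let ?I = "\<lambda>i s. snd s = M \<and> agree {''v''} R (fst s) \<and> fst s ''v'' = i"
  show ?thesis unfolding scan_def
  proof (rule reaches_Seq[where t = 1 and u = "3 * n + 1"], rule reaches_straight)
    show "reaches (While ?g ?b)
       (3 * n + 1) Q (effect (Assign ''v'' (Const 0)) (R, M))"
    proof (rule reaches_While[where I = ?I and N = v and t = 1])
      show "?I 0 (effect (Assign ''v'' (Const 0)) (R, M))" by (simp add: agree_def)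
    next
      fix i s assume i: "i < v" and I: "?I i s"
      have "fst s ''a'' = base" using I assms(1) by (simp add: agree_def fixed_regs_def)
      then have "aval (Mem (Plus (Reg ''a'') (Reg ''v''))) s = f i"
        using I i vn assms(2) by (simp add: links_def)
      then have "aval ?g s \<noteq> 0" using I fu[OF i] by (simp add: aval_neq)
      moreover have "reaches ?b 1 (?I (Suc i)) s"
        by (rule reaches_straight) (use I in \<open>auto simp: agree_def\<close>)
      ultimately show "aval ?g s \<noteq> 0
        \<and> reaches ?b 1 (?I (Suc i)) s" ..
    next
      fix s assume I: "?I v s"
      have "fst s ''a'' = base" using I assms(1) by (simp add: agree_def fixed_regs_def)
      then have "aval (Mem (Plus (Reg ''a'') (Reg ''v''))) s = f v"
        using I vn assms(2) by (simp add: links_def)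
      then have "aval ?g s = 0" using I fv by (simp add: aval_neq)
      moreover have "Q (fst s, M)" by (rule Q) (use I v_def in auto)
      ultimately show "aval ?g s = 0 \<and> Q s" using I by (metis prod.collapse)
    qed (use vn in simp)
  qed (use assms(4) in \<open>auto simp: gsize_def\<close>)
qed

lemma reaches_look_up:
  assumes "fixed_regs R" "stored_edges M" "20 * gsize \<le> T"
    and Q: "\<And>R'. agree {''y'', ''j'', ''i''} R R' \<Longrightarrow>
       R' ''y'' = (if {R ''v'', R ''x''} \<in> E then R ''x'' else R ''v'') \<Longrightarrow> Q (R', M)"
  shows "reaches look_up T Q (R, M)"
proof -
  define v where "v = R ''v''"
  define x where "x = R ''x''"
  define m where "m = length es"
  define hit where "hit = (\<lambda>i. \<exists>k<i. es ! k = (v, x) \<or> es ! k = (x, v))"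
  have hit_Suc: "hit (Suc i) \<longleftrightarrow> hit i \<or> es ! i = (v, x) \<or> es ! i = (x, v)" for i
    by (auto simp: hit_def less_Suc_eq)
  have hit_m: "hit m \<longleftrightarrow> {v, x} \<in> E"
  proof -
    have "{v, x} \<in> E \<longleftrightarrow> (\<exists>a b. (a, b) \<in> set es \<and> {v, x} = {a, b})"
      unfolding edges_es by (auto simp: image_iff split: prod.splits) blast+
    also have "\<dots> \<longleftrightarrow> (v, x) \<in> set es \<or> (x, v) \<in> set es"
      by (auto simp: doubleton_eq_iff)
    also have "\<dots> \<longleftrightarrow> hit m"
      unfolding hit_def m_def by (metis in_set_conv_nth)
    finally show ?thesis by simp
  qed
  let ?I = "\<lambda>i s. snd s = M \<and> agree {''y'', ''j'', ''i''} R (fst s) \<and> fst s ''j'' = 4 + 2 * i \<and>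
    fst s ''i'' = m - i \<and> fst s ''y'' = (if hit i then x else v)"
  show ?thesis unfolding look_up_def
  proof (rule reaches_Seq[where t = 5 and u = "11 * m + 1"], rule reaches_straight, goal_cases)
    case 3
    show ?case
    proof (rule reaches_While[where I = ?I and N = m and t = 9], goal_cases)
      case 1
      show ?case using assms(1) by (auto simp: agree_def hit_def v_def m_def fixed_regs_def)
    next
      case (2 i s)
      obtain R' M' where s: "s = (R', M')" by (cases s)
      have M': "M' = M" using 2 s by simp
      have r: "R' ''v'' = v" "R' ''x'' = x" "R' ''j'' = 4 + 2 * i" "R' ''i'' = m - i"
        "R' ''y'' = (if hit i then x else v)" using 2 by (auto simp: s agree_def v_def x_def)
      have Mi: "M (4 + 2 * i) = fst (es ! i)" "M (5 + 2 * i) = snd (es ! i)"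
        using assms(2) 2(1) by (auto simp: stored_edges_def m_def)
      have pair: "es ! i = (a, b) \<longleftrightarrow> fst (es ! i) = a \<and> snd (es ! i) = b" for a b
        by (cases "es ! i") auto
      have ag: "agree {''y'', ''j'', ''i''} R R'" using 2 by (simp add: s)
      let ?C1 = "Cond (Plus (neq (Mem (Reg ''j'')) (Reg ''v'')) (neq (Mem (Plus (Reg ''j'') (Const 1))) (Reg ''x'')))
              Skip (Assign ''y'' (Reg ''x''))"
      let ?C2 = "Cond (Plus (neq (Mem (Reg ''j'')) (Reg ''x'')) (neq (Mem (Plus (Reg ''j'') (Const 1))) (Reg ''v'')))
              Skip (Assign ''y'' (Reg ''x''))"
      let ?rest = "Seq (Assign ''j'' (Plus (Reg ''j'') (Const 2))) (Assign ''i'' (Minus (Reg ''i'') (Const 1)))"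
      let ?body = "Seq ?C1 (Seq ?C2 ?rest)"
      have Mi': "M (Suc (4 + 2 * i)) = snd (es ! i)" using Mi(2) by simp
      have ev: "aval (Plus (neq (Mem (Reg ''j'')) (Reg z1)) (neq (Mem (Plus (Reg ''j'') (Const 1))) (Reg z2))) (R1, M) = 0
          \<longleftrightarrow> es ! i = (R1 z1, R1 z2)" if "R1 ''j'' = 4 + 2 * i" for R1 z1 z2
        unfolding pair aval.simps add_is_0 aval_neq using that Mi(1) Mi' by simp
      have e1: "effect ?C1 (R', M) = (R'(''y'' := if es ! i = (v, x) then x else R' ''y''), M)"
        unfolding effect.simps ev[of R' "''v''" "''x''", OF r(3)] using r(1,2) by auto
      have e2: "effect ?C2 (R'(''y'' := Y), M) = (R'(''y'' := if es ! i = (x, v) then x else Y), M)" for Y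
        using ev[of "R'(''y'' := Y)" "''x''" "''v''"] r(1,2,3) by auto
      have eff: "effect ?body s = (R'(''y'' := if es ! i = (x, v) then x else if es ! i = (v, x) then x else R' ''y'',
          ''j'' := 4 + 2 * i + 2, ''i'' := m - i - 1), M)"
        unfolding s M' effect.simps(3)[of ?C1] e1 effect.simps(3)[of ?C2] e2 using r(3,4) by simp
      have step: "?I (Suc i) (effect ?body s)"
      proof -
        have "agree {''y'', ''j'', ''i''} R (R'(''y'' := Y, ''j'' := J, ''i'' := I))" for Y J I
          using ag by (simp add: agree_def)
        moreover have "(if es ! i = (x, v) then x else if es ! i = (v, x) then x else R' ''y'')
            = (if hit (Suc i) then x else v)" unfolding hit_Suc r(5) by presburger
        ultimately show ?thesis unfolding eff by simp
      qed
      show ?case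
      proof
        show "aval (Reg ''i'') s \<noteq> 0" using r 2(1) s by simp
        show "reaches ?body 9 (?I (Suc i)) s"
        proof (rule reaches_straight)
          show "?I (Suc i) (effect ?body s)" by (rule step)
        qed auto
      qed
    next
      case (3 s)
      obtain R' M' where s: "s = (R', M')" by (cases s)
      have r: "M' = M" "agree {''y'', ''j'', ''i''} R R'" "R' ''i'' = 0" "R' ''y'' = (if hit m then x else v)"
        using 3 by (simp_all add: s)
      have "Q (R', M)" by (rule Q[OF r(2)]) (simp only: r(4) hit_m v_def x_def)
      then show ?case by (simp add: s r)
    qed simp
  qed (use assms(3) in \<open>auto simp: gsize_def m_def\<close>)
qed

lemma reaches_walk:
  assumes "fixed_regs R" "links g M" "R ''v'' = v" "v < n" and gn: "\<And>u. u < n \<Longrightarrow> g u < n"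
    and "30 * gsize \<le> T"
    and Q: "\<And>R'. agree {''c'', ''m'', ''u'', ''i'', ''w'', ''p'', ''q''} R R' \<Longrightarrow>
       (R' ''c'' \<noteq> 0 \<longleftrightarrow> v \<in> orbit g v) \<Longrightarrow>
       (v \<in> orbit g v \<Longrightarrow> R' ''q'' < R' ''p'' \<longleftrightarrow> ok_cycle g (orbit g v)) \<Longrightarrow> Q (R', M)"
  shows "reaches walk T Q (R, M)"
proof -
  have it: "(g ^^ i) v < n" for i using gn assms(4) by (induction i) auto
  let ?Z = "{''c'', ''m'', ''u'', ''i'', ''w'', ''p'', ''q''}"
  define returns where "returns = (\<lambda>i. \<exists>j. 0 < j \<and> j \<le> i \<and> (g ^^ j) v = v)"
  have returns_Suc: "returns (Suc i) \<longleftrightarrow> returns i \<or> (g ^^ Suc i) v = v" for i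
    by (auto simp: returns_def le_Suc_eq)
  let ?I = "\<lambda>i s. snd s = M \<and> agree ?Z R (fst s) \<and> fst s ''u'' = (g ^^ i) v \<and> fst s ''i'' = n - i \<and>
    (fst s ''c'' \<noteq> 0 \<longleftrightarrow> returns i) \<and> (\<forall>j. 0 < j \<and> j \<le> i \<longrightarrow> fst s ''m'' \<le> (g ^^ j) v) \<and>
    (i = 0 \<longrightarrow> fst s ''m'' = n) \<and>
    (0 < i \<longrightarrow> (\<exists>j<i. fst s ''p'' = (g ^^ j) v) \<and> g (fst s ''p'') = fst s ''m'' \<and> fst s ''q'' = g (fst s ''m''))"
  show ?thesis unfolding walk_def
  proof (rule reaches_Seq[where t = 7 and u = "17 * n + 1"], rule reaches_straight, goal_cases)
    case 3
    show ?case
    proof (rule reaches_While[where I = ?I and N = n and t = 15], goal_cases)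
      case 1
      show ?case using assms(1,3) by (auto simp: agree_def returns_def fixed_regs_def)
    next
      case (2 i s)
      obtain R' M' where s: "s = (R', M')" by (cases s)
      define u where "u = (g ^^ i) v"
      have M': "M' = M" using 2 s by simp
      have ag: "agree ?Z R R'" using 2 by (simp add: s)
      have r: "R' ''v'' = v" "R' ''a'' = base" "R' ''u'' = u" "R' ''i'' = n - i" "R' ''c'' \<noteq> 0 \<longleftrightarrow> returns i"
        using 2 assms(1,3) by (auto simp: s agree_def u_def fixed_regs_def)
      have low: "\<And>j. 0 < j \<Longrightarrow> j \<le> i \<Longrightarrow> R' ''m'' \<le> (g ^^ j) v" using 2 by (simp add: s)
      have m0: "i = 0 \<Longrightarrow> R' ''m'' = n" using 2 by (simp add: s)
      have pq: "0 < i \<Longrightarrow> (\<exists>j<i. R' ''p'' = (g ^^ j) v) \<and> g (R' ''p'') = R' ''m'' \<and> R' ''q'' = g (R' ''m'')"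
        using 2 by (simp add: s)
      have un: "u < n" "g u < n" using it gn by (auto simp: u_def)
      have Mu: "M (base + u) = g u" "M (base + g u) = g (g u)" using assms(2) un by (auto simp: links_def)
      have gu: "g u = (g ^^ Suc i) v" by (simp add: u_def)
      let ?body = "Seq (Assign ''w'' (Mem (Plus (Reg ''a'') (Reg ''u''))))
       (Seq (Cond (Minus (Reg ''m'') (Reg ''w''))
              (Seq (Assign ''m'' (Reg ''w'')) (Seq (Assign ''p'' (Reg ''u''))
                (Assign ''q'' (Mem (Plus (Reg ''a'') (Reg ''w''))))))
              Skip)
       (Seq (Cond (neq (Reg ''w'') (Reg ''v'')) Skip (Assign ''c'' (Const 1)))
       (Seq (Assign ''u'' (Reg ''w'')) (Assign ''i'' (Minus (Reg ''i'') (Const 1))))))"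
      define s' where "s' = effect ?body s"
      have snd: "snd s' = M" by (simp add: s'_def s M')
      have ag': "agree ?Z R (fst s')" using ag by (auto simp: s'_def s agree_def)
      have u': "fst s' ''u'' = g u" using r Mu by (simp add: s'_def s M')
      have i': "fst s' ''i'' = n - Suc i" using r by (simp add: s'_def s M')
      have c': "fst s' ''c'' \<noteq> 0 \<longleftrightarrow> returns (Suc i)"
        using r Mu by (simp add: s'_def s M' aval_neq returns_Suc u_def[symmetric])
      have mpq: "(if g u < R' ''m'' then fst s' ''m'' = g u \<and> fst s' ''p'' = u \<and> fst s' ''q'' = g (g u)
        else fst s' ''m'' = R' ''m'' \<and> fst s' ''p'' = R' ''p'' \<and> fst s' ''q'' = R' ''q'')"
        using r Mu by (simp add: s'_def s M')
      have low': "fst s' ''m'' \<le> (g ^^ j) v" if j: "0 < j" "j \<le> Suc i" for j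
      proof (cases "j = Suc i")
        case True
        then show ?thesis using mpq gu by (auto split: if_splits)
      next
        case False
        then have "R' ''m'' \<le> (g ^^ j) v" using low j by simp
        then show ?thesis using mpq by (auto split: if_splits)
      qed
      have pq': "(\<exists>j<Suc i. fst s' ''p'' = (g ^^ j) v) \<and> g (fst s' ''p'') = fst s' ''m'' \<and> fst s' ''q'' = g (fst s' ''m'')"
      proof (cases "g u < R' ''m''")
        case True
        then have "fst s' ''m'' = g u" "fst s' ''p'' = u" "fst s' ''q'' = g (g u)" using mpq by auto
        moreover have "\<exists>j<Suc i. u = (g ^^ j) v" unfolding u_def by blast
        ultimately show ?thesis by simp
      next
        case False
        \<comment> \<open>The initial value \<open>n\<close> of \<open>m\<close> exceeds every
          vertex, so the first round always records one.\<close>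
        then have "i \<noteq> 0" using m0 un by auto
        then have "(\<exists>j<i. R' ''p'' = (g ^^ j) v) \<and> g (R' ''p'') = R' ''m'' \<and> R' ''q'' = g (R' ''m'')"
          using pq by simp
        moreover have "fst s' ''m'' = R' ''m''" "fst s' ''p'' = R' ''p''" "fst s' ''q'' = R' ''q''"
          using mpq False by auto
        ultimately show ?thesis by (metis less_SucI)
      qed
      show ?case
      proof
        show "aval (Reg ''i'') s \<noteq> 0" using r 2(1) s by simp
        show "reaches ?body 15 (?I (Suc i)) s"
        proof (rule reaches_straight)
          show "?I (Suc i) (effect ?body s)"
            unfolding s'_def[symmetric] using snd ag' u' i' c' low' pq' gu by simp
        qed auto
      qed
    next
      case (3 s)
      obtain R' M' where s: "s = (R', M')" by (cases s)
      have M': "M' = M" using 3 s by simp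
      have r: "R' ''i'' = 0" "R' ''c'' \<noteq> 0 \<longleftrightarrow> returns n" using 3 by (auto simp: s)
      have low: "\<And>j. 0 < j \<Longrightarrow> j \<le> n \<Longrightarrow> R' ''m'' \<le> (g ^^ j) v" using 3 by (simp add: s)
      have pq: "(\<exists>j<n. R' ''p'' = (g ^^ j) v) \<and> g (R' ''p'') = R' ''m'' \<and> R' ''q'' = g (R' ''m'')"
        using 3 n_pos by (simp add: s)
      \<comment> \<open>The vertices of one period are distinct and below \<open>n\<close>, so
        \<open>n\<close> rounds go all the way around.\<close>
      have per: "\<exists>d. 0 < d \<and> d \<le> n \<and> (g ^^ d) v = v" if o: "v \<in> orbit g v"
      proof -
        let ?d = "funpow_dist1 g v v"
        have "(\<lambda>i. (g ^^ i) v) ` {0..<?d} \<subseteq> {..<n}" using it by blast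
        then have "card {0..<?d} \<le> card {..<n}"
          by (rule card_inj_on_le[OF inj_on_funpow_dist1[OF o]]) simp
        then have "?d \<le> n" by simp
        moreover have "(g ^^ ?d) v = v" by (rule funpow_dist1_prop[OF o])
        ultimately show ?thesis by blast
      qed
      have "returns n \<longleftrightarrow> v \<in> orbit g v"
      proof
        assume "returns n"
        then obtain j where "0 < j" "(g ^^ j) v = v" by (auto simp: returns_def)
        then show "v \<in> orbit g v" unfolding orbit_altdef by (metis (mono_tags, lifting) mem_Collect_eq)
      qed (use per in \<open>auto simp: returns_def\<close>)
      moreover have "R' ''q'' < R' ''p'' \<longleftrightarrow> ok_cycle g (orbit g v)" if o: "v \<in> orbit g v"
      proof -
        obtain d where d: "0 < d" "d \<le> n" "(g ^^ d) v = v" using per[OF o] by blast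
        let ?S = "orbit g v"
        have cyc: "cyclic_on g ?S" by (rule cyclic_on_self_orbit[OF o])
        have pS: "R' ''p'' \<in> ?S" using pq cyclic_on_funpow_in[OF cyc o] by auto
        have mS: "R' ''m'' \<in> ?S" using pq cyclic_on_inI[OF cyc pS] by simp
        have "Min ?S = R' ''m''"
        proof (rule Min_eqI)
          show "finite ?S" by (rule finite_cyclic_on[OF cyc])
          show "R' ''m'' \<in> ?S" by (rule mS)
          fix y assume "y \<in> ?S"
          then obtain k where k: "k < d" "y = (g ^^ k) v"
            using orbit_altdef_bounded[OF d(3,1)] by auto
          show "R' ''m'' \<le> y"
          proof (cases "k = 0")
            case True then show ?thesis using low[of d] d k by simp
          next
            case False then show ?thesis using low[of k] d k by simp
          qed
        qed
        then have "ok_cycle g ?S \<longleftrightarrow> (\<exists>p\<in>?S. g p = R' ''m'' \<and> g (R' ''m'') < p)"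
          by (simp add: ok_cycle_def)
        also have "\<dots> \<longleftrightarrow> R' ''q'' < R' ''p''"
          using pq pS cyclic_on_inj_on[OF cyc] by (metis inj_on_def)
        finally show ?thesis by simp
      qed
      ultimately have "Q (R', M)" by (intro Q) (use 3 r in \<open>auto simp: s\<close>)
      then show ?case using r M' by (simp add: s)
    qed simp
  qed (use assms(6) in \<open>auto simp: gsize_def\<close>)
qed

lemma reaches_unlink:
  assumes "fixed_regs R" "links g M" "R ''v'' = v" "v < n" and gn: "\<And>u. u < n \<Longrightarrow> g u < n"
    and o: "v \<in> orbit g v" and "10 * gsize \<le> T"
    and Q: "\<And>R' M'. agree {''u'', ''w''} R R' \<Longrightarrow> links (glue (orbit g v) id g) M' \<Longrightarrow>
       (\<And>z. z < base \<or> base + n \<le> z \<Longrightarrow> M' z = M z) \<Longrightarrow> Q (R', M')"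
  shows "reaches unlink T Q (R, M)"
proof -
  have it: "(g ^^ i) v < n" for i using gn assms(4) by (induction i) auto
  define d where "d = funpow_dist1 g v v"
  have d0: "0 < d" by (simp add: d_def)
  have dv: "(g ^^ d) v = v" unfolding d_def by (rule funpow_dist1_prop[OF o])
  have inj: "inj_on (\<lambda>i. (g ^^ i) v) {0..<d}" unfolding d_def by (rule inj_on_funpow_dist1[OF o])
  have S: "orbit g v = (\<lambda>i. (g ^^ i) v) ` {0..<d}" unfolding d_def by (rule orbit_conv_funpow_dist1[OF o])
  have cyc: "cyclic_on g (orbit g v)" by (rule cyclic_on_self_orbit[OF o])
  have "(\<lambda>i. (g ^^ i) v) ` {0..<d} \<subseteq> {..<n}" using it by blast
  then have "card {0..<d} \<le> card {..<n}" by (rule card_inj_on_le[OF inj]) simp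
  then have dn: "d \<le> n" by simp
  \<comment> \<open>For a loop at \<open>v\<close> the guard fails at once.\<close>
  define N where "N = (if g v = v then 0 else d)"
  have Nd: "N \<le> d" "N \<le> n" using dn by (auto simp: N_def)
  define f where "f = (\<lambda>i. glue ((\<lambda>j. (g ^^ j) v) ` {0..<i}) id g)"
  let ?I = "\<lambda>i s. agree {''u'', ''w''} R (fst s) \<and> fst s ''u'' = (g ^^ i) v \<and> links (f i) (snd s) \<and>
     (\<forall>z. z < base \<or> base + n \<le> z \<longrightarrow> snd s z = M z)"
  let ?guard = "neq (Mem (Plus (Reg ''a'') (Reg ''u''))) (Reg ''u'')"
  let ?body = "Seq (Assign ''w'' (Mem (Plus (Reg ''a'') (Reg ''u''))))
       (Seq (Store (Plus (Reg ''a'') (Reg ''u'')) (Reg ''u'')) (Assign ''u'' (Reg ''w'')))"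
  have a: "fst s ''a'' = base" if "?I i s" for i s
    using that assms(1) by (simp add: agree_def fixed_regs_def)
  have mem: "snd s (base + (g ^^ i) v) = f i ((g ^^ i) v)" if "?I i s" for i s
    using that it[of i] by (simp add: links_def)
  have gd: "aval ?guard s = 0 \<longleftrightarrow> f i ((g ^^ i) v) = (g ^^ i) v" if "?I i s" for i s
    unfolding aval_neq using a[OF that] mem[OF that] that by simp
  show ?thesis unfolding unlink_def
  proof (rule reaches_Seq[where t = 1 and u = "7 * n + 1"], rule reaches_straight)
    show "reaches (While ?guard ?body) (7 * n + 1) Q (effect (Assign ''u'' (Reg ''v'')) (R, M))"
    proof (rule reaches_While[where I = ?I and N = N and t = 5])
      show "?I 0 (effect (Assign ''u'' (Reg ''v'')) (R, M))"
        using assms(2,3) by (auto simp: agree_def f_def glue_def)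
    next
      fix i s assume i: "i < N" and I: "?I i s"
      obtain R' M' where s: "s = (R', M')" by (cases s)
      define u where "u = (g ^^ i) v"
      have "g v \<noteq> v" "N = d" using i by (auto simp: N_def split: if_splits)
      have un: "u < n" using it by (simp add: u_def)
      have uS: "u \<in> orbit g v" using i \<open>N = d\<close> unfolding S u_def by auto
      have unew: "u \<notin> (\<lambda>j. (g ^^ j) v) ` {0..<i}"
      proof
        assume "u \<in> (\<lambda>j. (g ^^ j) v) ` {0..<i}"
        then obtain j where "j < i" "(g ^^ i) v = (g ^^ j) v" by (auto simp: u_def)
        then show False using inj_onD[OF inj, of i j] i \<open>N = d\<close> by auto
      qed
      then have fu: "f i u = g u" by (simp add: f_def glue_def)
      have gu: "g u \<noteq> u"
      proof
        assume "g u = u"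
        then have "orbit g u = {u}" by (simp add: orbit_eq_singleton_iff)
        moreover have "orbit g u = orbit g v" by (rule orbit_cyclic_eq3[OF cyc uS])
        ultimately have "u = v" using o by auto
        then show False using \<open>g u = u\<close> \<open>g v \<noteq> v\<close> by simp
      qed
      have Mu: "M' (base + u) = g u" using mem[OF I] fu by (simp add: u_def s)
      have R': "R' ''a'' = base" "R' ''u'' = u" using a[OF I] I by (auto simp: s u_def)
      have fS: "f (Suc i) = (f i)(u := u)"
        by (auto simp: f_def glue_def u_def fun_eq_iff less_Suc_eq)
      show "aval ?guard s \<noteq> 0 \<and> reaches ?body 5 (?I (Suc i)) s"
      proof
        show "aval ?guard s \<noteq> 0" using gd[OF I] fu gu by (simp add: u_def)
        have "effect ?body s = (R'(''w'' := g u, ''u'' := g u), M'(base + u := u))"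
          using R' Mu by (simp add: s)
        moreover have "?I (Suc i) (R'(''w'' := g u, ''u'' := g u), M'(base + u := u))"
          using I un by (auto simp: s agree_def links_def fS u_def)
        ultimately show "reaches ?body 5 (?I (Suc i)) s" by (intro reaches_straight) auto
      qed
    next
      fix s assume I: "?I N s"
      have orb: "f N = glue (orbit g v) id g" and fix_v: "f N ((g ^^ N) v) = (g ^^ N) v"
      proof -
        show "f N = glue (orbit g v) id g"
        proof (cases "g v = v")
          case True
          then have "orbit g v = {v}" by (simp add: orbit_eq_singleton_iff)
          then show ?thesis using True by (auto simp: f_def N_def glue_def)
        qed (simp add: f_def N_def S)
        have "(g ^^ N) v = v" using dv by (simp add: N_def)
        then show "f N ((g ^^ N) v) = (g ^^ N) v"
          using o by (simp add: \<open>f N = glue (orbit g v) id g\<close> glue_def)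
      qed
      have "Q (fst s, snd s)" by (rule Q) (use I orb in auto)
      then show "aval ?guard s = 0 \<and> Q s" using gd[OF I] fix_v by simp
    qed (use Nd in simp)
  qed (use assms(7) in \<open>auto simp: gsize_def\<close>)
qed

lemma reaches_reset:
  assumes "R ''n'' = n" "R ''a'' = base" "10 * gsize \<le> T"
    and Q: "\<And>R' M'. agree {''u''} R R' \<Longrightarrow> links id M' \<Longrightarrow>
       (\<And>z. z < base \<or> base + n < z \<Longrightarrow> M' z = M z) \<Longrightarrow> Q (R', M')"
  shows "reaches reset T Q (R, M)"
proof -
  let ?I = "\<lambda>i s. agree {''u''} R (fst s) \<and> fst s ''u'' = i \<and> (\<forall>u<i. snd s (base + u) = u) \<and>
     (\<forall>z. z < base \<or> base + n < z \<longrightarrow> snd s z = M z)"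
  let ?guard = "Minus (Plus (Reg ''n'') (Const 1)) (Reg ''u'')"
  let ?body = "Seq (Store (Plus (Reg ''a'') (Reg ''u'')) (Reg ''u'')) (Assign ''u'' (Plus (Reg ''u'') (Const 1)))"
  show ?thesis unfolding reset_def
  proof (rule reaches_Seq[where t = 1 and u = "5 * (n + 1) + 1"], rule reaches_straight)
    show "reaches (While ?guard ?body) (5 * (n + 1) + 1) Q (effect (Assign ''u'' (Const 0)) (R, M))"
    proof (rule reaches_While[where I = ?I and N = "n + 1" and t = 3])
      show "?I 0 (effect (Assign ''u'' (Const 0)) (R, M))" by (simp add: agree_def)
    next
      fix i s assume i: "i < n + 1" and I: "?I i s"
      obtain R' M' where s: "s = (R', M')" by (cases s)
      have r: "R' ''n'' = n" "R' ''a'' = base" "R' ''u'' = i" using I assms by (auto simp: s agree_def)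
      have "effect ?body s = (R'(''u'' := i + 1), M'(base + i := i))" using r by (simp add: s)
      moreover have "?I (Suc i) (R'(''u'' := i + 1), M'(base + i := i))"
        using I i by (auto simp: s agree_def less_Suc_eq)
      ultimately show "aval ?guard s \<noteq> 0 \<and> reaches ?body 3 (?I (Suc i)) s"
        using r i by (intro conjI reaches_straight) (auto simp: s)
    next
      fix s assume I: "?I (n + 1) s"
      have "Q (fst s, snd s)" by (rule Q) (use I in \<open>auto simp: links_def\<close>)
      moreover have "fst s ''n'' = n" using I assms by (simp add: agree_def)
      ultimately show "aval ?guard s = 0 \<and> Q s" using I by simp
    qed simp
  qed (use assms(3) in \<open>auto simp: gsize_def\<close>)
qed

end

section \<open>The main loop\<close>

text \<open>\<open>P\<close> speaks of the law of the final state; it will be a coupling by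
  \<open>rel_pmf\<close> with the law of the abstract chain.\<close>

definition terminates :: "com \<Rightarrow> nat \<Rightarrow> (state pmf \<Rightarrow> bool) \<Rightarrow> state \<Rightarrow> bool" where
  "terminates c t P s \<longleftrightarrow> (\<exists>M. exec c s t M \<and> P M)"

lemma terminates_reaches:
  assumes "reaches c t Q s" "\<And>s'. Q s' \<Longrightarrow> P (return_pmf s')"
  shows "terminates c t P s" using assms unfolding terminates_def reaches_def by blast

lemma terminates_Seq_reaches:
  assumes "reaches c t (\<lambda>s'. terminates d u P s') s" "t + u + 1 \<le> T"
  shows "terminates (Seq c d) T P s"
proof -
  obtain s' where s': "exec c s t (return_pmf s')" "terminates d u P s'" using assms(1) unfolding reaches_def by blast
  then obtain M where M: "exec d s' u M" "P M" unfolding terminates_def by blast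
  have "exec (Seq c d) s (t + u + 1) (bind_pmf (return_pmf s') (\<lambda>_. M))"
    by (rule exec_Seq[OF s'(1)]) (use M(1) in simp)
  then have "exec (Seq c d) s T M" using exec_mono[OF _ assms(2)] by (simp add: bind_return_pmf)
  then show ?thesis using M(2) unfolding terminates_def by blast
qed

lemma terminates_step:
  assumes "step (c, s) = return_pmf (c', s')" "terminates c' t P s'" "Suc t \<le> T"
  shows "terminates c T P s" using assms exec_step exec_mono unfolding terminates_def by blast

lemma terminates_Cond:
  assumes "aval a s \<noteq> 0 \<Longrightarrow> terminates c t P s" "aval a s = 0 \<Longrightarrow> terminates d t P s" "Suc t \<le> T"
  shows "terminates (Cond a c d) T P s"
  by (rule terminates_step[of _ _ "if aval a s \<noteq> 0 then c else d" s t]) (use assms in auto)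

lemma terminates_Seq:
  assumes M: "terminates c t (\<lambda>M. rel_pmf rel M q) s"
    and d: "\<And>s' a. rel s' a \<Longrightarrow> terminates d u (\<lambda>M. rel_pmf rel' M (f a)) s'"
    and "t + u + 1 \<le> T"
  shows "terminates (Seq c d) T (\<lambda>M. rel_pmf rel' M (bind_pmf q f)) s"
proof -
  obtain M where M: "exec c s t M" "rel_pmf rel M q" using assms(1) unfolding terminates_def by blast
  \<comment> \<open>The final law is determined by \<open>s'\<close> alone, so one kernel
    \<open>N\<close> serves every \<open>a\<close> related to \<open>s'\<close>.\<close>
  define N where "N = (\<lambda>s'. map_pmf snd (run u (d, s')))"
  have N: "exec d s' u (N s') \<and> rel_pmf rel' (N s') (f a)" if r: "rel s' a" for s' a
  proof -
    obtain M' where M': "exec d s' u M'" "rel_pmf rel' M' (f a)"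
      using d[OF r] unfolding terminates_def by blast
    then have "M' = N s'" by (simp add: N_def exec_def pmf.map_comp o_def)
    then show ?thesis using M' by simp
  qed
  have "exec (Seq c d) s (t + u + 1) (bind_pmf M N)"
  proof (rule exec_Seq[OF M(1)])
    fix s' assume "s' \<in> set_pmf M"
    then obtain a where "rel s' a" using rel_pmf_imp_rel_set[OF M(2)] by (auto simp: rel_set_def)
    then show "exec d s' u (N s')" using N by blast
  qed
  moreover have "rel_pmf rel' (bind_pmf M N) (bind_pmf q f)"
    by (rule rel_pmf_bindI[OF M(2)]) (use N in blast)
  ultimately show ?thesis using exec_mono[OF _ assms(3)] unfolding terminates_def by blast
qed

lemma terminates_Draw:
  "terminates (Draw x a) 1
    (\<lambda>M. rel_pmf (\<lambda>s' k. k \<le> aval a s \<and> s' = ((fst s)(x := k), snd s)) M (pmf_of_set {0..aval a s})) s"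
  unfolding terminates_def
proof (intro exI conjI)
  show "exec (Draw x a) s 1 (map_pmf (\<lambda>k. ((fst s)(x := k), snd s)) (pmf_of_set {0..aval a s}))"
    by (rule exec_Draw)
  show "rel_pmf (\<lambda>s' k. k \<le> aval a s \<and> s' = ((fst s)(x := k), snd s))
     (map_pmf (\<lambda>k. ((fst s)(x := k), snd s)) (pmf_of_set {0..aval a s})) (pmf_of_set {0..aval a s})"
    unfolding pmf.rel_map by (rule rel_pmf_reflI) auto
qed

text \<open>Adds 1 to \<open>h\<close> if \<open>h \<le> v\<close>, and 0 otherwise.\<close>

definition accept :: com where
  "accept = Assign ''h'' (Plus (Reg ''h'') (Minus (Const 1) (Minus (Reg ''h'') (Reg ''v''))))"

text \<open>The counter increases before acceptance is decided, since rejected draws count as well.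
  The increment is 1 for \<open>v = h\<close> and 0 for \<open>v < h\<close>, by truncated
  subtraction.\<close>

definition record_draw :: com where
  "record_draw = Seq (Store (Plus (Reg ''a'') (Reg ''v'')) (Reg ''y''))
     (Store (Plus (Reg ''b'') (Reg ''v''))
       (Plus (Mem (Plus (Reg ''b'') (Reg ''v''))) (Minus (Const 1) (Minus (Reg ''h'') (Reg ''v'')))))"

text \<open>A drawn non-neighbour shows up as a loop with \<open>p = q = v\<close>; it takes the
  branch \<open>unlink\<close>, which leaves the links as they are.\<close>

definition after_draw :: com where
  "after_draw = Seq look_up (Seq record_draw (Seq walk
     (Cond (Reg ''c'') (Cond (Minus (Reg ''p'') (Reg ''q'')) accept unlink) accept)))"

definition end_run :: com where
  "end_run = Seq (Seq (Assign ''r'' (Minus (Reg ''r'') (Const 1))) (Assign ''h'' (Const 0))) reset"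

text \<open>Once no runs are left, an iteration only decrements the counter. The number of
  iterations is thus fixed in advance, and the time bound holds on every execution.\<close>

definition iteration :: com where
  "iteration = Seq (Assign ''l'' (Minus (Reg ''l'') (Const 1)))
     (Cond (Reg ''r'')
       (Seq scan (Cond (Minus (Reg ''n'') (Reg ''v''))
         (Seq (Draw ''x'' (Minus (Reg ''n'') (Const 1))) after_draw) end_run))
       Skip)"

text \<open>\<open>k\<close> is the ceiling of \<open>q / p = 1 / \<epsilon>\<close>, found by
  adding \<open>p\<close> until \<open>q\<close> is reached; then \<open>s\<close> becomes
  \<open>64 * n * k ^ 2\<close> and \<open>l\<close> becomes \<open>64 * n ^ 3 * s\<close>.\<close>

definition initialise :: com where
  "initialise = Seq (Seq (Assign ''n'' (Mem (Const 2))) (Seq (Assign ''e'' (Mem (Const 3)))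
       (Seq (Assign ''k'' (Const 0)) (Assign ''w'' (Const 0)))))
     (Seq (While (Minus (Mem (Const 1)) (Reg ''w''))
       (Seq (Assign ''w'' (Plus (Reg ''w'') (Mem (Const 0)))) (Assign ''k'' (Plus (Reg ''k'') (Const 1)))))
     (Seq (Assign ''s'' (Const 64)) (Seq (mul ''s'' ''n'') (Seq (mul ''s'' ''k'') (Seq (mul ''s'' ''k'')
     (Seq (Assign ''l'' (Const 64)) (Seq (mul ''l'' ''n'') (Seq (mul ''l'' ''n'') (Seq (mul ''l'' ''n'')
     (Seq (mul ''l'' ''s'')
     (Seq (Seq (Assign ''a'' (Plus (Const 4) (Plus (Reg ''e'') (Reg ''e''))))
          (Seq (Assign ''b'' (Plus (Plus (Reg ''a'') (Reg ''n'')) (Const 1))) (Assign ''r'' (Reg ''s''))))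
       reset)))))))))))"

text \<open>The count is the product of \<open>n * accept_prob i\<close>, and
  \<open>s / tot i\<close> estimates \<open>accept_prob i\<close>; this gives the numerator
  \<open>(n * s) ^ n\<close> and the product of the counters as denominator.\<close>

definition finalise :: com where
  "finalise = Seq (Assign ''w'' (Reg ''s'')) (Seq (mul ''w'' ''n'')
     (Seq (Seq (Assign ''x'' (Const 1)) (Seq (Assign ''y'' (Const 1)) (Assign ''v'' (Const 0))))
     (Seq (While (Minus (Reg ''n'') (Reg ''v''))
       (Seq (mul ''x'' ''w'') (Seq (Assign ''q'' (Mem (Plus (Reg ''b'') (Reg ''v''))))
         (Seq (mul ''y'' ''q'') (Assign ''v'' (Plus (Reg ''v'') (Const 1)))))))
     (Seq (Store (Const 0) (Reg ''x'')) (Store (Const 1) (Reg ''y''))))))"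

definition approx_count :: com where
  "approx_count = Seq initialise (Seq (While (Reg ''l'') iteration) finalise)"

section \<open>Simulation of the chain by the program\<close>

context encoded_graph
begin

definition linked :: "(nat \<Rightarrow> nat) \<Rightarrow> nat \<Rightarrow> bool" where
  "linked f h \<longleftrightarrow> (\<forall>u. f u \<noteq> u \<longrightarrow> {u, f u} \<in> E \<and> u < h) \<and> h \<le> n"

text \<open>The condition \<open>tot u + j \<le> B\<close> bounds each counter by the number of
  iterations made. At the end it limits the cost of multiplying by the counters.\<close>

definition represents :: "nat \<Rightarrow> nat \<Rightarrow> nat \<Rightarrow> state \<Rightarrow> chain_state \<Rightarrow> bool" where
  "represents B s j = (\<lambda>(R, M) (f, h, r, tot). fixed_regs R \<and> stored_edges M \<and> links f M \<and>
     (\<forall>u<n. M (tots + u) = tot u \<and> tot u + j \<le> B) \<and> linked f h \<and>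
     R ''h'' = h \<and> R ''r'' = r \<and> R ''s'' = s \<and> R ''l'' = j)"

lemma linked_lt: "linked f h \<Longrightarrow> u < n \<Longrightarrow> f u < n"
  using edgeD(2)[of u "f u"] by (cases "f u = u") (auto simp: linked_def)

lemma linked_fix: "linked f h \<Longrightarrow> h \<le> u \<Longrightarrow> f u = u"
  by (metis leD linked_def)

lemma stored_edges_cong: "stored_edges M \<Longrightarrow> (\<And>z. z < base \<Longrightarrow> M' z = M z) \<Longrightarrow> stored_edges M'"
  by (simp add: stored_edges_def base_def)

text \<open>The loop counter has already been decremented at this point; the hypothesis on
  \<open>represents\<close> restores it.\<close>

lemma reaches_after_draw:
  assumes rep: "represents B s (Suc j) (R(''l'' := Suc j), M) (f, h, r, tot)" and "R ''l'' = j" "0 < r"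
    and v: "R ''v'' = v" "v = (LEAST v. f v = v)" "v < n" and x: "R ''x'' = x" "x < n"
    and T: "100 * gsize \<le> T"
  shows "reaches after_draw T (\<lambda>s'. represents B s j s' (trial x (f, h, r, tot))) (R, M)"
proof -
  let ?agree = "agree {''y'', ''j'', ''i'', ''c'', ''m'', ''u'', ''w'', ''p'', ''q''} R"
  let ?d = "Cond (Reg ''c'') (Cond (Minus (Reg ''p'') (Reg ''q'')) accept unlink) accept"
  let ?Q = "(\<lambda>s'. represents B s j s' (trial x (f, h, r, tot)))"
  have R: "fixed_regs R" "R ''h'' = h" "R ''r'' = r" "R ''s'' = s" and M: "stored_edges M" "links f M"
    and tot: "\<And>u. u < n \<Longrightarrow> M (tots + u) = tot u \<and> tot u + Suc j \<le> B" and lin: "linked f h"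
    using rep by (auto simp: represents_def fixed_regs_def)
  \<comment> \<open>\<open>h\<close> itself is inactive. Given \<open>v \<le> h\<close>, the
    expression \<open>1 - (h - v)\<close> is the indicator of \<open>v = h\<close>.\<close>
  have vh: "v \<le> h" unfolding v(2) by (rule Least_le) (rule linked_fix[OF lin order_refl])
  have fv: "f v = v" unfolding v(2) by (rule LeastI) (rule linked_fix[OF lin order_refl])
  define y where "y = (if {v, x} \<in> E then x else v)"
  define g where "g = f(v := y)"
  define M2 where "M2 = M(base + v := y, tots + v := tot v + (1 - (h - v)))"
  define tot' where "tot' = (if v = h then tot(v := Suc (tot v)) else tot)"
  have size: "1 \<le> gsize" by (simp add: gsize_def)
  have yn: "y < n" using v(3) x(2) by (simp add: y_def)
  have gn: "g u < n" if "u < n" for u using linked_lt[OF lin that] yn by (simp add: g_def)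
  have g: "links g M2" using M(2) v(3) by (auto simp: links_def M2_def g_def tots_def)
  have base_M2: "M2 z = M z" if "z < base" for z using that by (simp add: M2_def tots_def)
  have tot2: "M2 (tots + u) = tot' u \<and> tot' u + j \<le> B" if "u < n" for u
    using tot[OF that] vh v(3) by (auto simp: M2_def tots_def base_def tot'_def)
  have tr: "trial x (f, h, r, tot) =
     (pop_cycle v g, if v = h \<and> pop_cycle v g v \<noteq> v then Suc h else h, r, tot')"
    using v(3) assms(3)
    by (simp add: trial_def v(2)[symmetric] Let_def tot'_def g_def y_def draw_step_def)
  have popped: "represents B s j (R', M') (trial x (f, h, r, tot))"
    if bad: "v \<in> orbit g v" "\<not> ok_cycle g (orbit g v)"
      and R': "?agree R'"
      and M': "links (glue (orbit g v) id g) M'" "\<And>z. z < base \<or> base + n \<le> z \<Longrightarrow> M' z = M2 z" for R' M'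
  proof -
    have p: "pop_cycle v g = glue (orbit g v) id g" using bad by (simp add: pop_cycle_def)
    have pv: "pop_cycle v g v = v" using bad by (simp add: p glue_def)
    have "linked (pop_cycle v g) h" using lin unfolding linked_def p
    proof (intro conjI allI impI)
      fix u assume l: "(\<forall>u. f u \<noteq> u \<longrightarrow> {u, f u} \<in> E \<and> u < h) \<and> h \<le> n"
        and u: "glue (orbit g v) id g u \<noteq> u"
      then have "u \<notin> orbit g v" "u \<noteq> v" using bad(1) by (auto simp: glue_def)
      then have "glue (orbit g v) id g u = f u" by (simp add: glue_def g_def)
      then show "{u, glue (orbit g v) id g u} \<in> E" "u < h" using l u by auto
    qed auto
    moreover have "stored_edges M'" using M(1) by (rule stored_edges_cong) (use M'(2) base_M2 in auto)
    moreover have "fixed_regs R'" "R' ''h'' = h" "R' ''r'' = r" "R' ''s'' = s" "R' ''l'' = j"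
      using R R' assms(2) by (auto simp: fixed_regs_def agree_def)
    moreover have "M' (tots + u) = tot' u \<and> tot' u + j \<le> B" if "u < n" for u
      using tot2[OF that] M'(2)[of "tots + u"] by (simp add: tots_def)
    ultimately show ?thesis unfolding tr using M'(1) pv by (simp add: represents_def p)
  qed
  have accepted: "represents B s j (R'(''h'' := h + (1 - (h - v))), M2) (trial x (f, h, r, tot))"
    if good: "\<not> (v \<in> orbit g v \<and> \<not> ok_cycle g (orbit g v))"
      and R': "?agree R'" for R'
  proof -
    have p: "pop_cycle v g = g" unfolding pop_cycle_def using good by (rule if_not_P)
    have gv: "g v \<noteq> v"
    proof
      assume "g v = v"
      then have "orbit g v = {v}" by (simp add: orbit_eq_singleton_iff)
      moreover have "\<not> ok_cycle g {v}" using \<open>g v = v\<close> by (simp add: ok_cycle_def)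
      ultimately show False using good by simp
    qed
    then have e: "{v, x} \<in> E" "y = x" by (auto simp: g_def y_def split: if_splits)
    define h' where "h' = (if v = h then Suc h else h)"
    have h': "h + (1 - (h - v)) = h'" using vh by (auto simp: h'_def)
    have "linked g h'" using lin e vh v(3) unfolding linked_def h'_def g_def by auto
    moreover have "stored_edges M2" using M(1) by (rule stored_edges_cong) (rule base_M2)
    moreover have "fixed_regs (R'(''h'' := h'))" "(R'(''h'' := h')) ''r'' = r" "(R'(''h'' := h')) ''s'' = s"
      "(R'(''h'' := h')) ''l'' = j" using R R' assms(2) by (auto simp: fixed_regs_def agree_def)
    ultimately show ?thesis unfolding tr h' p using g tot2 gv by (simp add: represents_def h'_def)
  qed
  show ?thesis unfolding after_draw_def
  proof (rule reaches_Seq[where t = "20 * gsize" and u = "60 * gsize"], rule reaches_look_up[OF R(1) M(1)])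
    fix R1 assume R1: "agree {''y'', ''j'', ''i''} R R1" "R1 ''y'' = (if {R ''v'', R ''x''} \<in> E then R ''x'' else R ''v'')"
    have eff: "effect record_draw (R1, M) = (R1, M2)"
    proof -
      have "R1 ''a'' = base" "R1 ''b'' = tots" "R1 ''v'' = v" "R1 ''h'' = h" "R1 ''y'' = y"
        using R1 R v x by (simp_all add: agree_def fixed_regs_def y_def)
      moreover have "tots + v \<noteq> base + v" by (simp add: tots_def)
      ultimately show ?thesis using tot[OF v(3)] by (simp add: record_draw_def M2_def)
    qed
    show "reaches (Seq record_draw (Seq walk ?d))
      (60 * gsize) ?Q (R1, M)"
    proof (rule reaches_Seq[where t = 3 and u = "50 * gsize"], rule reaches_straight, goal_cases)
      case 3
      show ?case unfolding eff
      proof (rule reaches_Seq[where t = "30 * gsize" and u = "15 * gsize"], rule reaches_walk[where g = g and v = v])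
        fix R2 assume R2: "agree {''c'', ''m'', ''u'', ''i'', ''w'', ''p'', ''q''} R1 R2"
          "(R2 ''c'' \<noteq> 0) = (v \<in> orbit g v)"
          "v \<in> orbit g v \<Longrightarrow> (R2 ''q'' < R2 ''p'') = ok_cycle g (orbit g v)"
        have ag: "?agree R2" using R1(1) R2(1) by (simp add: agree_def)
        have acc: "reaches accept t ?Q (R2, M2)"
          if "\<not> (v \<in> orbit g v \<and> \<not> ok_cycle g (orbit g v))" "1 \<le> t" for t
        proof (rule reaches_straight)
          have "effect accept (R2, M2) = (R2(''h'' := h + (1 - (h - v))), M2)"
            using ag R v by (simp add: accept_def agree_def)
          then show "represents B s j (effect accept (R2, M2)) (trial x (f, h, r, tot))"
            using accepted[OF that(1) ag] by simp
        qed (use that in \<open>auto simp: accept_def\<close>)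
        show "reaches ?d (15 * gsize)
          ?Q (R2, M2)"
        proof (rule reaches_Cond[where t = "12 * gsize"])
          assume "aval (Reg ''c'') (R2, M2) \<noteq> 0"
          then have o: "v \<in> orbit g v" using R2(2) by simp
          show "reaches (Cond (Minus (Reg ''p'') (Reg ''q'')) accept unlink) (12 * gsize)
            ?Q (R2, M2)"
          proof (rule reaches_Cond[where t = "10 * gsize"])
            assume "aval (Minus (Reg ''p'') (Reg ''q'')) (R2, M2) \<noteq> 0"
            then show "reaches accept (10 * gsize) ?Q (R2, M2)"
              using R2(3)[OF o] size by (intro acc) auto
          next
            assume "aval (Minus (Reg ''p'') (Reg ''q'')) (R2, M2) = 0"
            then have no: "\<not> ok_cycle g (orbit g v)" using R2(3)[OF o] by auto
            show "reaches unlink (10 * gsize) ?Q (R2, M2)"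
            proof (rule reaches_unlink[OF _ g _ v(3) gn o])
              show "fixed_regs R2" using ag R(1) by (simp add: agree_def fixed_regs_def)
              show "R2 ''v'' = v" using ag v(1) by (simp add: agree_def)
              fix R' M' assume R': "agree {''u'', ''w''} R2 R'" and M': "links (glue (orbit g v) id g) M'"
                "\<And>z. z < base \<or> base + n \<le> z \<Longrightarrow> M' z = M2 z"
              have "?agree R'" using ag R' by (simp add: agree_def)
              then show "represents B s j (R', M') (trial x (f, h, r, tot))"
                using popped[OF o no _ M'] by blast
            qed auto
          qed (use size in auto)
        next
          assume "aval (Reg ''c'') (R2, M2) = 0"
          then show "reaches accept (12 * gsize) ?Q (R2, M2)" using R2(2) size by (intro acc) auto
        qed (use size in auto)
      next
        show "fixed_regs R1" using R1(1) R(1) by (simp add: agree_def fixed_regs_def)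
        show "R1 ''v'' = v" using R1(1) v(1) by (simp add: agree_def)
      qed (use g v(3) gn size in auto)
    qed (use size in \<open>auto simp: record_draw_def\<close>)
  qed (use T size in auto)
qed

lemma terminates_iteration:
  assumes rep: "represents B s (Suc j) st a"
  shows "terminates iteration (200 * gsize)
    (\<lambda>M. rel_pmf (represents B s j) M (map_pmf (\<lambda>x. trial x a) (pmf_of_set {..<n}))) st"
proof -
  let ?l = "Assign ''l'' (Minus (Reg ''l'') (Const 1))"
  let ?x = "Draw ''x'' (Minus (Reg ''n'') (Const 1))"
  let ?g = "Minus (Reg ''n'') (Reg ''v'')"
  obtain R M where st: "st = (R, M)" by (cases st)
  obtain f h r tot where a: "a = (f, h, r, tot)" by (metis prod_cases4)
  let ?P = "\<lambda>M. rel_pmf (represents B s j) M (map_pmf (\<lambda>x. trial x a) (pmf_of_set {..<n}))"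
  have R: "fixed_regs R" "R ''h'' = h" "R ''r'' = r" "R ''s'' = s" "R ''l'' = Suc j" and M: "stored_edges M" "links f M"
    and tot: "\<And>u. u < n \<Longrightarrow> M (tots + u) = tot u \<and> tot u + Suc j \<le> B" and lin: "linked f h"
    using rep by (auto simp: represents_def fixed_regs_def st a)
  define R0 where "R0 = R(''l'' := j)"
  have R0: "fixed_regs R0" "R0 ''h'' = h" "R0 ''r'' = r" "R0 ''s'' = s" "R0 ''l'' = j"
    using R by (auto simp: R0_def fixed_regs_def)
  have size: "1 \<le> gsize" by (simp add: gsize_def)
  have const: "?P (return_pmf st')" if "represents B s j st' b" "\<And>x. trial x a = b" for st' b
    using that by (simp add: rel_return_pmf)
  show ?thesis unfolding iteration_def
  proof (rule terminates_Seq_reaches[where t = 1 and u = "190 * gsize"], rule reaches_straight)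
    have eff: "effect ?l st = (R0, M)" using R by (simp add: st R0_def)
    show "terminates (Cond (Reg ''r'') (Seq scan (Cond ?g
         (Seq ?x after_draw) end_run)) Skip) (190 * gsize) ?P
         (effect ?l st)" unfolding eff
    proof (rule terminates_Cond[where t = "180 * gsize"])
      assume "aval (Reg ''r'') (R0, M) = 0"
      then have "r = 0" using R0 by simp
      then have "trial x a = a" for x by (simp add: trial_def a)
      moreover have "represents B s j (R0, M) a"
        using R0 M lin tot by (fastforce simp: represents_def a)
      ultimately have "?P (return_pmf (R0, M))" by (rule const[rotated])
      then show "terminates Skip (180 * gsize) ?P (R0, M)"
        unfolding terminates_def using exec_Skip by blast
    next
      assume "aval (Reg ''r'') (R0, M) \<noteq> 0"
      then have r: "0 < r" using R0 by simp
      have fn: "f n = n" using linked_fix[OF lin] lin by (auto simp: linked_def)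
      show "terminates (Seq scan (Cond ?g
         (Seq ?x after_draw) end_run)) (180 * gsize) ?P (R0, M)"
      proof (rule terminates_Seq_reaches[where t = "10 * gsize" and u = "150 * gsize"],
          rule reaches_scan[OF R0(1) M(2) fn order_refl])
        fix R1 assume R1: "agree {''v''} R0 R1" "R1 ''v'' = (LEAST v. f v = v)"
        define v where "v = (LEAST v. f v = v)"
        have R1': "fixed_regs R1" "R1 ''h'' = h" "R1 ''r'' = r" "R1 ''s'' = s" "R1 ''l'' = j" "R1 ''v'' = v" "R1 ''n'' = n"
          using R0 R1 by (auto simp: agree_def fixed_regs_def v_def)
        show "terminates (Cond ?g
         (Seq ?x after_draw) end_run) (150 * gsize) ?P (R1, M)"
        proof (rule terminates_Cond[where t = "140 * gsize"])
          assume "aval ?g (R1, M) = 0"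
          then have "n \<le> v" using R1' by simp
          then have tr: "trial x a = (id, 0, r - 1, tot)" for x using r by (simp add: trial_def a v_def)
          show "terminates end_run (140 * gsize) ?P (R1, M)"
          proof (rule terminates_reaches[where Q = "\<lambda>s'. represents B s j s' (id, 0, r - 1, tot)"])
            show "reaches end_run (140 * gsize) (\<lambda>s'. represents B s j s' (id, 0, r - 1, tot)) (R1, M)"
              unfolding end_run_def
            proof (rule reaches_Seq[where t = 3 and u = "10 * gsize"], rule reaches_straight, goal_cases)
              case 3
              have eff: "effect (Seq (Assign ''r'' (Minus (Reg ''r'') (Const 1))) (Assign ''h'' (Const 0))) (R1, M)
                = (R1(''r'' := r - 1, ''h'' := 0), M)" using R1' by simp
              show ?case unfolding eff
              proof (rule reaches_reset)
                fix R' M' assume R': "agree {''u''} (R1(''r'' := r - 1, ''h'' := 0)) R'" and M': "links id M'"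
                  "\<And>z. z < base \<or> base + n < z \<Longrightarrow> M' z = M z"
                have "fixed_regs R'" "R' ''h'' = 0" "R' ''r'' = r - 1" "R' ''s'' = s" "R' ''l'' = j"
                  using R1' R' by (auto simp: agree_def fixed_regs_def)
                moreover have "stored_edges M'" using M(1) by (rule stored_edges_cong) (use M'(2) in auto)
                moreover have "M' (tots + u) = tot u \<and> tot u + j \<le> B" if "u < n" for u
                  using tot[OF that] M'(2)[of "tots + u"] by (simp add: tots_def)
                ultimately show "represents B s j (R', M') (id, 0, r - 1, tot)"
                  using M'(1) by (simp add: represents_def linked_def)
              qed (use R1' in \<open>auto simp: fixed_regs_def\<close>)
            qed (use size in auto)
            fix s' assume "represents B s j s' (id, 0, r - 1, tot)"
            then show "?P (return_pmf s')" using tr by (rule const)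
          qed
        next
          assume "aval ?g (R1, M) \<noteq> 0"
          then have vn: "v < n" using R1' by simp
          let ?rel = "\<lambda>s' k. k \<le> aval (Minus (Reg ''n'') (Const 1)) (R1, M) \<and> s' = ((fst (R1, M))(''x'' := k), snd (R1, M))"
          have U: "pmf_of_set {0..aval (Minus (Reg ''n'') (Const 1)) (R1, M)} = pmf_of_set {..<n}"
            using R1' n_pos by (intro arg_cong[of _ _ pmf_of_set]) auto
          have "terminates (Seq ?x after_draw) (140 * gsize)
            (\<lambda>M'. rel_pmf (represents B s j) M' (bind_pmf (pmf_of_set {..<n}) (\<lambda>x. return_pmf (trial x a)))) (R1, M)"
          proof (rule terminates_Seq[where rel = ?rel and t = 1 and u = "100 * gsize"])
            show "terminates ?x 1 (\<lambda>M'. rel_pmf ?rel M' (pmf_of_set {..<n})) (R1, M)"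
              using terminates_Draw[of "''x''" "Minus (Reg ''n'') (Const 1)" "(R1, M)"] unfolding U .
          next
            fix s' x assume "?rel s' x"
            then have s': "s' = (R1(''x'' := x), M)" and xn: "x < n" using R1' n_pos by auto
            have "reaches after_draw (100 * gsize) (\<lambda>s'. represents B s j s' (trial x (f, h, r, tot))) (R1(''x'' := x), M)"
            proof (rule reaches_after_draw[where v = v])
              have "fixed_regs (R1(''x'' := x, ''l'' := Suc j))" using R1' by (simp add: fixed_regs_def)
              then show "represents B s (Suc j) ((R1(''x'' := x))(''l'' := Suc j), M) (f, h, r, tot)"
                using R1' M lin tot by (simp add: represents_def)
            qed (use R1' r vn xn v_def in auto)
            then show "terminates after_draw (100 * gsize)
              (\<lambda>M'. rel_pmf (represents B s j) M' (return_pmf (trial x a))) s'"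
              unfolding s' by (rule terminates_reaches) (simp add: a rel_return_pmf)
          qed (use size in auto)
          then show "terminates (Seq ?x after_draw) (140 * gsize) ?P (R1, M)"
            by (simp add: map_pmf_def)
        qed (use size in auto)
      qed (use size in auto)
    qed (use size in auto)
  qed (use size in auto)
qed

lemma terminates_loop:
  assumes "represents B s j st a"
  shows "terminates (While (Reg ''l'') iteration) (j * (200 * gsize + 2) + 1)
    (\<lambda>M. rel_pmf (represents B s 0) M (chain j a)) st" using assms
proof (induction j arbitrary: st a)
  case 0
  obtain R M f h r tot where "st = (R, M)" "a = (f, h, r, tot)" by (metis prod_cases4 surj_pair)
  then have l: "aval (Reg ''l'') st = 0" using 0 by (simp add: represents_def)
  have "terminates Skip 0 (\<lambda>M. rel_pmf (represents B s 0) M (chain 0 a)) st"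
    unfolding terminates_def using exec_Skip[of st 0] 0 by (intro exI[of _ "return_pmf st"]) (simp add: rel_return_pmf)
  then show ?case by (rule terminates_step[rotated]) (use l in auto)
next
  case (Suc j)
  obtain R M f h r tot where "st = (R, M)" "a = (f, h, r, tot)" by (metis prod_cases4 surj_pair)
  then have l: "aval (Reg ''l'') st \<noteq> 0" using Suc.prems by (simp add: represents_def)
  have "terminates (Seq iteration (While (Reg ''l'') iteration)) (200 * gsize + (j * (200 * gsize + 2) + 1) + 1)
    (\<lambda>M. rel_pmf (represents B s 0) M (bind_pmf (map_pmf (\<lambda>x. trial x a) (pmf_of_set {..<n})) (chain j))) st"
    by (rule terminates_Seq[OF terminates_iteration[OF Suc.prems] Suc.IH order_refl])
  then have "terminates (Seq iteration (While (Reg ''l'') iteration)) (200 * gsize + (j * (200 * gsize + 2) + 1) + 1)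
    (\<lambda>M. rel_pmf (represents B s 0) M (chain (Suc j) a)) st" by (simp add: bind_map_pmf)
  then show ?case by (rule terminates_step[rotated]) (use l in auto)
qed

end

section \<open>The randomised approximation scheme\<close>

lemma reaches_SeqI:
  assumes "reaches c t P s" "\<And>s'. P s' \<Longrightarrow> reaches d u Q s'" "t + u + 1 \<le> T"
  shows "reaches (Seq c d) T Q s"
  by (rule reaches_Seq[OF reaches_mono[OF assms(1) order_refl assms(2)] assms(3)])

lemma concat_pairs_nth:
  "i < length ps \<Longrightarrow> concat (map (\<lambda>(u, v). [u, v]) ps) ! (2 * i) = fst (ps ! i)
    \<and> concat (map (\<lambda>(u, v). [u, v]) ps) ! Suc (2 * i) = snd (ps ! i)"
  by (induction ps arbitrary: i) (auto simp: nth_Cons split: nat.splits)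

lemma length_concat_pairs: "length (concat (map (\<lambda>(u, v). [u, v]) ps)) = 2 * length ps"
  by (induction ps) auto

section \<open>Initialisation, final products and running time\<close>

context encoded_graph
begin

definition init_regs :: "nat \<Rightarrow> nat \<Rightarrow> nat \<Rightarrow> (string \<Rightarrow> nat) \<Rightarrow> bool" where
  "init_regs k s l R \<longleftrightarrow> R ''n'' = n \<and> R ''e'' = length es \<and> R ''k'' = k \<and> R ''h'' = 0 \<and> R ''s'' = s \<and> R ''l'' = l"

lemma reaches_initialise:
  assumes M: "M 0 = p" "M 1 = q" "M 2 = n" "M 3 = length es" "stored_edges M" "\<And>z. base \<le> z \<Longrightarrow> M z = 0"
    and p: "0 < p"
  defines "k \<equiv> (LEAST k. q \<le> k * p)"
  defines "s \<equiv> 64 * n * k ^ 2"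
  defines "B \<equiv> 64 * n ^ 3 * s"
  assumes T: "5 * s + 15 * k + 30 * gsize + 100 \<le> T"
  shows "reaches initialise T (\<lambda>s'. represents B s B s' (id, 0, s, \<lambda>_. 0)) (\<lambda>_. 0, M)"
proof -
  have "q \<le> q * p" using p by simp
  then have k: "q \<le> k * p" unfolding k_def by (rule LeastI)
  have less_k: "i * p < q" if "i < k" for i
    using not_less_Least[of i "\<lambda>k. q \<le> k * p"] that by (simp add: k_def)
  let ?Q = "\<lambda>s'. represents B s B s' (id, 0, s, \<lambda>_. 0)"
  let ?I = "\<lambda>s l s'. snd s' = M \<and> init_regs k s l (fst s')"
  have muls: "reaches (mul ''s'' y) (5 * c + 7) (?I (a * c) l) s'" if I: "?I a l s'" "fst s' y = c" "y \<in> {''n'', ''k''}" for y a l c s'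
  proof -
    obtain R where s': "s' = (R, M)" using I(1) by (metis prod.collapse)
    show ?thesis unfolding s'
      by (rule reaches_mul) (use I in \<open>auto simp: s' init_regs_def agree_def\<close>)
  qed
  have mull: "reaches (mul ''l'' y) (5 * c + 7) (?I a (l * c)) s'" if I: "?I a l s'" "fst s' y = c" "y \<in> {''n'', ''s''}" for y a l c s'
  proof -
    obtain R where s': "s' = (R, M)" using I(1) by (metis prod.collapse)
    show ?thesis unfolding s'
      by (rule reaches_mul) (use I in \<open>auto simp: s' init_regs_def agree_def\<close>)
  qed
  let ?d0 = "Seq (Seq (Assign ''a'' (Plus (Const 4) (Plus (Reg ''e'') (Reg ''e''))))
          (Seq (Assign ''b'' (Plus (Plus (Reg ''a'') (Reg ''n'')) (Const 1))) (Assign ''r'' (Reg ''s''))))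
       reset"
  \<comment> \<open>\<open>?d0\<close> to \<open>?d10\<close> are the successive tails of
    \<open>initialise\<close>, treated from the end backwards.\<close>
  have d0: "reaches ?d0 (10 * gsize + 6) ?Q s'" if I: "?I s B s'" for s'
  proof (rule reaches_Seq[where t = 5 and u = "10 * gsize"], rule reaches_straight, goal_cases)
    case 3
    obtain R where s': "s' = (R, M)" using I by (metis prod.collapse)
    let ?R = "R(''a'' := base, ''b'' := tots, ''r'' := s)"
    have eff: "effect (Seq (Assign ''a'' (Plus (Const 4) (Plus (Reg ''e'') (Reg ''e''))))
          (Seq (Assign ''b'' (Plus (Plus (Reg ''a'') (Reg ''n'')) (Const 1))) (Assign ''r'' (Reg ''s'')))) s' = (?R, M)"
    proof -
      have "R ''e'' = length es" "R ''n'' = n" "R ''s'' = s" using I by (simp_all add: s' init_regs_def)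
      moreover have "base = 2 * length es + 4" by (simp add: base_def)
      ultimately show ?thesis by (simp add: s' tots_def)
    qed
    show ?case unfolding eff
    proof (rule reaches_reset)
      fix R' M' assume R': "agree {''u''} ?R R'" and M': "links id M'" "\<And>z. z < base \<or> base + n < z \<Longrightarrow> M' z = M z"
      have "fixed_regs R'" "R' ''h'' = 0" "R' ''r'' = s" "R' ''s'' = s" "R' ''l'' = B"
        using R' I by (auto simp: agree_def fixed_regs_def init_regs_def s')
      moreover have "stored_edges M'" using M(5) by (rule stored_edges_cong) (use M'(2) in auto)
      moreover have "M' (tots + u) = 0" if "u < n" for u
        using M'(2)[of "tots + u"] M(6)[of "tots + u"] by (simp add: tots_def)
      ultimately show "represents B s B (R', M') (id, 0, s, \<lambda>_. 0)"
        using M'(1) by (simp add: represents_def linked_def)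
    qed (use I in \<open>auto simp: s' init_regs_def\<close>)
  qed auto
  let ?d1 = "Seq (mul ''l'' ''s'') ?d0"
  have "64 * n * n * n * s = B" by (simp add: B_def power3_eq_cube)
  then have d1: "reaches ?d1 ((5 * s + 7) + (10 * gsize + 6) + 1) ?Q s'" if "?I s (64 * n * n * n) s'" for s'
    by (intro reaches_SeqI[OF mull[of s' s "64 * n * n * n" "''s''" s] d0 order_refl]) (use that in \<open>auto simp: init_regs_def\<close>)
  let ?d2 = "Seq (mul ''l'' ''n'') ?d1"
  have d2: "reaches ?d2 ((5 * n + 7) + ((5 * s + 7) + (10 * gsize + 6) + 1) + 1) ?Q s'" if "?I s (64 * n * n) s'" for s'
    by (intro reaches_SeqI[OF mull[of s' s "64 * n * n" "''n''" n] d1 order_refl]) (use that in \<open>auto simp: init_regs_def\<close>)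
  let ?d3 = "Seq (mul ''l'' ''n'') ?d2"
  have d3: "reaches ?d3 (10 * n + 5 * s + 10 * gsize + 30) ?Q s'" if "?I s (64 * n) s'" for s'
    by (intro reaches_SeqI[OF mull[of s' s "64 * n" "''n''" n] d2]) (use that in \<open>auto simp: init_regs_def\<close>)
  let ?d4 = "Seq (mul ''l'' ''n'') ?d3"
  have d4: "reaches ?d4 (15 * n + 5 * s + 10 * gsize + 38) ?Q s'" if "?I s 64 s'" for s'
    by (intro reaches_SeqI[OF mull[of s' s 64 "''n''" n] d3]) (use that in \<open>auto simp: init_regs_def\<close>)
  let ?d5 = "Seq (Assign ''l'' (Const 64)) ?d4"
  have d5: "reaches ?d5 (15 * n + 5 * s + 10 * gsize + 40) ?Q s'" if "?I s 0 s'" for s'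
    by (rule reaches_SeqI[OF _ d4]) (use that in \<open>auto simp: init_regs_def intro!: reaches_straight\<close>)
  let ?d6 = "Seq (mul ''s'' ''k'') ?d5"
  have "64 * n * k * k = s" by (simp add: s_def power2_eq_square)
  then have d6: "reaches ?d6 (5 * k + 15 * n + 5 * s + 10 * gsize + 48) ?Q s'" if "?I (64 * n * k) 0 s'" for s'
    by (intro reaches_SeqI[OF muls[of s' "64 * n * k" 0 "''k''" k] d5]) (use that in \<open>auto simp: init_regs_def\<close>)
  let ?d7 = "Seq (mul ''s'' ''k'') ?d6"
  have d7: "reaches ?d7 (10 * k + 15 * n + 5 * s + 10 * gsize + 56) ?Q s'" if "?I (64 * n) 0 s'" for s'
    by (intro reaches_SeqI[OF muls[of s' "64 * n" 0 "''k''" k] d6]) (use that in \<open>auto simp: init_regs_def\<close>)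
  let ?d8 = "Seq (mul ''s'' ''n'') ?d7"
  have d8: "reaches ?d8 (10 * k + 20 * n + 5 * s + 10 * gsize + 64) ?Q s'" if "?I 64 0 s'" for s'
    by (intro reaches_SeqI[OF muls[of s' 64 0 "''n''" n] d7]) (use that in \<open>auto simp: init_regs_def\<close>)
  let ?d9 = "Seq (Assign ''s'' (Const 64)) ?d8"
  have d9: "reaches ?d9 (10 * k + 20 * n + 5 * s + 10 * gsize + 66) ?Q s'" if "?I 0 0 s'" for s'
    by (rule reaches_SeqI[OF _ d8]) (use that in \<open>auto simp: init_regs_def intro!: reaches_straight\<close>)
  let ?w = "Seq (Assign ''w'' (Plus (Reg ''w'') (Mem (Const 0)))) (Assign ''k'' (Plus (Reg ''k'') (Const 1)))"
  let ?J = "\<lambda>i s'. snd s' = M \<and> init_regs i 0 0 (fst s') \<and> fst s' ''w'' = i * p"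
  have loop: "reaches (While (Minus (Mem (Const 1)) (Reg ''w'')) ?w) (5 * k + 1) (?I 0 0) s'" if "?J 0 s'" for s'
  proof (rule reaches_While[where I = ?J and N = k and t = 3])
    show "?J 0 s'" by (rule that)
  next
    fix i s' assume i: "i < k" and J: "?J i s'"
    obtain R where s': "s' = (R, M)" using J by (metis prod.collapse)
    have "aval (Minus (Mem (Const 1)) (Reg ''w'')) s' \<noteq> 0" using less_k[OF i] J M by (simp add: s')
    moreover have "effect ?w s' = (R(''w'' := i * p + p, ''k'' := i + 1), M)"
      using J M by (simp add: s' init_regs_def)
    then have "?J (Suc i) (effect ?w s')" using J by (simp add: s' init_regs_def)
    then have "reaches ?w 3 (?J (Suc i)) s'" by (intro reaches_straight) auto
    ultimately show "aval (Minus (Mem (Const 1)) (Reg ''w'')) s' \<noteq> 0 \<and> reaches ?w 3 (?J (Suc i)) s'" ..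
  next
    fix s' assume J: "?J k s'"
    then show "aval (Minus (Mem (Const 1)) (Reg ''w'')) s' = 0 \<and> ?I 0 0 s'" using k M by simp
  qed simp
  let ?d10 = "Seq (While (Minus (Mem (Const 1)) (Reg ''w'')) ?w) ?d9"
  have d10: "reaches ?d10 (15 * k + 20 * n + 5 * s + 10 * gsize + 68) ?Q s'" if "?J 0 s'" for s'
    by (rule reaches_SeqI[OF loop[OF that] d9]) auto
  show ?thesis unfolding initialise_def
  proof (rule reaches_SeqI[where P = "?J 0" and t = 7, OF _ d10], rule reaches_straight, goal_cases)
    case 3
    show ?case using M by (simp add: init_regs_def)
  qed (use T in \<open>auto simp: gsize_def\<close>)
qed

lemma reaches_finalise:
  assumes rep: "represents B s 0 st (f, h, r, tot)"
    and T: "n * (5 * (n * s) + 5 * B + 22) + 5 * n + 30 \<le> T"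
  shows "reaches finalise T (\<lambda>s'. snd s' 0 = (n * s) ^ n \<and> snd s' 1 = (\<Prod>i<n. tot i)) st"
proof -
  obtain R M where st: "st = (R, M)" by (cases st)
  have R: "R ''n'' = n" "R ''b'' = tots" "R ''s'' = s" and M: "\<And>u. u < n \<Longrightarrow> M (tots + u) = tot u \<and> tot u \<le> B"
    using rep by (auto simp: represents_def fixed_regs_def st)
  let ?Q = "\<lambda>s'. snd s' 0 = (n * s) ^ n \<and> snd s' 1 = (\<Prod>i<n. tot i)"
  let ?I = "\<lambda>i s'. snd s' = M \<and> fst s' ''n'' = n \<and> fst s' ''b'' = tots \<and> fst s' ''w'' = n * s \<and>
     fst s' ''v'' = i \<and> fst s' ''x'' = (n * s) ^ i \<and> fst s' ''y'' = (\<Prod>j<i. tot j)"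
  let ?body = "Seq (mul ''x'' ''w'') (Seq (Assign ''q'' (Mem (Plus (Reg ''b'') (Reg ''v''))))
         (Seq (mul ''y'' ''q'') (Assign ''v'' (Plus (Reg ''v'') (Const 1)))))"
  have body: "reaches ?body (5 * (n * s) + 5 * B + 20) (?I (Suc i)) s'" if i: "i < n" and I: "?I i s'" for i s'
  proof -
    obtain R where s': "s' = (R, M)" using I by (metis prod.collapse)
    show ?thesis unfolding s'
    proof (rule reaches_Seq[where t = "5 * (n * s) + 7" and u = "5 * B + 12"], rule reaches_mul)
      fix R1 assume R1: "agree {''x'', ''t'', ''i''} R R1" "R1 ''x'' = R ''x'' * R ''w''"
      have r1: "R1 ''n'' = n" "R1 ''b'' = tots" "R1 ''w'' = n * s" "R1 ''v'' = i" "R1 ''x'' = (n * s) ^ Suc i"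
        "R1 ''y'' = (\<Prod>j<i. tot j)" using R1 I by (auto simp: s' agree_def mult.commute)
      show "reaches (Seq (Assign ''q'' (Mem (Plus (Reg ''b'') (Reg ''v''))))
         (Seq (mul ''y'' ''q'') (Assign ''v'' (Plus (Reg ''v'') (Const 1))))) (5 * B + 12) (?I (Suc i)) (R1, M)"
      proof (rule reaches_Seq[where t = 1 and u = "5 * tot i + 8 + 1"], rule reaches_straight, goal_cases)
        case 3
        have eff: "effect (Assign ''q'' (Mem (Plus (Reg ''b'') (Reg ''v'')))) (R1, M) = (R1(''q'' := tot i), M)"
          using r1 M[OF i] by simp
        show ?case unfolding eff
        proof (rule reaches_Seq[where t = "5 * tot i + 7" and u = 1], rule reaches_mul)
          fix R2 assume R2: "agree {''y'', ''t'', ''i''} (R1(''q'' := tot i)) R2"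
            "R2 ''y'' = (R1(''q'' := tot i)) ''y'' * (R1(''q'' := tot i)) ''q''"
          show "reaches (Assign ''v'' (Plus (Reg ''v'') (Const 1))) 1 (?I (Suc i)) (R2, M)"
            by (rule reaches_straight) (use R2 r1 in \<open>auto simp: agree_def\<close>)
        qed auto
      qed (use M[OF i] in auto)
    qed (use I in \<open>auto simp: s'\<close>)
  qed
  have loop: "reaches (While (Minus (Reg ''n'') (Reg ''v'')) ?body) (n * (5 * (n * s) + 5 * B + 22) + 1) (?I n) s'"
    if "?I 0 s'" for s'
  proof (rule reaches_While[where I = ?I and N = n and t = "5 * (n * s) + 5 * B + 20"])
    show "?I 0 s'" by (rule that)
  next
    fix i s' assume i: "i < n" and I: "?I i s'"
    show "aval (Minus (Reg ''n'') (Reg ''v'')) s' \<noteq> 0 \<and> reaches ?body (5 * (n * s) + 5 * B + 20) (?I (Suc i)) s'"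
      using body[OF i I] I i by simp
  qed auto
  let ?c1 = "Seq (Store (Const 0) (Reg ''x'')) (Store (Const 1) (Reg ''y''))"
  have c1: "reaches ?c1 3 ?Q s'" if "?I n s'" for s' by (rule reaches_straight) (use that in auto)
  let ?c2 = "Seq (While (Minus (Reg ''n'') (Reg ''v'')) ?body) ?c1"
  have c2: "reaches ?c2 (n * (5 * (n * s) + 5 * B + 22) + 5) ?Q s'" if "?I 0 s'" for s'
    by (rule reaches_SeqI[OF loop[OF that] c1]) auto
  let ?init = "Seq (Assign ''x'' (Const 1)) (Seq (Assign ''y'' (Const 1)) (Assign ''v'' (Const 0)))"
  let ?W = "\<lambda>s'. snd s' = M \<and> fst s' ''n'' = n \<and> fst s' ''b'' = tots \<and> fst s' ''w'' = n * s"
  have c3: "reaches (Seq ?init ?c2) (n * (5 * (n * s) + 5 * B + 22) + 11) ?Q s'" if "?W s'" for s'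
  proof (rule reaches_SeqI[where P = "?I 0" and t = 5, OF _ c2])
    show "reaches ?init 5 (?I 0) s'" by (rule reaches_straight) (use that in auto)
  qed auto
  have c4: "reaches (mul ''w'' ''n'') (5 * n + 7) ?W (R(''w'' := s), M)"
    by (rule reaches_mul) (use R in \<open>auto simp: agree_def mult.commute\<close>)
  show ?thesis unfolding finalise_def st
  proof (rule reaches_Seq[where t = 1 and u = "n * (5 * (n * s) + 5 * B + 22) + 5 * n + 20"], rule reaches_straight, goal_cases)
    case 3
    have "effect (Assign ''w'' (Reg ''s'')) (R, M) = (R(''w'' := s), M)" using R by simp
    then show ?case using reaches_SeqI[OF c4 c3] by simp
  qed (use T in auto)
qed

lemma approx_count_run:
  fixes p q :: nat
  assumes p: "0 < p" "p < q"
  defines "e \<equiv> real p / real q"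
  defines "ws \<equiv> p # q # n # length es # concat (map (\<lambda>(u, v). [u, v]) es)"
  shows "\<exists>t. real t \<le> 10 ^ 9 * real n ^ 4 * real (length es) / e ^ 2 \<and> halts_within approx_count ws t \<and>
    measure_pmf.prob (output_dist approx_count ws t)
      {z. (1 - e) * card (good {..<n}) \<le> z \<and> z \<le> (1 + e) * card (good {..<n})} \<ge> 3 / 4"
proof -
  define k where "k = (LEAST k. q \<le> k * p)"
  define s where "s = 64 * n * k ^ 2"
  define B where "B = 64 * n ^ 3 * s"
  define m where "m = length es"
  have "q \<le> q * p" using p by simp
  then have k: "q \<le> k * p" unfolding k_def by (rule LeastI)
  have k0: "0 < k" using k p by (cases k) auto
  have "\<not> q \<le> (k - 1) * p" using not_less_Least[of "k - 1" "\<lambda>k. q \<le> k * p"] k0 by (simp add: k_def)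
  \<comment> \<open>This is minimality of \<open>k\<close>; with \<open>p < q\<close> it yields
    \<open>k \<le> 2 / e\<close>.\<close>
  then have "k * p < q + p" using k0 by (cases k) auto
  have e: "0 < e" "e < 1" using p by (auto simp: e_def)
  have ke: "1 / real k \<le> e"
  proof -
    have "real q \<le> real k * real p" using k by (metis of_nat_le_iff of_nat_mult)
    then show ?thesis using k0 p by (simp add: e_def field_simps)
  qed
  have k2: "real k \<le> 2 / e"
  proof -
    have "k * p \<le> 2 * q" using \<open>k * p < q + p\<close> p by simp
    then have "real k * real p \<le> 2 * real q" by (metis of_nat_le_iff of_nat_mult of_nat_numeral)
    then show ?thesis using p by (simp add: e_def field_simps)
  qed
  define M where "M = snd (initial_state ws)"
  have init: "initial_state ws = (\<lambda>_. 0, M)" by (simp add: M_def initial_state_def)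
  have len: "length ws = 4 + 2 * length es" by (simp add: ws_def length_concat_pairs)
  have Mi: "M 0 = p" "M 1 = q" "M 2 = n" "M 3 = length es"
    by (simp_all add: M_def initial_state_def ws_def numeral_2_eq_2 numeral_3_eq_3)
  have edges: "stored_edges M"
  proof -
    have "M (4 + 2 * i) = fst (es ! i) \<and> M (5 + 2 * i) = snd (es ! i)" if i: "i < length es" for i
    proof -
      have "ws ! (4 + j) = concat (map (\<lambda>(u, v). [u, v]) es) ! j" for j
        by (simp add: ws_def numeral_eq_Suc)
      from this[of "2 * i"] this[of "Suc (2 * i)"] show ?thesis
        using concat_pairs_nth[OF i] i by (simp add: M_def initial_state_def len)
    qed
    then show ?thesis by (simp add: stored_edges_def)
  qed
  have zero: "M z = 0" if "base \<le> z" for z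
    using that by (simp add: M_def initial_state_def len base_def)
  let ?Ti = "5 * s + 15 * k + 30 * gsize + 100"
  let ?Tl = "B * (200 * gsize + 2) + 1"
  let ?Tf = "n * (5 * (n * s) + 5 * B + 22) + 5 * n + 30"
  define t where "t = ?Ti + (?Tl + ?Tf + 1) + 1"
  let ?fin = "\<lambda>(st :: state) (f, h, r, tot). snd st 0 = (n * s) ^ n \<and> snd st 1 = (\<Prod>i<n. tot i)"
  let ?a = "(id, 0, s, \<lambda>_. 0) :: chain_state"
  have "terminates approx_count t (\<lambda>D. rel_pmf ?fin D (bind_pmf (chain B ?a) return_pmf)) (\<lambda>_. 0, M)"
    unfolding approx_count_def
  proof (rule terminates_Seq_reaches)
    have i: "reaches initialise ?Ti (\<lambda>s'. represents B s B s' ?a) (\<lambda>_. 0, M)"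
      by (rule reaches_initialise[of M p q, folded k_def, folded s_def, folded B_def])
        (use Mi edges zero p(1) in auto)
    show "reaches initialise ?Ti (\<lambda>st. terminates (Seq (While (Reg ''l'') iteration) finalise) (?Tl + ?Tf + 1)
        (\<lambda>D. rel_pmf ?fin D (bind_pmf (chain B ?a) return_pmf)) st) (\<lambda>_. 0, M)"
    proof (rule reaches_mono[OF i order_refl])
      fix st assume st: "represents B s B st ?a"
      show "terminates (Seq (While (Reg ''l'') iteration) finalise) (?Tl + ?Tf + 1)
        (\<lambda>D. rel_pmf ?fin D (bind_pmf (chain B ?a) return_pmf)) st"
      proof (rule terminates_Seq[OF terminates_loop[OF st] _ order_refl])
        fix st' a assume r: "represents B s 0 st' a"
        obtain f h r tot where a: "a = (f, h, r, tot)" by (metis prod_cases4)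
        show "terminates finalise ?Tf (\<lambda>D. rel_pmf ?fin D (return_pmf a)) st'"
          by (rule terminates_reaches[OF reaches_finalise[OF r[unfolded a] order_refl]]) (simp add: a rel_return_pmf)
      qed
    qed
  qed (simp add: t_def)
  then obtain D where D: "exec approx_count (initial_state ws) t D" "rel_pmf ?fin D (chain B ?a)"
    unfolding terminates_def init by (auto simp: bind_return_pmf')
  have run: "run t (approx_count, initial_state ws) = map_pmf (Pair Skip) D"
    using D(1) by (simp add: exec_def)
  have "halts_within approx_count ws t" by (auto simp: halts_within_def run)
  moreover have "3 / 4 \<le> measure_pmf.prob (output_dist approx_count ws t)
      {z. (1 - e) * card (good {..<n}) \<le> z \<and> z \<le> (1 + e) * card (good {..<n})}"
  proof -
    let ?Z = "{z. (1 - e) * card (good {..<n}) \<le> z \<and> z \<le> (1 + e) * card (good {..<n})}"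
    let ?G = "{(f, h, r, tot). (1 - e) * card (good {..<n}) \<le> (\<Prod>i<n. real (n * s) / tot i) \<and>
       (\<Prod>i<n. real (n * s) / tot i) \<le> (1 + e) * card (good {..<n})} :: chain_state set"
    have "3 / 4 \<le> measure_pmf.prob (chain B ?a) ?G"
      using chain_accuracy[OF k0 ke e(2)] unfolding s_def[symmetric] B_def[symmetric] .
    also have "rel_pmf ?fin\<inverse>\<inverse> (chain B ?a) D" using D(2) by (simp add: pmf.rel_flip)
    then have "measure_pmf.prob (chain B ?a) ?G \<le> measure_pmf.prob D {y. \<exists>x\<in>?G. ?fin\<inverse>\<inverse> x y}"
      by (rule rel_pmf_measureD)
    also have "\<dots> \<le> measure_pmf.prob D (result -` ?Z)"
    proof (rule measure_pmf.finite_measure_mono)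
      show "{y. \<exists>x\<in>?G. ?fin\<inverse>\<inverse> x y} \<subseteq> result -` ?Z"
      proof
        fix st assume "st \<in> {y. \<exists>x\<in>?G. ?fin\<inverse>\<inverse> x y}"
        then obtain f h r tot where g: "(f, h, r, tot) \<in> ?G"
          and st: "snd st 0 = (n * s) ^ n" "snd st 1 = (\<Prod>i<n. tot i)" by auto
        have "result st = (\<Prod>i<n. real (n * s) / real (tot i))"
          unfolding result_def st by (simp add: prod_dividef del: of_nat_mult)
        then show "st \<in> result -` ?Z" using g by simp
      qed
    qed simp
    also have "\<dots> = measure_pmf.prob (output_dist approx_count ws t) ?Z"
      by (simp add: output_dist_def run pmf.map_comp o_def)
    finally show ?thesis .
  qed
  moreover have "real t \<le> 10 ^ 9 * real n ^ 4 * real (length es) / e ^ 2"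
  proof -
    have m: "n \<le> m"
    proof -
      have "card E \<le> card (set es)" unfolding edges_es by (rule card_image_le) simp
      then show ?thesis using card_edges card_length[of es] by (simp add: m_def)
    qed
    \<comment> \<open>All parts of the running time are bounded by multiples of
      \<open>P * m\<close>; the main loop dominates, with \<open>4096 * P\<close> iterations of cost
      linear in \<open>m\<close>.\<close>
    define P where "P = n ^ 4 * k ^ 2"
    have n1: "1 \<le> n" and k1: "1 \<le> k" using n_pos k0 by auto
    have "n ^ 4 = n ^ 3 * n" by (simp add: eval_nat_numeral)
    then have B: "B = 4096 * P" by (simp add: B_def s_def P_def algebra_simps)
    have Pn: "n ^ j * k ^ i \<le> P" if "j \<le> 4" "i \<le> 2" for i j
      unfolding P_def using that n1 k1 by (intro mult_mono power_increasing) auto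
    have s: "s \<le> 64 * P" "n * (n * s) \<le> 64 * P"
      using Pn[of 1 2] Pn[of 3 2] by (simp_all add: s_def power3_eq_cube algebra_simps)
    have P1: "1 \<le> P" "n \<le> P" "k \<le> P" using Pn[of 0 0] Pn[of 1 0] Pn[of 0 1] by auto
    have Pm: "P \<le> P * m" "m \<le> P * m" "1 \<le> P * m" using P1 m n1 by auto
    have size: "gsize \<le> 3 * m" using m n1 by (simp add: gsize_def m_def)
    have 1: "?Ti \<le> 1000 * (P * m)" using s P1 Pm size by linarith
    have 2: "?Tl \<le> 3000000 * (P * m)"
    proof -
      have "B * (200 * gsize + 2) \<le> B * (602 * m)"
        by (rule mult_left_mono) (use size m n1 in auto)
      also have "\<dots> = 2465792 * (P * m)" by (simp add: B)
      finally show ?thesis using Pm by linarith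
    qed
    have 3: "?Tf \<le> 30000 * (P * m)"
    proof -
      have "?Tf = 5 * (n * (n * s)) + 5 * (n * B) + 27 * n + 30" by (simp add: algebra_simps)
      moreover have "n * B \<le> 4096 * (P * m)" using m by (simp add: B mult.commute)
      ultimately show ?thesis using s P1 Pm by linarith
    qed
    have "t \<le> 4000000 * (P * m)" unfolding t_def using 1 2 3 Pm by linarith
    then have "real t \<le> real (4000000 * (P * m))" by (simp only: of_nat_le_iff)
    also have "\<dots> = 4000000 * (real n ^ 4 * real m) * real k ^ 2" by (simp add: P_def)
    also have "\<dots> \<le> 4000000 * (real n ^ 4 * real m) * (2 / e) ^ 2"
      using k2 by (intro mult_left_mono power_mono) auto
    also have "\<dots> \<le> 10 ^ 9 * (real n ^ 4 * real m) * (1 / e ^ 2)"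
      using e by (simp add: power_divide mult_right_mono divide_right_mono)
    finally show ?thesis by (simp add: m_def mult.assoc)
  qed
  ultimately show ?thesis by blast
qed

end

lemma encoded_graph_input:
  assumes "(n, es) \<in> bicircular_inputs"
  shows "encoded_graph n (edges (n, es)) es" "card (edges (n, es)) = length es"
proof -
  have G: "distinct (map (\<lambda>(u, v). {u, v}) es)" "simple_graph {..<n} (edges (n, es))"
    "connected_graph {..<n} (edges (n, es))" "n \<le> card (edges (n, es))"
    using assms by (auto simp: bicircular_inputs_def vertices_def)
  show "encoded_graph n (edges (n, es)) es"
    by unfold_locales (use G in \<open>auto simp: simple_graph_def edges_def\<close>)
  show "card (edges (n, es)) = length es" using distinct_card[OF G(1)] by (simp add: edges_def)
qed

lemma approx_count_scheme:
  "approx_scheme_in_time bicircular_inputs encode_graph num_bases approx_count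
     (\<lambda>G \<epsilon>. 10 ^ 9 * real (card (vertices G)) ^ 3 * real (card (edges G)) ^ 2 / \<epsilon> ^ 2)"
  unfolding approx_scheme_in_time_def
proof (intro ballI allI impI)
  fix G :: graph_input and p q :: nat and \<epsilon> :: real
  assume G: "G \<in> bicircular_inputs" and pq: "0 < p \<and> p < q \<and> \<epsilon> = real p / real q"
  obtain n es where Ge: "G = (n, es)" by (cases G)
  interpret encoded_graph n "edges (n, es)" es by (rule encoded_graph_input(1)) (use G Ge in simp)
  have m: "card (edges (n, es)) = length es" by (rule encoded_graph_input(2)) (use G Ge in simp)
  have ws: "p # q # encode_graph G = p # q # n # length es # concat (map (\<lambda>(u, v). [u, v]) es)"
    by (simp add: Ge encode_graph_def)
  have N: "num_bases G = card (good {..<n})" by (simp add: Ge num_bases_def vertices_def card_bases)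
  obtain t where t: "real t \<le> 10 ^ 9 * real n ^ 4 * real (length es) / \<epsilon> ^ 2"
    "halts_within approx_count (p # q # encode_graph G) t"
    "measure_pmf.prob (output_dist approx_count (p # q # encode_graph G) t)
      {z. (1 - \<epsilon>) * card (good {..<n}) \<le> z \<and> z \<le> (1 + \<epsilon>) * card (good {..<n})} \<ge> 3 / 4"
    using approx_count_run[of p q] pq unfolding ws by blast
  \<comment> \<open>One factor \<open>n\<close> is traded for \<open>m\<close>, as
    \<open>n \<le> m\<close>.\<close>
  have "real n ^ 4 * real (length es) \<le> real n ^ 3 * real (length es) ^ 2"
  proof -
    have "real n \<le> real (length es)" using card_edges m by simp
    then have "real n ^ 3 * real (length es) * real n \<le> real n ^ 3 * real (length es) * real (length es)"
      by (rule mult_left_mono) simp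
    then show ?thesis by (simp add: eval_nat_numeral algebra_simps)
  qed
  then have "10 ^ 9 * (real n ^ 4 * real (length es)) / \<epsilon> ^ 2 \<le> 10 ^ 9 * (real n ^ 3 * real (length es) ^ 2) / \<epsilon> ^ 2"
    by (intro divide_right_mono mult_left_mono) auto
  then have "real t \<le> 10 ^ 9 * real (card (vertices G)) ^ 3 * real (card (edges G)) ^ 2 / \<epsilon> ^ 2"
    using t(1) by (simp add: Ge vertices_def m mult.assoc)
  then show "\<exists>t. real t \<le> 10 ^ 9 * real (card (vertices G)) ^ 3 * real (card (edges G)) ^ 2 / \<epsilon> ^ 2 \<and>
      halts_within approx_count (p # q # encode_graph G) t \<and>
      measure_pmf.prob (output_dist approx_count (p # q # encode_graph G) t)
        {z. (1 - \<epsilon>) * real (num_bases G) \<le> z \<and> z \<le> (1 + \<epsilon>) * real (num_bases G)} \<ge> 3 / 4"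
    using t(2,3) unfolding N by blast
qed

lemma approx_scheme_in_time_mono:
  assumes "approx_scheme_in_time I enc N P T"
    and "\<And>x p q. x \<in> I \<Longrightarrow> 0 < p \<Longrightarrow> p < q \<Longrightarrow> T x (real p / real q) \<le> T' x (real p / real q)"
  shows "approx_scheme_in_time I enc N P T'" unfolding approx_scheme_in_time_def
proof (intro ballI allI impI)
  fix x and p q :: nat and \<epsilon> :: real
  assume x: "x \<in> I" and pq: "0 < p \<and> p < q \<and> \<epsilon> = real p / real q"
  have "T x \<epsilon> \<le> T' x \<epsilon>" using assms(2)[OF x, of p q] pq by simp
  moreover obtain t where "real t \<le> T x \<epsilon>" "halts_within P (p # q # enc x) t"
    "measure_pmf.prob (output_dist P (p # q # enc x) t)
       {z. (1 - \<epsilon>) * real (N x) \<le> z \<and> z \<le> (1 + \<epsilon>) * real (N x)} \<ge> 3 / 4"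
    using assms(1) x pq unfolding approx_scheme_in_time_def by blast
  ultimately show "\<exists>t. real t \<le> T' x \<epsilon> \<and> halts_within P (p # q # enc x) t \<and>
      measure_pmf.prob (output_dist P (p # q # enc x) t)
       {z. (1 - \<epsilon>) * real (N x) \<le> z \<and> z \<le> (1 + \<epsilon>) * real (N x)} \<ge> 3 / 4"
    by (meson order_trans)
qed

text \<open>The numbers of vertices and edges and \<open>1 / \<epsilon>\<close> are each at most the
  base \<open>L\<close> of the polynomial bound; the exponent 7 is 3 + 2 + 2.\<close>

lemma approx_count_fpras: "is_fpras bicircular_inputs encode_graph num_bases approx_count"
  unfolding is_fpras_def
proof (intro exI, rule approx_scheme_in_time_mono[OF approx_count_scheme])
  fix G :: graph_input and p q :: nat
  assume G: "G \<in> bicircular_inputs" and p: "0 < p" "p < q"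
  obtain n es where Ge: "G = (n, es)" by (cases G)
  interpret encoded_graph n "edges (n, es)" es by (rule encoded_graph_input(1)) (use G Ge in simp)
  have m: "card (edges (n, es)) = length es" by (rule encoded_graph_input(2)) (use G Ge in simp)
  define e where "e = real p / real q"
  have e: "0 < e" using p by (simp add: e_def)
  define L where "L = real (length (encode_graph G)) + 1 / e"
  have len: "length (encode_graph G) = 2 + 2 * length es" by (simp add: Ge encode_graph_def length_concat_pairs)
  have L: "real n \<le> L" "real (length es) \<le> L" "1 / e \<le> L" "0 \<le> L"
    using card_edges m e by (simp_all add: L_def len add_increasing add_increasing2)
  have "10 ^ 9 * real n ^ 3 * real (length es) ^ 2 / e ^ 2 = 10 ^ 9 * (real n ^ 3 * real (length es) ^ 2 * (1 / e) ^ 2)"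
    by (simp add: power_divide)
  also have "\<dots> \<le> 10 ^ 9 * (L ^ 3 * L ^ 2 * L ^ 2)"
    using L e by (intro mult_left_mono mult_mono power_mono) auto
  also have "\<dots> = 10 ^ 9 * L ^ 7" by (simp add: power_add[symmetric])
  finally show "10 ^ 9 * real (card (vertices G)) ^ 3 * real (card (edges G)) ^ 2 / (real p / real q) ^ 2
      \<le> 10 ^ 9 * (real (length (encode_graph G)) + 1 / (real p / real q)) ^ 7"
    unfolding L_def e_def[symmetric] by (simp add: Ge vertices_def m)
qed

theorem theorem5p1:
  "\<exists>P :: com.
     is_fpras bicircular_inputs encode_graph num_bases P \<and>
     (\<exists>C :: real. approx_scheme_in_time bicircular_inputs encode_graph num_bases P
        (\<lambda>G \<epsilon>. C * real (card (vertices G)) ^ 3 * real (card (edges G)) ^ 2 / \<epsilon> ^ 2))"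
  using approx_count_fpras approx_count_scheme by blast

end
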